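(* Let $(M^2,\omega_0)$ be a real-analytic symplectic 2-manifold and let a singular (Lagrangian) fibration on a neighbourhood of a point $P\in M^2$ be given by the level sets of a real-analytic function having an $A_2$ singularity at $P$. Then, in a neighbourhood of $P$, one can always find real-analytic local coordinates $x,y$ (vanishing at $P$) and a real-analytic function germ $f$ in one variable at $0$ such that the fibration is defined by the function $H=y^3-x^2$ and the symplectic structure takes the form $$\omega_0 = dx\wedge dy + f(y^3-x^2)\, y\, dx\wedge dy .$$ In this representation the real-analytic function (germ) $f$ is uniquely defined.
   Context: A real-analytic function germ $G$ of two real variables has an $A_2$ singularity at $P$ if in suitable real-analytic local coordinates $(u,v)$ centred at $P$ it has the form $G-G(P)=\pm u^2\pm v^3$. The fibration is considered as an object independent of the chosen function: "the fibration is defined by $H$" means that the given function is, near $P$, of the form $h(H)$ with $h$ a real-analytic germ, $h'(0)\ne 0$. All objects (functions, forms, coordinate changes) are real-analytic. *)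

theory Defs
  imports "HOL-Analysis.Analysis"
begin

definition analytic1_at :: "(real \<Rightarrow> real) \<Rightarrow> real \<Rightarrow> bool" where
  "analytic1_at f a \<longleftrightarrow>
     (\<exists>c. \<exists>r>0. \<forall>t. \<bar>t - a\<bar> < r \<longrightarrow> (\<lambda>n. c n * (t - a) ^ n) sums f t)"

text \<open>
  The unordered sum \<open>has_sum\<close> is absolute convergence of the double power series.
\<close>

definition analytic2_at :: "(real \<times> real \<Rightarrow> real) \<Rightarrow> real \<times> real \<Rightarrow> bool" where
  "analytic2_at f p \<longleftrightarrow>
     (\<exists>c :: nat \<times> nat \<Rightarrow> real. \<exists>r>0. \<forall>x y. \<bar>x - fst p\<bar> < r \<and> \<bar>y - snd p\<bar> < r \<longrightarrow>
        ((\<lambda>(i, j). c (i, j) * (x - fst p) ^ i * (y - snd p) ^ j) has_sum f (x, y)) UNIV)"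

text \<open>
  A chart is a pair \<open>(U, \<phi>)\<close>; only the values of \<open>\<phi>\<close> on \<open>U\<close> are meaningful.
\<close>

type_synonym 'a chart = "'a set \<times> ('a \<Rightarrow> real \<times> real)"

definition is_chart :: "'a topology \<Rightarrow> 'a chart \<Rightarrow> bool" where
  "is_chart X c \<longleftrightarrow> (case c of (U, \<phi>) \<Rightarrow>
     openin X U \<and> open (\<phi> ` U) \<and>
     homeomorphic_map (subtopology X U) (top_of_set (\<phi> ` U)) \<phi>)"

definition chart_inv :: "'a chart \<Rightarrow> real \<times> real \<Rightarrow> 'a" where
  "chart_inv c = inv_into (fst c) (snd c)"

definition transition :: "'a chart \<Rightarrow> 'a chart \<Rightarrow> real \<times> real \<Rightarrow> real \<times> real" where
  "transition c d = snd d \<circ> chart_inv c"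

definition overlap :: "'a chart \<Rightarrow> 'a chart \<Rightarrow> (real \<times> real) set" where
  "overlap c d = snd c ` (fst c \<inter> fst d)"

definition analytic_transition :: "'a chart \<Rightarrow> 'a chart \<Rightarrow> bool" where
  "analytic_transition c d \<longleftrightarrow>
     (\<forall>z\<in>overlap c d. analytic2_at (fst \<circ> transition c d) z \<and> analytic2_at (snd \<circ> transition c d) z)"

definition analytic_compatible :: "'a chart \<Rightarrow> 'a chart \<Rightarrow> bool" where
  "analytic_compatible c d \<longleftrightarrow> analytic_transition c d \<and> analytic_transition d c"

text \<open>
  The atlas \<open>A\<close> is required to be maximal, so that its members are exactly the
  real-analytic local coordinate systems.
\<close>

definition analytic_surface :: "'a topology \<Rightarrow> 'a chart set \<Rightarrow> bool" where
  "analytic_surface X A \<longleftrightarrow>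
     Hausdorff_space X \<and> second_countable X \<and>
     (\<forall>c\<in>A. is_chart X c) \<and>
     (\<Union>c\<in>A. fst c) = topspace X \<and>
     (\<forall>c\<in>A. \<forall>d\<in>A. analytic_compatible c d) \<and>
     (\<forall>c. is_chart X c \<and> (\<forall>d\<in>A. analytic_compatible c d) \<longrightarrow> c \<in> A)"

definition coords_centred_at :: "'a chart set \<Rightarrow> 'a \<Rightarrow> 'a chart \<Rightarrow> bool" where
  "coords_centred_at A P c \<longleftrightarrow> c \<in> A \<and> P \<in> fst c \<and> snd c P = 0"

definition analytic_fun_on :: "'a chart set \<Rightarrow> 'a set \<Rightarrow> ('a \<Rightarrow> real) \<Rightarrow> bool" where
  "analytic_fun_on A W G \<longleftrightarrow>
     (\<forall>c\<in>A. \<forall>q \<in> W \<inter> fst c. analytic2_at (G \<circ> chart_inv c) (snd c q))"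

text \<open>
  A 2-form is given by its local expressions: \<open>\<omega> c z v w\<close> is the value, in the chart \<open>c\<close>
  and at the coordinate point \<open>z\<close>, on the vectors with components \<open>v\<close> and \<open>w\<close>. The
  local expressions are related by pullback along the transition maps.
\<close>

type_synonym form2 = "real \<times> real \<Rightarrow> real \<times> real \<Rightarrow> real"

type_synonym 'a form2_field = "'a chart \<Rightarrow> real \<times> real \<Rightarrow> form2"

definition dx_wedge_dy :: form2 where
  "dx_wedge_dy v w = fst v * snd w - snd v * fst w"

definition analytic_2form :: "'a chart set \<Rightarrow> 'a form2_field \<Rightarrow> bool" where
  "analytic_2form A \<omega> \<longleftrightarrow>
     (\<forall>c\<in>A. \<forall>z \<in> snd c ` fst c.
        bilinear (\<omega> c z) \<and> (\<forall>v. \<omega> c z v v = 0) \<and>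
        (\<forall>v w. analytic2_at (\<lambda>z'. \<omega> c z' v w) z)) \<and>
     (\<forall>c\<in>A. \<forall>d\<in>A. \<forall>z \<in> overlap c d. \<forall>v w.
        \<omega> c z v w =
          \<omega> d (transition c d z)
            (frechet_derivative (transition c d) (at z) v)
            (frechet_derivative (transition c d) (at z) w))"

text \<open>
  A symplectic form is a closed nondegenerate 2-form. On a surface every 3-form vanishes,
  so closedness is automatic and only nondegeneracy has to be required.
\<close>

definition symplectic_form :: "'a chart set \<Rightarrow> 'a form2_field \<Rightarrow> bool" where
  "symplectic_form A \<omega> \<longleftrightarrow>
     analytic_2form A \<omega> \<and>
     (\<forall>c\<in>A. \<forall>z \<in> snd c ` fst c. \<forall>v. (\<forall>w. \<omega> c z v w = 0) \<longrightarrow> v = 0)"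

definition A2_singularity :: "'a topology \<Rightarrow> 'a chart set \<Rightarrow> 'a \<Rightarrow> ('a \<Rightarrow> real) \<Rightarrow> bool" where
  "A2_singularity X A P G \<longleftrightarrow>
     (\<exists>c. coords_centred_at A P c \<and>
        (\<exists>\<epsilon>\<in>{1, -1}. \<exists>\<delta>\<in>{1, -1}. \<forall>\<^sub>F q in nhdsin X P.
           G q - G P = \<epsilon> * fst (snd c q) ^ 2 + \<delta> * snd (snd c q) ^ 3))"

text \<open>
  The fibration by the level sets of \<open>G\<close> is defined near \<open>P\<close> by a function \<open>H\<close> that
  vanishes at \<open>P\<close>.
\<close>

definition fibration_defined_by ::
    "'a topology \<Rightarrow> 'a \<Rightarrow> ('a \<Rightarrow> real) \<Rightarrow> ('a \<Rightarrow> real) \<Rightarrow> bool" where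
  "fibration_defined_by X P G H \<longleftrightarrow>
     (\<exists>h. analytic1_at h 0 \<and> deriv h 0 \<noteq> 0 \<and> (\<forall>\<^sub>F q in nhdsin X P. G q = h (H q)))"

definition cusp :: "real \<times> real \<Rightarrow> real" where
  "cusp = (\<lambda>(x, y). y ^ 3 - x ^ 2)"

definition A2_normal_form ::
    "'a topology \<Rightarrow> 'a chart set \<Rightarrow> 'a form2_field \<Rightarrow> 'a \<Rightarrow> ('a \<Rightarrow> real) \<Rightarrow>
     'a chart \<Rightarrow> (real \<Rightarrow> real) \<Rightarrow> bool" where
  "A2_normal_form X A \<omega> P G c f \<longleftrightarrow>
     coords_centred_at A P c \<and>
     analytic1_at f 0 \<and>
     fibration_defined_by X P G (cusp \<circ> snd c) \<and>
     (\<forall>\<^sub>F (x, y) in nhds 0. \<forall>v w.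
        \<omega> c (x, y) v w =
          dx_wedge_dy v w + f (y ^ 3 - x ^ 2) * y * dx_wedge_dy v w)"

end

theory Submission
  imports Defs "HOL-Complex_Analysis.Complex_Analysis"
begin

text \<open>
  Write \<open>H = y\<^sup>3 - x\<^sup>2\<close> and \<open>{H, \<eta>}\<close> for its Poisson bracket with \<open>\<eta>\<close>. The quotient of the analytic
  germs by the brackets \<open>{H, \<eta>}\<close> is free over the germs in \<open>H\<close> with basis \<open>1, y\<close>, so every area
  density has the form \<open>f0(H) + f1(H) y + {H, \<eta>}\<close> with unique \<open>f0\<close> and \<open>f1\<close>.

  Existence: flowing for the variable time \<open>\<eta>\<close> along the Hamiltonian field of \<open>H\<close> with respect to
  the form with density \<open>f0(H) + f1(H) y\<close> preserves \<open>H\<close> and removes the summand \<open>{H, \<eta>}\<close>. A scaling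
  \<open>(x, y) \<mapsto> (\<kappa>(H)\<^sup>3 x, \<kappa>(H)\<^sup>2 y)\<close> with a suitable function \<open>\<kappa>\<close> then turns \<open>f0\<close> into \<open>1\<close>.

  Uniqueness: a coordinate change that preserves the fibration acts on the quotient compatibly with
  the Gauss-Manin connection, for which \<open>1\<close> and \<open>y\<close> have the exponents \<open>5/6\<close> and \<open>7/6\<close>. Their
  difference is not an integer, which leaves only constant multiples of \<open>1\<close> and \<open>y\<close>, and the linear
  part of the coordinate change shows that these constants are \<open>1\<close>.
\<close>

text \<open>The numbers come from giving x the weight 1/2 and y the weight 1/3, so that H has weight
  1: then dx dy and y dx dy have the weights 5/6 and 7/6. The Jacobian of the scaling is \<kappa>^5
  + 6 H \<kappa>^4 \<kappa>', and finding \<kappa> means inverting \<mu> + 6/5 t \<mu>', which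
  multiplies t^n by 1 + 6n/5 and hence never by zero. The obstacle in the existence part is
  convergence. Solving for \<eta> is a recursion on Taylor coefficients that trades one power of H
  for three powers of y, so the radii in H and y have to be estimated separately. The flow is not
  taken from a differential equation either, but is a series in the time with iterated derivatives
  as coefficients. Both need Cauchy estimates and holomorphic uniform limits, which is why
  real-analytic germs are extended to C^2. In the uniqueness part the coordinate change (u, v) may
  also reparametrise the values of H by a germ k. The equations for J = jac u v and for v J see k
  only through k / (t k'). Comparing areas makes this quotient 1, and k'(0) = 1 then gives k =
  id.\<close>

section \<open>Partial and total derivatives in two variables, over the reals and the complex
  numbers at once\<close>

definition pdx :: "('a::real_normed_field \<times> 'a \<Rightarrow> 'a) \<Rightarrow> 'a \<times> 'a \<Rightarrow> 'a" where
  "pdx f z = deriv (\<lambda>t. f (t, snd z)) (fst z)"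

definition pdy :: "('a::real_normed_field \<times> 'a \<Rightarrow> 'a) \<Rightarrow> 'a \<times> 'a \<Rightarrow> 'a" where
  "pdy f z = deriv (\<lambda>t. f (fst z, t)) (snd z)"

text \<open>Since \<open>deriv\<close> has some value even where no derivative exists,
  \<open>pdx\<close> and \<open>pdy\<close> carry information only together with this total
  differentiability. Over the complex numbers the derivative is required to be complex
  linear.\<close>

definition diff2 :: "('a::real_normed_field \<times> 'a \<Rightarrow> 'a) \<Rightarrow> 'a \<times> 'a \<Rightarrow> bool" where
  "diff2 f p \<longleftrightarrow> (f has_derivative (\<lambda>h. pdx f p * fst h + pdy f p * snd h)) (at p)"

lemma has_field_derivative_slice_x:
  assumes "(f has_derivative (\<lambda>h. a * fst h + b * snd h)) (at (x, y))"
  shows "((\<lambda>t. f (t, y)) has_field_derivative a) (at x)"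
proof -
  have "((\<lambda>t. (t, y)) has_derivative (\<lambda>h. (h, 0))) (at x)"
    by (auto intro!: derivative_eq_intros)
  from diff_chain_at[OF this assms] show ?thesis
    by (simp add: has_field_derivative_def o_def)
qed

lemma has_field_derivative_slice_y:
  assumes "(f has_derivative (\<lambda>h. a * fst h + b * snd h)) (at (x, y))"
  shows "((\<lambda>t. f (x, t)) has_field_derivative b) (at y)"
proof -
  have "((\<lambda>t. (x, t)) has_derivative (\<lambda>h. (0, h))) (at y)"
    by (auto intro!: derivative_eq_intros)
  from diff_chain_at[OF this assms] show ?thesis
    by (simp add: has_field_derivative_def o_def)
qed

lemma diff2I:
  assumes "(f has_derivative (\<lambda>h. a * fst h + b * snd h)) (at p)"
  shows "diff2 f p" "pdx f p = a" "pdy f p = b"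
proof -
  show "pdx f p = a"
    using has_field_derivative_slice_x[of f a b "fst p" "snd p"] assms
    by (auto simp: pdx_def intro!: DERIV_imp_deriv)
  moreover show "pdy f p = b"
    using has_field_derivative_slice_y[of f a b "fst p" "snd p"] assms
    by (auto simp: pdy_def intro!: DERIV_imp_deriv)
  ultimately show "diff2 f p"
    using assms by (simp add: diff2_def)
qed

lemma diff2D: "diff2 f p \<Longrightarrow> (f has_derivative (\<lambda>h. pdx f p * fst h + pdy f p * snd h)) (at p)"
  by (simp add: diff2_def)

lemma diff2_slices:
  assumes "diff2 f (x, y)"
  shows "((\<lambda>t. f (t, y)) has_field_derivative pdx f (x, y)) (at x)"
    and "((\<lambda>t. f (x, t)) has_field_derivative pdy f (x, y)) (at y)"
  using has_field_derivative_slice_x has_field_derivative_slice_y assms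
  unfolding diff2_def by blast+

lemma diff2_isCont: "diff2 f p \<Longrightarrow> isCont f p"
  using has_derivative_continuous diff2_def by blast

lemma diff2_cong:
  assumes "diff2 f p" "\<forall>\<^sub>F q in nhds p. g q = f q"
  shows "diff2 g p" "pdx g p = pdx f p" "pdy g p = pdy f p"
proof -
  have "(g has_derivative (\<lambda>h. pdx f p * fst h + pdy f p * snd h)) (at p)"
  proof (rule has_derivative_transform_eventually[OF diff2D[OF assms(1)]])
    show "\<forall>\<^sub>F x in at p. f x = g x"
      using assms(2) by (auto simp: eventually_at_filter elim: eventually_mono)
    show "f p = g p" using eventually_nhds_x_imp_x[OF assms(2)] by simp
  qed simp
  from diff2I[OF this] show "diff2 g p" "pdx g p = pdx f p" "pdy g p = pdy f p"
    by auto
qed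

lemma diff2_const: "diff2 (\<lambda>z. c) p" "pdx (\<lambda>z. c) p = 0" "pdy (\<lambda>z. c) p = 0"
  using diff2I[of "\<lambda>z. c" 0 0 p] by auto

lemma diff2_fst: "diff2 fst p" "pdx fst p = 1" "pdy fst p = 0"
  using diff2I[of fst 1 0 p] bounded_linear_imp_has_derivative[OF bounded_linear_fst, of "at p"]
  by auto

lemma diff2_snd: "diff2 snd p" "pdx snd p = 0" "pdy snd p = 1"
  using diff2I[of snd 0 1 p] bounded_linear_imp_has_derivative[OF bounded_linear_snd, of "at p"]
  by auto

lemma diff2_add:
  assumes "diff2 f p" "diff2 g p"
  shows "diff2 (\<lambda>z. f z + g z) p" "pdx (\<lambda>z. f z + g z) p = pdx f p + pdx g p"
    "pdy (\<lambda>z. f z + g z) p = pdy f p + pdy g p"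
  using diff2I[of "\<lambda>z. f z + g z" "pdx f p + pdx g p" "pdy f p + pdy g p" p]
    has_derivative_add[OF assms[THEN diff2D]] by (auto simp: algebra_simps)

lemma diff2_mult:
  assumes "diff2 f p" "diff2 g p"
  shows "diff2 (\<lambda>z. f z * g z) p" "pdx (\<lambda>z. f z * g z) p = pdx f p * g p + f p * pdx g p"
    "pdy (\<lambda>z. f z * g z) p = pdy f p * g p + f p * pdy g p"
  using diff2I[of "\<lambda>z. f z * g z" "pdx f p * g p + f p * pdx g p" "pdy f p * g p + f p * pdy g p" p]
    has_derivative_mult[OF assms[THEN diff2D]] by (auto simp: algebra_simps)

lemma diff2_cmult:
  assumes "diff2 f p"
  shows "diff2 (\<lambda>z. c * f z) p" "pdx (\<lambda>z. c * f z) p = c * pdx f p" "pdy (\<lambda>z. c * f z) p = c * pdy f p"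
  using diff2_mult[OF diff2_const(1) assms, of c] diff2_const[of c p] by auto

lemma diff2_diff:
  assumes "diff2 f p" "diff2 g p"
  shows "diff2 (\<lambda>z. f z - g z) p" "pdx (\<lambda>z. f z - g z) p = pdx f p - pdx g p"
    "pdy (\<lambda>z. f z - g z) p = pdy f p - pdy g p"
  using diff2_add[OF assms(1) diff2_cmult(1)[OF assms(2), of "-1"]] diff2_cmult[OF assms(2), of "-1"]
  by auto

lemma diff2_comp1:
  assumes "(h has_field_derivative d) (at (g p))" "diff2 g p"
  shows "diff2 (\<lambda>z. h (g z)) p" "pdx (\<lambda>z. h (g z)) p = d * pdx g p"
    "pdy (\<lambda>z. h (g z)) p = d * pdy g p"
  using diff2I[of "\<lambda>z. h (g z)" "d * pdx g p" "d * pdy g p" p]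
    diff_chain_at[OF diff2D[OF assms(2)], of h "(*) d"] assms(1)
  by (auto simp: algebra_simps o_def has_field_derivative_def)

lemma diff2_comp2:
  assumes "diff2 f (g1 p, g2 p)" "diff2 g1 p" "diff2 g2 p"
  shows "diff2 (\<lambda>z. f (g1 z, g2 z)) p"
    "pdx (\<lambda>z. f (g1 z, g2 z)) p = pdx f (g1 p, g2 p) * pdx g1 p + pdy f (g1 p, g2 p) * pdx g2 p"
    "pdy (\<lambda>z. f (g1 z, g2 z)) p = pdx f (g1 p, g2 p) * pdy g1 p + pdy f (g1 p, g2 p) * pdy g2 p"
proof -
  have "((\<lambda>z. f (g1 z, g2 z)) has_derivative
    (\<lambda>h. (pdx f (g1 p, g2 p) * pdx g1 p + pdy f (g1 p, g2 p) * pdx g2 p) * fst h +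
         (pdx f (g1 p, g2 p) * pdy g1 p + pdy f (g1 p, g2 p) * pdy g2 p) * snd h)) (at p)"
    using diff_chain_at[OF has_derivative_Pair[OF assms(2,3)[THEN diff2D]], of f] diff2D[OF assms(1)]
    by (fastforce simp: algebra_simps o_def elim: has_derivative_eq_rhs)
  from diff2I[OF this] show "diff2 (\<lambda>z. f (g1 z, g2 z)) p"
    "pdx (\<lambda>z. f (g1 z, g2 z)) p = pdx f (g1 p, g2 p) * pdx g1 p + pdy f (g1 p, g2 p) * pdx g2 p"
    "pdy (\<lambda>z. f (g1 z, g2 z)) p = pdx f (g1 p, g2 p) * pdy g1 p + pdy f (g1 p, g2 p) * pdy g2 p"
    by simp_all
qed

subsection \<open>Holomorphic functions of two variables\<close>

definition hol2 :: "(complex \<times> complex \<Rightarrow> complex) \<Rightarrow> (complex \<times> complex) set \<Rightarrow> bool" where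
  "hol2 F S \<longleftrightarrow> open S \<and> (\<forall>p\<in>S. diff2 F p)"

lemma hol2_open: "hol2 F S \<Longrightarrow> open S"
  by (simp add: hol2_def)

lemma hol2_continuous_on: "hol2 F S \<Longrightarrow> continuous_on S F"
  by (meson continuous_at_imp_continuous_on diff2_isCont hol2_def)

lemma hol2_subset: "hol2 F S \<Longrightarrow> open T \<Longrightarrow> T \<subseteq> S \<Longrightarrow> hol2 F T"
  by (auto simp: hol2_def)

text \<open>
  For continuous functions, separate holomorphy is equivalent to complex differentiability; unlike
  the latter it is visibly stable under uniform limits.
\<close>

definition sep_hol :: "(complex \<times> complex \<Rightarrow> complex) \<Rightarrow> (complex \<times> complex) set \<Rightarrow> bool" where
  "sep_hol F S \<longleftrightarrow> open S \<and> continuous_on S F \<and>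
     (\<forall>z w. (z, w) \<in> S \<longrightarrow> (\<lambda>t. F (t, w)) field_differentiable (at z) \<and>
       (\<lambda>t. F (z, t)) field_differentiable (at w))"

lemma hol2_imp_sep_hol: "hol2 F S \<Longrightarrow> sep_hol F S"
  unfolding sep_hol_def using diff2_slices hol2_continuous_on
  by (fastforce simp: hol2_def field_differentiable_def)

definition polydisc :: "complex \<times> complex \<Rightarrow> real \<Rightarrow> (complex \<times> complex) set" where
  "polydisc p r = ball (fst p) r \<times> ball (snd p) r"

definition cpolydisc :: "complex \<times> complex \<Rightarrow> real \<Rightarrow> (complex \<times> complex) set" where
  "cpolydisc p r = cball (fst p) r \<times> cball (snd p) r"

lemma open_polydisc: "open (polydisc p r)"
  by (simp add: polydisc_def open_Times)

lemma polydisc_subset_cpolydisc: "polydisc p r \<subseteq> cpolydisc p r"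
  by (auto simp: polydisc_def cpolydisc_def)

lemma compact_cpolydisc: "compact (cpolydisc p r)"
  by (simp add: cpolydisc_def compact_Times)

lemma centre_in_polydisc: "0 < r \<Longrightarrow> p \<in> polydisc p r"
  by (cases p) (simp add: polydisc_def)

lemma open_contains_cpolydisc:
  assumes "open S" "p \<in> S"
  obtains r where "r > 0" "cpolydisc p r \<subseteq> S"
proof -
  obtain A B where AB: "open A" "open B" "p \<in> A \<times> B" "A \<times> B \<subseteq> S"
    using assms open_prod_elim by metis
  obtain r1 where r1: "r1 > 0" "cball (fst p) r1 \<subseteq> A"
    using AB open_contains_cball[of A] by (metis mem_Times_iff)
  obtain r2 where r2: "r2 > 0" "cball (snd p) r2 \<subseteq> B"
    using AB open_contains_cball[of B] by (metis mem_Times_iff)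
  have "cpolydisc p (min r1 r2) \<subseteq> S"
    using r1 r2 AB by (force simp: cpolydisc_def)
  then show ?thesis
    using that[of "min r1 r2"] r1 r2 by auto
qed

text \<open>The error of the difference quotient is a Taylor remainder of second order. On the half
  disc Cauchy's inequality bounds g'' by 2 M / (R/2)^2 = 8 M / R^2, uniformly in the centre w; this
  uniformity is what \<open>sep_hol_pdy\<close> needs.\<close>

lemma holomorphic_quotient_bound:
  assumes "g holomorphic_on ball w R" "\<And>v. v \<in> ball w R \<Longrightarrow> norm (g v) \<le> M" "0 < R"
    and "h \<noteq> 0" "norm h < R / 2"
  shows "norm ((g (w + h) - g w) / h - deriv g w) \<le> 8 * M / R\<^sup>2 * norm h"
proof -
  define B where "B = 8 * M / R\<^sup>2"
  have hol: "(deriv ^^ i) g holomorphic_on ball w R" for i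
    using assms(1) holomorphic_higher_deriv by blast
  have d: "((deriv ^^ i) g has_field_derivative (deriv ^^ Suc i) g z) (at z within ball w (R/2))"
    if "z \<in> ball w (R/2)" for z i
  proof -
    have "z \<in> ball w R" using that assms(3) by (simp add: field_simps) 
    then show ?thesis
      using hol[of i] by (simp add: holomorphic_derivI has_field_derivative_at_within)
  qed
  have b: "norm ((deriv ^^ Suc 1) g z) \<le> B" if "z \<in> ball w (R/2)" for z
  proof -
    have sub3: "cball z (R/2) \<subseteq> ball w R"
    proof
      fix u assume "u \<in> cball z (R/2)"
      then show "u \<in> ball w R" using that dist_triangle[of w u z]
        by (simp add: dist_commute)
    qed
    have "norm ((deriv ^^ 2) g z) \<le> fact 2 * M / (R/2)^2"
    proof (rule Cauchy_inequality)
      show "g holomorphic_on ball z (R/2)"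
        using assms(1) sub3 ball_subset_cball holomorphic_on_subset by blast
      show "continuous_on (cball z (R/2)) g"
        using assms(1) sub3 holomorphic_on_subset holomorphic_on_imp_continuous_on by blast
      show "0 < R/2" using assms by simp
      show "norm (g x) \<le> M" if "norm (z - x) = R/2" for x
        using that sub3 assms(2) by (auto simp: dist_norm subset_iff)
    qed
    then show ?thesis by (simp add: B_def power2_eq_square numeral_2_eq_2)
  qed
  have wh: "w + h \<in> ball w (R/2)" "w \<in> ball w (R/2)"
    using assms by (auto simp: dist_norm)
  have "norm ((deriv ^^ 0) g (w + h) - (\<Sum>i\<le>1. (deriv ^^ i) g w * (w + h - w) ^ i / fact i))
      \<le> B * norm (w + h - w) ^ Suc 1 / fact 1"
    by (rule complex_Taylor[OF convex_ball d b wh(2,1)])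
  then have "norm (g (w + h) - g w - deriv g w * h) \<le> B * norm h ^ 2"
    by (simp add: power2_eq_square algebra_simps)
  moreover have "(g (w + h) - g w) / h - deriv g w = (g (w + h) - g w - deriv g w * h) / h"
    using assms(4) by (simp add: field_simps)
  ultimately have "norm ((g (w + h) - g w) / h - deriv g w) \<le> B * norm h"
    using assms(4) by (simp add: norm_divide divide_simps power2_eq_square)
  then show ?thesis by (simp add: B_def)
qed

text \<open>The one-variable theorem on uniform limits of holomorphic functions, applied on each
  slice. An arbitrary filter is allowed because the limits are taken over steps h tending to 0, over
  finite index sets and over partial sums; for the first of these the hypothesis holds only
  eventually.\<close>

lemma sep_hol_uniform_limit:
  assumes "\<forall>\<^sub>F n in N. sep_hol (F n) (polydisc p r)"
    and "uniform_limit (polydisc p r) F G N" "\<not> trivial_limit N"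
  shows "sep_hol G (polydisc p r)"
    and "\<And>z. z \<in> polydisc p r \<Longrightarrow> ((\<lambda>n. pdx (F n) z) \<longlongrightarrow> pdx G z) N"
    and "\<And>z. z \<in> polydisc p r \<Longrightarrow> ((\<lambda>n. pdy (F n) z) \<longlongrightarrow> pdy G z) N"
proof -
  have cont: "continuous_on (polydisc p r) G"
    by (rule uniform_limit_theorem[OF _ assms(2,3)])
       (use assms(1) in \<open>auto simp: sep_hol_def elim: eventually_mono\<close>)
  have X: "(\<lambda>t. G (t, w)) field_differentiable (at z) \<and> ((\<lambda>n. pdx (F n) (z, w)) \<longlongrightarrow> pdx G (z, w)) N"
    if zw: "(z, w) \<in> polydisc p r" for z w
  proof -
    obtain e where e: "e > 0" "cball z e \<subseteq> ball (fst p) r"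
      using zw open_contains_cball[of "ball (fst p) r"] unfolding polydisc_def by (metis open_ball mem_Sigma_iff)
    have in_p: "(t, w) \<in> polydisc p r" if "t \<in> cball z e" for t
      using e zw that by (auto simp: polydisc_def)
    obtain g' where g': "continuous_on (cball z e) (\<lambda>t. G (t, w))"
        "\<And>u. u \<in> ball z e \<Longrightarrow> ((\<lambda>t. G (t, w)) has_field_derivative g' u) (at u) \<and>
          ((\<lambda>n. pdx (F n) (u, w)) \<longlongrightarrow> g' u) N"
    proof (rule has_complex_derivative_uniform_limit[of z e "\<lambda>n t. F n (t, w)" "\<lambda>n t. pdx (F n) (t, w)" N "\<lambda>t. G (t, w)"])
      show "\<forall>\<^sub>F n in N. continuous_on (cball z e) (\<lambda>t. F n (t, w)) \<and>
          (\<forall>u\<in>ball z e. ((\<lambda>t. F n (t, w)) has_field_derivative pdx (F n) (u, w)) (at u))"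
        using assms(1)
      proof eventually_elim
        case (elim n)
        have *: "(\<lambda>t. F n (t, w)) field_differentiable at u" if "u \<in> cball z e" for u
          using in_p[OF that] elim by (auto simp: sep_hol_def)
        then show ?case
          by (auto simp: pdx_def intro!: continuous_at_imp_continuous_on field_differentiable_imp_continuous_at
            field_differentiable_derivI)
      qed
      show "uniform_limit (cball z e) (\<lambda>n t. F n (t, w)) (\<lambda>t. G (t, w)) N"
        using assms(2) in_p unfolding uniform_limit_iff by (auto elim!: eventually_mono)
    qed (use assms e in auto)
    have "((\<lambda>t. G (t, w)) has_field_derivative g' z) (at z)" "((\<lambda>n. pdx (F n) (z, w)) \<longlongrightarrow> g' z) N"
      using g'(2)[of z] e by auto
    then show ?thesis
      by (auto simp: pdx_def field_differentiable_def DERIV_imp_deriv)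
  qed
  have Y: "(\<lambda>t. G (z, t)) field_differentiable (at w) \<and> ((\<lambda>n. pdy (F n) (z, w)) \<longlongrightarrow> pdy G (z, w)) N"
    if zw: "(z, w) \<in> polydisc p r" for z w
  proof -
    obtain e where e: "e > 0" "cball w e \<subseteq> ball (snd p) r"
      using zw open_contains_cball[of "ball (snd p) r"] unfolding polydisc_def by (metis open_ball mem_Sigma_iff)
    have in_p: "(z, t) \<in> polydisc p r" if "t \<in> cball w e" for t
      using e zw that by (auto simp: polydisc_def)
    obtain g' where g': "continuous_on (cball w e) (\<lambda>t. G (z, t))"
        "\<And>u. u \<in> ball w e \<Longrightarrow> ((\<lambda>t. G (z, t)) has_field_derivative g' u) (at u) \<and>
          ((\<lambda>n. pdy (F n) (z, u)) \<longlongrightarrow> g' u) N"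
    proof (rule has_complex_derivative_uniform_limit[of w e "\<lambda>n t. F n (z, t)" "\<lambda>n t. pdy (F n) (z, t)" N "\<lambda>t. G (z, t)"])
      show "\<forall>\<^sub>F n in N. continuous_on (cball w e) (\<lambda>t. F n (z, t)) \<and>
          (\<forall>u\<in>ball w e. ((\<lambda>t. F n (z, t)) has_field_derivative pdy (F n) (z, u)) (at u))"
        using assms(1)
      proof eventually_elim
        case (elim n)
        have *: "(\<lambda>t. F n (z, t)) field_differentiable at u" if "u \<in> cball w e" for u
          using in_p[OF that] elim by (auto simp: sep_hol_def)
        then show ?case
          by (auto simp: pdy_def intro!: continuous_at_imp_continuous_on field_differentiable_imp_continuous_at
            field_differentiable_derivI)
      qed
      show "uniform_limit (cball w e) (\<lambda>n t. F n (z, t)) (\<lambda>t. G (z, t)) N"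
        using assms(2) in_p unfolding uniform_limit_iff by (auto elim!: eventually_mono)
    qed (use assms e in auto)
    have "((\<lambda>t. G (z, t)) has_field_derivative g' w) (at w)" "((\<lambda>n. pdy (F n) (z, w)) \<longlongrightarrow> g' w) N"
      using g'(2)[of w] e by auto
    then show ?thesis
      by (auto simp: pdy_def field_differentiable_def DERIV_imp_deriv)
  qed
  show "sep_hol G (polydisc p r)"
    using X Y cont by (auto simp: sep_hol_def open_polydisc)
  show "((\<lambda>n. pdx (F n) z) \<longlongrightarrow> pdx G z) N" if "z \<in> polydisc p r" for z
    using X[of "fst z" "snd z"] that by simp
  show "((\<lambda>n. pdy (F n) z) \<longlongrightarrow> pdy G z) N" if "z \<in> polydisc p r" for z
    using Y[of "fst z" "snd z"] that by simp
qed

lemma sep_hol_local: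
  assumes "open S" "\<And>p. p \<in> S \<Longrightarrow> \<exists>r>0. sep_hol F (polydisc p r)"
  shows "sep_hol F S"
  unfolding sep_hol_def
proof (intro conjI allI impI assms(1))
  show "continuous_on S F"
  proof (intro continuous_at_imp_continuous_on ballI)
    fix p assume "p \<in> S"
    then obtain r where "r > 0" "sep_hol F (polydisc p r)" using assms by blast
    then show "isCont F p"
      using centre_in_polydisc open_polydisc continuous_on_eq_continuous_at
      unfolding sep_hol_def by blast
  qed
  fix z w assume zw: "(z, w) \<in> S"
  obtain r where r: "r > 0" "sep_hol F (polydisc (z, w) r)" using assms zw by blast
  then show "(\<lambda>t. F (t, w)) field_differentiable (at z)" "(\<lambda>t. F (z, t)) field_differentiable (at w)"
    using centre_in_polydisc[OF r(1), of "(z, w)"] unfolding sep_hol_def by blast+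
qed

text \<open>Holomorphy of \<open>pdy F\<close> in the first variable is the point: difference
  quotients in the second variable are separately holomorphic, and they converge locally uniformly
  by \<open>holomorphic_quotient_bound\<close>.\<close>

lemma sep_hol_pdy:
  assumes "sep_hol F S"
  shows "sep_hol (pdy F) S"
proof (rule sep_hol_local)
  show S: "open S" using assms by (simp add: sep_hol_def)
  fix p assume "p \<in> S"
  then obtain r where r: "r > 0" "cpolydisc p r \<subseteq> S"
    using open_contains_cpolydisc S by blast
  have "continuous_on (cpolydisc p r) F"
    using assms r continuous_on_subset unfolding sep_hol_def by blast
  then have "bounded (F ` cpolydisc p r)"
    using compact_cpolydisc compact_continuous_image compact_imp_bounded by blast
  then obtain M where M: "\<And>q. q \<in> cpolydisc p r \<Longrightarrow> norm (F q) \<le> M"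
    unfolding bounded_iff by auto
  \<comment> \<open>Half the radius leaves room for the shift by h and for the discs on which
    Cauchy's inequality is used.\<close>
  define R where "R = r / 2"
  have R: "R > 0" using r by (simp add: R_def)
  define N where "N = at (0::complex)"
  define Q where "Q = (\<lambda>h z. (F (fst z, snd z + h) - F z) / h)"
  have shift: "(z, w + h) \<in> cpolydisc p r" if "(z, w) \<in> polydisc p R" "norm h < R" for z w h
  proof -
    have "dist (snd p) (w + h) \<le> dist (snd p) w + norm h"
      by (metis dist_triangle dist_norm add_diff_cancel_left' norm_minus_commute)
    then show ?thesis using that zero_le_dist[of "fst p" z] r
      by (simp add: polydisc_def cpolydisc_def R_def del: zero_le_dist)
  qed
  have b: "norm (Q h z - pdy F z) \<le> 8 * M / R\<^sup>2 * norm h"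
    if "z \<in> polydisc p R" "h \<noteq> 0" "norm h < R / 2" for h z
  proof -
    obtain z1 z2 where z: "z = (z1, z2)" by (cases z)
    have in_c: "(z1, v) \<in> cpolydisc p r" if "v \<in> ball z2 R" for v
      using shift[of z1 z2 "v - z2"] \<open>z \<in> polydisc p R\<close> that z
      by (simp add: dist_norm norm_minus_commute)
    have "norm ((F (z1, z2 + h) - F (z1, z2)) / h - deriv (\<lambda>v. F (z1, v)) z2) \<le> 8 * M / R\<^sup>2 * norm h"
    proof (rule holomorphic_quotient_bound)
      show "(\<lambda>v. F (z1, v)) holomorphic_on ball z2 R"
        using in_c r assms unfolding sep_hol_def holomorphic_on_def
        by (meson field_differentiable_at_within subsetD)
    qed (use that in_c M R in auto)
    then show ?thesis by (simp add: Q_def z pdy_def)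
  qed
  have ul: "uniform_limit (polydisc p R) Q (pdy F) N"
    unfolding uniform_limit_iff
  proof (intro allI impI)
    fix e :: real assume e: "e > 0"
    define C where "C = 8 * M / R\<^sup>2"
    have "((\<lambda>h. C * norm h) \<longlongrightarrow> C * norm (0::complex)) N"
      unfolding N_def by (intro tendsto_intros)
    then have "\<forall>\<^sub>F h in N. C * norm h < e" using e order_tendstoD(2) by fastforce
    moreover have "\<forall>\<^sub>F h in N. norm h < R / 2"
      unfolding N_def eventually_at using R by (intro exI[of _ "R/2"]) (auto simp: dist_norm)
    moreover have "\<forall>\<^sub>F h in N. h \<noteq> 0"
      unfolding N_def by (simp add: eventually_at_filter)
    ultimately show "\<forall>\<^sub>F h in N. \<forall>z\<in>polydisc p R. dist (Q h z) (pdy F z) < e"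
    proof eventually_elim
      case (elim h)
      show ?case
      proof
        fix z assume "z \<in> polydisc p R"
        then have "norm (Q h z - pdy F z) \<le> C * norm h"
          using b elim unfolding C_def by blast
        then show "dist (Q h z) (pdy F z) < e" using elim by (simp add: dist_norm)
      qed
    qed
  qed
  have Qs: "\<forall>\<^sub>F h in N. sep_hol (Q h) (polydisc p R)"
  proof -
    have "\<forall>\<^sub>F h in N. norm h < R"
      unfolding N_def eventually_at using R by (intro exI[of _ "R"]) (auto simp: dist_norm)
    moreover have "\<forall>\<^sub>F h in N. h \<noteq> 0"
      unfolding N_def by (simp add: eventually_at_filter)
    ultimately show ?thesis
    proof eventually_elim
      case (elim h)
      have s: "(z, w + h) \<in> S" "(z, w) \<in> S" if "(z, w) \<in> polydisc p R" for z w
        using shift[OF that, of h] shift[OF that, of 0] elim r R by auto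
      have fd: "(\<lambda>t. F (t, w + h)) field_differentiable (at z)" "(\<lambda>t. F (t, w)) field_differentiable (at z)"
        "(\<lambda>t. F (z, t)) field_differentiable (at w)" "(\<lambda>t. F (z, t)) field_differentiable (at (w + h))"
        if "(z, w) \<in> polydisc p R" for z w
        using assms s[OF that] by (auto simp: sep_hol_def)
      have fd5: "(\<lambda>t. F (z, t + h)) field_differentiable (at w)" if "(z, w) \<in> polydisc p R" for z w
      proof -
        have "(\<lambda>t. t + h) field_differentiable (at w)"
          by (intro derivative_intros)
        then show ?thesis
          using field_differentiable_compose[of "\<lambda>t. t + h" w "\<lambda>t. F (z, t)"] fd(4)[OF that]
          by (simp add: o_def)
      qed
      have "continuous_on (polydisc p R) (\<lambda>z. F (fst z, snd z + h))"
        by (rule continuous_on_compose2[of S F]) (use assms s in \<open>auto simp: sep_hol_def intro!: continuous_intros\<close>)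
      moreover have "continuous_on (polydisc p R) F"
      proof (rule continuous_on_subset)
        show "continuous_on S F" using assms by (simp add: sep_hol_def)
        show "polydisc p R \<subseteq> S" using s(2) by fast
      qed
      ultimately have c: "continuous_on (polydisc p R) (Q h)"
        unfolding Q_def using elim by (intro continuous_intros) auto
      have "(\<lambda>t. Q h (t, w)) field_differentiable at z" "(\<lambda>t. Q h (z, t)) field_differentiable at w"
        if "(z, w) \<in> polydisc p R" for z w
        unfolding Q_def fst_conv snd_conv using elim fd[OF that] fd5[OF that]
        by (intro field_differentiable_divide field_differentiable_diff field_differentiable_const; simp)+
      then show ?case using c by (simp add: sep_hol_def open_polydisc)
    qed
  qed
  show "\<exists>r>0. sep_hol (pdy F) (polydisc p r)"
    using sep_hol_uniform_limit(1)[OF Qs ul] R unfolding N_def by auto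
qed

text \<open>One partial derivative at the point and continuity of the other one nearby imply total
  differentiability. The continuity comes from \<open>sep_hol_pdy\<close>.\<close>

lemma sep_hol_imp_hol2:
  assumes "sep_hol F S"
  shows "hol2 F S"
  unfolding hol2_def
proof (intro conjI ballI)
  show S: "open S" using assms by (simp add: sep_hol_def)
  fix p assume p: "p \<in> S"
  obtain r where r: "r > 0" "cpolydisc p r \<subseteq> S"
    using open_contains_cpolydisc S p by blast
  obtain x y where xy: "p = (x, y)" by (cases p)
  define U V where "U = ball x r" and "V = ball y r"
  have UV: "U \<times> V \<subseteq> S" "open U" "open V" "(x, y) \<in> U \<times> V"
    using r xy by (auto simp: U_def V_def cpolydisc_def)
  have "((\<lambda>(x, y). F (x, y)) has_derivative (\<lambda>(tx, ty). pdx F p * tx + blinfun_mult_right (pdy F (x, y)) ty))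
     (at (x, y) within U \<times> V)"
  proof (rule has_derivative_partialsI)
    show "((\<lambda>t. F (t, y)) has_derivative (*) (pdx F p)) (at x within U)"
      using assms p xy unfolding sep_hol_def pdx_def
      by (metis field_differentiable_derivI has_derivative_at_withinI has_field_derivative_def fst_conv snd_conv)
    show "((\<lambda>t. F (a, t)) has_derivative blinfun_apply (blinfun_mult_right (pdy F (a, b)))) (at b within V)"
      if "a \<in> U" "b \<in> V" for a b
    proof -
      have "(\<lambda>t. F (a, t)) field_differentiable (at b)"
        using assms that UV unfolding sep_hol_def by blast
      then have "((\<lambda>t. F (a, t)) has_field_derivative pdy F (a, b)) (at b within V)"
        unfolding pdy_def fst_conv snd_conv
        by (rule has_field_derivative_at_within[OF field_differentiable_derivI])
      then show ?thesis by (simp add: has_field_derivative_def blinfun_mult_right.rep_eq)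
    qed
    have "continuous_on S (pdy F)" using sep_hol_pdy[OF assms] by (simp add: sep_hol_def)
    then have "isCont (pdy F) (x, y)" using S p xy continuous_on_eq_continuous_at by blast
    then have "continuous (at (x, y) within U \<times> V) (pdy F)"
      using continuous_at_imp_continuous_within by blast
    then show "continuous (at (x, y) within U \<times> V) (\<lambda>(x, y). blinfun_mult_right (pdy F (x, y)))"
      unfolding case_prod_unfold prod.collapse
      by (intro bounded_linear.continuous[OF bounded_linear_blinfun_mult_right])
  qed (use UV in \<open>auto simp: V_def\<close>)
  then have "(F has_derivative (\<lambda>h. pdx F p * fst h + pdy F p * snd h)) (at p)"
    using at_within_open[OF UV(4) open_Times[OF UV(2,3)]] xy
    by (simp add: case_prod_unfold blinfun_mult_right.rep_eq)
  then show "diff2 F p" by (simp add: diff2_def)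
qed

text \<open>Exchanging the coordinates carries the result on \<open>pdy\<close> over to
  \<open>pdx\<close>.\<close>

lemma hol2_swap: "hol2 F S \<Longrightarrow> hol2 (\<lambda>z. F (snd z, fst z)) ((\<lambda>z. (snd z, fst z)) -` S)"
  unfolding hol2_def
  by (auto intro!: diff2_comp2 diff2_fst diff2_snd open_vimage continuous_intros)

lemma hol2_pdy: "hol2 F S \<Longrightarrow> hol2 (pdy F) S"
  using hol2_imp_sep_hol sep_hol_imp_hol2 sep_hol_pdy by blast

lemma hol2_pdx:
  assumes "hol2 F S"
  shows "hol2 (pdx F) S"
proof -
  define G where "G = (\<lambda>z. F (snd z, fst z))"
  have "hol2 (pdy G) ((\<lambda>z. (snd z, fst z)) -` S)"
    using hol2_swap[OF assms] hol2_pdy G_def by simp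
  from hol2_swap[OF this] have "hol2 (\<lambda>z. pdy G (snd z, fst z)) S"
    by (simp add: vimage_def)
  then show ?thesis by (simp add: pdy_def pdx_def[abs_def] G_def)
qed

lemma hol2_uniform_limit:
  assumes "\<And>n. hol2 (F n) (polydisc p r)"
    and "uniform_limit (polydisc p r) F G N" "\<not> trivial_limit N"
  shows "hol2 G (polydisc p r)"
    and "\<And>z. z \<in> polydisc p r \<Longrightarrow> ((\<lambda>n. pdx (F n) z) \<longlongrightarrow> pdx G z) N"
    and "\<And>z. z \<in> polydisc p r \<Longrightarrow> ((\<lambda>n. pdy (F n) z) \<longlongrightarrow> pdy G z) N"
  using sep_hol_uniform_limit[OF _ assms(2,3)] hol2_imp_sep_hol[OF assms(1)]
  by (simp_all add: sep_hol_imp_hol2)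

lemma hol2_intros:
  "open S \<Longrightarrow> hol2 (\<lambda>z. c) S" "open S \<Longrightarrow> hol2 fst S" "open S \<Longrightarrow> hol2 snd S"
  "hol2 F S \<Longrightarrow> hol2 G S \<Longrightarrow> hol2 (\<lambda>z. F z + G z) S"
  "hol2 F S \<Longrightarrow> hol2 G S \<Longrightarrow> hol2 (\<lambda>z. F z - G z) S"
  "hol2 F S \<Longrightarrow> hol2 G S \<Longrightarrow> hol2 (\<lambda>z. F z * G z) S"
  by (auto simp: hol2_def intro: diff2_const diff2_fst diff2_snd diff2_add diff2_diff diff2_mult)

lemma hol2_power: "hol2 F S \<Longrightarrow> hol2 (\<lambda>z. F z ^ n) S"
  by (induction n) (auto intro: hol2_intros hol2_open)

lemma hol2_sum: "open S \<Longrightarrow> (\<And>i. i \<in> I \<Longrightarrow> hol2 (F i) S) \<Longrightarrow> hol2 (\<lambda>z. \<Sum>i\<in>I. F i z) S"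
  by (induction I rule: infinite_finite_induct) (auto intro: hol2_intros)

lemma hol2_compose:
  assumes "hol2 F S" "hol2 G1 T" "hol2 G2 T"
  shows "hol2 (\<lambda>z. F (G1 z, G2 z)) {z\<in>T. (G1 z, G2 z) \<in> S}"
proof -
  have "continuous_on T (\<lambda>z. (G1 z, G2 z))"
    using assms hol2_continuous_on by (auto intro!: continuous_intros)
  then have "open {z\<in>T. (G1 z, G2 z) \<in> S}"
    using continuous_open_preimage[of T "\<lambda>z. (G1 z, G2 z)" S] hol2_open[OF assms(1)] hol2_open[OF assms(2)]
    by (simp add: Int_def vimage_def)
  then show ?thesis using assms by (auto simp: hol2_def intro: diff2_comp2)
qed

lemma hol2_compose1:
  assumes "h holomorphic_on A" "open A" "hol2 G T"
  shows "hol2 (\<lambda>z. h (G z)) {z\<in>T. G z \<in> A}"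
proof -
  have "open {z\<in>T. G z \<in> A}"
    using continuous_open_preimage[of T G A] assms(2) hol2_open[OF assms(3)] hol2_continuous_on[OF assms(3)]
    by (simp add: Int_def vimage_def)
  moreover have "diff2 (\<lambda>z. h (G z)) p" if "p \<in> T" "G p \<in> A" for p
    using diff2_comp1(1)[of h "deriv h (G p)" G p] holomorphic_derivI[OF assms(1,2) that(2)] that assms(3)
    by (simp add: hol2_def)
  ultimately show ?thesis by (simp add: hol2_def)
qed

subsection \<open>Double power series\<close>

definition pterm :: "(nat \<Rightarrow> nat \<Rightarrow> 'a::real_normed_field) \<Rightarrow> 'a \<Rightarrow> 'a \<Rightarrow> nat \<times> nat \<Rightarrow> 'a" where
  "pterm c x y = (\<lambda>(i, j). c i j * x ^ i * y ^ j)"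

definition psum :: "(nat \<Rightarrow> nat \<Rightarrow> 'a::real_normed_field) \<Rightarrow> 'a \<Rightarrow> 'a \<Rightarrow> 'a" where
  "psum c x y = infsum (pterm c x y) UNIV"

text \<open>Convergence is encoded as a geometric bound on the coefficients, so that it can be
  followed through index shifts and recursions without looking at the sums.\<close>

definition cbound :: "(nat \<Rightarrow> nat \<Rightarrow> 'a::real_normed_field) \<Rightarrow> real \<Rightarrow> real \<Rightarrow> bool" where
  "cbound c M R \<longleftrightarrow> R > 0 \<and> (\<forall>i j. norm (c i j) \<le> M / R ^ (i + j))"

lemma geometric_summable_on:
  fixes a b :: real
  assumes "0 \<le> a" "a < 1" "0 \<le> b" "b < 1"
  shows "(\<lambda>(i, j). M * (a ^ i * b ^ j)) summable_on (UNIV :: (nat \<times> nat) set)"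
proof -
  have *: "(\<lambda>n. t ^ n) summable_on (UNIV :: nat set)" if "0 \<le> t" "t < 1" for t :: real
    using that by (intro norm_summable_imp_summable_on) simp
  have "(\<lambda>(i, j). a ^ i * b ^ j) summable_on (UNIV \<times> UNIV :: (nat \<times> nat) set)"
  proof (rule summable_on_SigmaI)
    show "((\<lambda>j. case (i, j) of (i, j) \<Rightarrow> a ^ i * b ^ j) has_sum a ^ i * infsum (\<lambda>n. b ^ n) UNIV) UNIV" for i
      using has_sum_cmult_right[OF has_sum_infsum[OF *[OF assms(3,4)]], of "a ^ i"] by simp
    show "(\<lambda>i. a ^ i * infsum (\<lambda>n. b ^ n) UNIV) summable_on UNIV"
      using *[OF assms(1,2)] by (rule summable_on_cmult_left)
  qed (use assms in auto)
  then show ?thesis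
    using summable_on_cmult_right[of "\<lambda>(i, j). a ^ i * b ^ j" UNIV M] by (simp add: case_prod_unfold)
qed

lemma pterm_bound:
  assumes "cbound c M R" "norm x \<le> r" "norm y \<le> r"
  shows "norm (pterm c x y (i, j)) \<le> M * ((r / R) ^ i * (r / R) ^ j)"
proof -
  have R: "R > 0" and c: "norm (c i j) \<le> M / R ^ (i + j)" using assms by (auto simp: cbound_def)
  have r: "r \<ge> 0" using assms(2) norm_ge_zero order_trans by blast
  have "norm (pterm c x y (i, j)) = norm (c i j) * (norm x ^ i * norm y ^ j)"
    by (simp add: pterm_def norm_mult norm_power)
  also have "\<dots> \<le> M / R ^ (i + j) * (r ^ i * r ^ j)"
    using assms r c R by (intro mult_mono power_mono) (auto intro: order_trans[OF norm_ge_zero])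
  finally show ?thesis by (simp add: power_divide power_add)
qed

lemma pterm_has_sum:
  fixes c :: "nat \<Rightarrow> nat \<Rightarrow> 'a::{real_normed_field, banach}"
  assumes "cbound c M R" "norm x < R" "norm y < R"
  shows "(pterm c x y has_sum psum c x y) UNIV"
proof -
  define r where "r = max (norm x) (norm y)"
  have r: "norm x \<le> r" "norm y \<le> r" "0 \<le> r / R" "r / R < 1"
    using assms by (auto simp: r_def cbound_def le_max_iff_disj)
  have "(\<lambda>(i, j). M * ((r / R) ^ i * (r / R) ^ j)) summable_on (UNIV :: (nat \<times> nat) set)"
    using geometric_summable_on r by blast
  then have "pterm c x y abs_summable_on UNIV"
    using pterm_bound[OF assms(1) r(1,2)]
    by (intro Infinite_Sum.abs_summable_on_comparison_test'[of "\<lambda>(i, j). M * ((r / R) ^ i * (r / R) ^ j)"]) auto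
  then show ?thesis
    unfolding psum_def by (rule has_sum_infsum[OF abs_summable_summable])
qed

lemma hol2_pterm: "open S \<Longrightarrow> hol2 (\<lambda>z. pterm c (fst z) (snd z) ij) S"
  by (cases ij) (auto simp: pterm_def intro!: hol2_intros hol2_power)

text \<open>The partial sums run over finite index sets, so that the limit is the unordered sum and
  no enumeration of the pairs has to be chosen.\<close>

lemma psum_uniform_limit:
  fixes c :: "nat \<Rightarrow> nat \<Rightarrow> complex"
  assumes "cbound c M R" "r < R"
  shows "uniform_limit (polydisc 0 r) (\<lambda>X z. \<Sum>ij\<in>X. pterm c (fst z) (snd z) ij)
     (\<lambda>z. psum c (fst z) (snd z)) (finite_subsets_at_top UNIV)"
proof (cases "r > 0")
  case True
  show ?thesis
    unfolding psum_def
  proof (rule Weierstrass_m_test_general)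
    fix ij :: "nat \<times> nat" and z :: "complex \<times> complex"
    assume "z \<in> polydisc 0 r"
    then have "norm (fst z) \<le> r" "norm (snd z) \<le> r" by (auto simp: polydisc_def)
    from pterm_bound[OF assms(1) this, of "fst ij" "snd ij"]
    show "norm (pterm c (fst z) (snd z) ij) \<le> (case ij of (i, j) \<Rightarrow> M * ((r / R) ^ i * (r / R) ^ j))"
      by (simp add: case_prod_unfold)
  next
    show "(\<lambda>(i, j). M * ((r / R) ^ i * (r / R) ^ j)) summable_on (UNIV :: (nat \<times> nat) set)"
      using True assms by (intro geometric_summable_on) auto
  qed
next
  case False
  then have "polydisc 0 r = {}" by (simp add: polydisc_def)
  then show ?thesis by simp
qed

lemma polydisc_0_exhaust:
  assumes "z \<in> polydisc 0 R"
  obtains r where "0 < r" "r < R" "z \<in> polydisc 0 r"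
proof -
  obtain r where "max (norm (fst z)) (norm (snd z)) < r" "r < R"
    using assms dense[of "max (norm (fst z)) (norm (snd z))" R] by (auto simp: polydisc_def)
  moreover from this have "0 < r" using norm_ge_zero[of "fst z"] by linarith
  ultimately show ?thesis using that[of r] by (auto simp: polydisc_def mem_Times_iff)
qed

text \<open>Termwise differentiation is an instance of \<open>hol2_uniform_limit\<close>. The
  truncated exponent i - 1 is harmless at i = 0, where the factor i is zero.\<close>

lemma
  fixes c :: "nat \<Rightarrow> nat \<Rightarrow> complex"
  assumes "cbound c M R"
  shows hol2_psum: "hol2 (\<lambda>z. psum c (fst z) (snd z)) (polydisc 0 R)"
    and psum_pdx: "(z, w) \<in> polydisc 0 R \<Longrightarrow> ((\<lambda>(i, j). of_nat i * c i j * z ^ (i - 1) * w ^ j)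
        has_sum pdx (\<lambda>z. psum c (fst z) (snd z)) (z, w)) UNIV"
proof -
  have *: "hol2 (\<lambda>z. \<Sum>ij\<in>X. pterm c (fst z) (snd z) ij) (polydisc 0 r)" for X r
    by (intro hol2_sum hol2_pterm open_polydisc)
  have "diff2 (\<lambda>z. psum c (fst z) (snd z)) z" if "z \<in> polydisc 0 R" for z
  proof -
    obtain r where "0 < r" "r < R" "z \<in> polydisc 0 r" using polydisc_0_exhaust[OF \<open>z \<in> _\<close>] by metis
    then show ?thesis
      using hol2_uniform_limit(1)[OF * psum_uniform_limit[OF assms]] by (auto simp: hol2_def)
  qed
  then show "hol2 (\<lambda>z. psum c (fst z) (snd z)) (polydisc 0 R)"
    by (simp add: hol2_def open_polydisc)
  assume "(z, w) \<in> polydisc 0 R"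
  then obtain r where r: "0 < r" "r < R" "(z, w) \<in> polydisc 0 r" using polydisc_0_exhaust by metis
  have p1: "((\<lambda>t. pterm c t w ij) has_field_derivative
      (case ij of (i, j) \<Rightarrow> of_nat i * c i j * z ^ (i - 1) * w ^ j)) (at z)" for ij
    by (cases ij) (auto simp: pterm_def intro!: derivative_eq_intros)
  have p: "pdx (\<lambda>z. \<Sum>ij\<in>X. pterm c (fst z) (snd z) ij) (z, w) =
      (\<Sum>ij\<in>X. case ij of (i, j) \<Rightarrow> of_nat i * c i j * z ^ (i - 1) * w ^ j)" for X
    unfolding pdx_def fst_conv snd_conv by (intro DERIV_imp_deriv DERIV_sum p1)
  show "((\<lambda>(i, j). of_nat i * c i j * z ^ (i - 1) * w ^ j)
        has_sum pdx (\<lambda>z. psum c (fst z) (snd z)) (z, w)) UNIV"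
    using hol2_uniform_limit(2)[OF * psum_uniform_limit[OF assms r(2)] _ r(3)]
    unfolding p has_sum_def by simp
qed

lemma bounded_on_cpolydisc:
  assumes "hol2 F S" "cpolydisc p r \<subseteq> S"
  obtains M where "M > 0" "\<And>q. q \<in> cpolydisc p r \<Longrightarrow> norm (F q) \<le> M"
proof -
  have "continuous_on (cpolydisc p r) F"
    using assms hol2_continuous_on continuous_on_subset by blast
  then have "bounded (F ` cpolydisc p r)"
    using compact_cpolydisc compact_continuous_image compact_imp_bounded by blast
  then show ?thesis using that unfolding bounded_pos by auto
qed

lemma hol2_slice_x:
  assumes "hol2 F S" "\<And>u. u \<in> A \<Longrightarrow> (u, w) \<in> S"
  shows "(\<lambda>u. F (u, w)) holomorphic_on A"
  using assms hol2_imp_sep_hol[OF assms(1)] unfolding holomorphic_on_def sep_hol_def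
  by (blast intro: field_differentiable_at_within)

lemma hol2_slice_y:
  assumes "hol2 F S" "\<And>u. u \<in> A \<Longrightarrow> (z, u) \<in> S"
  shows "(\<lambda>u. F (z, u)) holomorphic_on A"
  using assms hol2_imp_sep_hol[OF assms(1)] unfolding holomorphic_on_def sep_hol_def
  by (blast intro: field_differentiable_at_within)

lemma hol2_pdy_funpow: "hol2 F S \<Longrightarrow> hol2 ((pdy ^^ n) F) S"
  by (induction n) (auto intro: hol2_pdy)

text \<open>The left side is visibly holomorphic in z, while Cauchy's inequality and the Taylor
  series apply to the right side; \<open>osgood\<close> uses both.\<close>

lemma pdy_funpow_deriv: "(pdy ^^ n) F (z, w) = (deriv ^^ n) (\<lambda>v. F (z, v)) w"
proof (induction n arbitrary: w)
  case (Suc n)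
  have "(\<lambda>v. (pdy ^^ n) F (z, v)) = (deriv ^^ n) (\<lambda>v. F (z, v))"
    using Suc by auto
  then show ?case by (simp add: pdy_def[of "(pdy ^^ n) F"])
qed simp

text \<open>Expand in the second variable. The coefficients \<open>A j\<close> are holomorphic in
  the first variable and can be expanded in turn. Cauchy's inequality, used once in each variable,
  bounds the double coefficients, and absolute convergence makes the iterated sum equal to the
  double one.\<close>

lemma osgood:
  assumes F: "hol2 F S" "cpolydisc p r \<subseteq> S" "r > 0"
  obtains c M where "cbound c M r"
    "\<And>z w. norm z < r \<Longrightarrow> norm w < r \<Longrightarrow> F (fst p + z, snd p + w) = psum c z w"
proof -
  obtain a b where p: "p = (a, b)" by (cases p)
  obtain M where M: "M > 0" "\<And>q. q \<in> cpolydisc p r \<Longrightarrow> norm (F q) \<le> M"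
    using bounded_on_cpolydisc F by metis
  define A where "A = (\<lambda>j z. (pdy ^^ j) F (z, b) / fact j)"
  define c where "c = (\<lambda>i j. (deriv ^^ i) (A j) a / fact i)"
  have inS: "(z, w) \<in> S" if "z \<in> cball a r" "w \<in> cball b r" for z w
    using that F p by (auto simp: cpolydisc_def)
  have bin: "b \<in> cball b r" using F by simp
  have Ahol: "A j holomorphic_on cball a r" for j
    unfolding A_def using inS bin
    by (intro holomorphic_intros hol2_slice_x[OF hol2_pdy_funpow[OF F(1)]]) auto
  have slice_hol: "(\<lambda>v. F (z, v)) holomorphic_on cball b r" if "z \<in> cball a r" for z
    using inS that by (intro hol2_slice_y[OF F(1)]) auto
  have Abd: "norm (A j z) \<le> M / r ^ j" if "z \<in> cball a r" for j z
  proof -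
    have "norm ((deriv ^^ j) (\<lambda>v. F (z, v)) b) \<le> fact j * M / r ^ j"
    proof (rule Cauchy_inequality)
      show "(\<lambda>v. F (z, v)) holomorphic_on ball b r"
        by (rule holomorphic_on_subset[OF slice_hol[OF that] ball_subset_cball])
      show "continuous_on (cball b r) (\<lambda>v. F (z, v))"
        using slice_hol[OF that] holomorphic_on_imp_continuous_on by blast
      show "norm (F (z, x)) \<le> M" if "norm (b - x) = r" for x
        using M(2)[of "(z, x)"] that \<open>z \<in> cball a r\<close> p by (auto simp: cpolydisc_def dist_norm)
    qed (use F in auto)
    then have "norm ((deriv ^^ j) (\<lambda>v. F (z, v)) b) / fact j \<le> fact j * M / r ^ j / fact j"
      by (rule divide_right_mono) simp
    then show ?thesis
      by (simp add: A_def pdy_funpow_deriv norm_divide)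
  qed
  have cb: "norm (c i j) \<le> M / r ^ (i + j)" for i j
  proof -
    have "norm ((deriv ^^ i) (A j) a) \<le> fact i * (M / r ^ j) / r ^ i"
    proof (rule Cauchy_inequality)
      show "A j holomorphic_on ball a r"
        by (rule holomorphic_on_subset[OF Ahol ball_subset_cball])
      show "continuous_on (cball a r) (A j)"
        using Ahol holomorphic_on_imp_continuous_on by blast
      show "norm (A j x) \<le> M / r ^ j" if "norm (a - x) = r" for x
        using Abd that by (auto simp: dist_norm)
    qed (use F in auto)
    then have "norm ((deriv ^^ i) (A j) a) / fact i \<le> fact i * (M / r ^ j) / r ^ i / fact i"
      by (rule divide_right_mono) simp
    then show ?thesis
      by (simp add: c_def norm_divide power_add mult.commute)
  qed
  have cbd: "cbound c M r" using cb F by (auto simp: cbound_def)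
  have "F (a + z, b + w) = psum c z w" if zw: "norm z < r" "norm w < r" for z w
  proof -
    \<comment> \<open>The index pairs are swapped because the inner sum must run over i for fixed j,
      where it yields \<open>A j\<close>.\<close>
    have "((\<lambda>ij. pterm c z w (prod.swap ij)) has_sum psum c z w) UNIV"
      using pterm_has_sum[OF cbd zw] by (subst has_sum_reindex_bij_betw[OF bij_swap])
    then have swap: "((\<lambda>(j, i). pterm c z w (i, j)) has_sum psum c z w) (UNIV \<times> UNIV)"
      by (simp add: case_prod_unfold prod.swap_def)
    have sum2: "((\<lambda>i. pterm c z w (i, j)) has_sum (A j (a + z) * w ^ j)) UNIV" for j
    proof -
      have az: "a + z \<in> ball a r" using zw by (simp add: dist_norm)
      have "(\<lambda>n. (deriv ^^ n) (A j) a / fact n * (a + z - a) ^ n) sums A j (a + z)"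
        by (rule holomorphic_power_series[OF holomorphic_on_subset[OF Ahol ball_subset_cball] az])
      then have s: "(\<lambda>i. c i j * z ^ i) sums A j (a + z)" by (simp add: c_def)
      have "summable (\<lambda>i. norm (c i j * z ^ i))"
      proof (rule summable_comparison_test')
        show "summable (\<lambda>i. M / r ^ j * (norm z / r) ^ i)"
          using zw F by (intro summable_mult summable_geometric) auto
        show "norm (norm (c i j * z ^ i)) \<le> M / r ^ j * (norm z / r) ^ i" for i
          using mult_right_mono[OF cb[of i j], of "norm z ^ i"] F
          by (simp add: norm_mult norm_power power_divide power_add field_simps)
      qed
      from has_sum_cmult_left[OF norm_summable_imp_has_sum[OF this s], of "w ^ j"]
      show ?thesis by (simp add: pterm_def)
    qed
    have "((\<lambda>j. A j (a + z) * w ^ j) has_sum psum c z w) UNIV"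
      using has_sum_SigmaD[OF swap] sum2 by simp
    then have s1: "(\<lambda>j. A j (a + z) * w ^ j) sums psum c z w"
      by (rule has_sum_imp_sums)
    have "(\<lambda>n. (deriv ^^ n) (\<lambda>v. F (a + z, v)) b / fact n * (b + w - b) ^ n) sums F (a + z, b + w)"
      using slice_hol[of "a + z"] zw holomorphic_on_subset[OF _ ball_subset_cball]
      by (intro holomorphic_power_series[of "\<lambda>v. F (a + z, v)" b r]) (auto simp: dist_norm)
    then have "(\<lambda>j. A j (a + z) * w ^ j) sums F (a + z, b + w)"
      by (simp add: A_def pdy_funpow_deriv)
    then show ?thesis using s1 sums_unique2 by blast
  qed
  then show ?thesis using that cbd p by auto
qed

subsection \<open>Complex extensions of real-analytic functions\<close>

definition emb :: "real \<times> real \<Rightarrow> complex \<times> complex" where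
  "emb p = (of_real (fst p), of_real (snd p))"

text \<open>Agreement is demanded at every real point of S, so identities between extensions can be
  read off as real identities.\<close>

definition cext :: "(real \<times> real \<Rightarrow> real) \<Rightarrow> (complex \<times> complex \<Rightarrow> complex) \<Rightarrow> (complex \<times> complex) set \<Rightarrow> bool" where
  "cext f F S \<longleftrightarrow> hol2 F S \<and> (\<forall>p. emb p \<in> S \<longrightarrow> F (emb p) = of_real (f p))"

lemma cextD: "cext f F S \<Longrightarrow> emb p \<in> S \<Longrightarrow> F (emb p) = of_real (f p)"
  by (simp only: cext_def)

lemma cext_hol2: "cext f F S \<Longrightarrow> hol2 F S"
  by (simp only: cext_def)

lemma open_emb_vimage: "open S \<Longrightarrow> open (emb -` S)"
  unfolding emb_def by (intro open_vimage continuous_intros)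

lemma eventually_emb: "open S \<Longrightarrow> emb p \<in> S \<Longrightarrow> \<forall>\<^sub>F q in nhds p. emb q \<in> S"
  using eventually_nhds_in_open[OF open_emb_vimage, of S p] by simp

text \<open>Along the real embedding the imaginary part of F vanishes near p, so the partial
  derivatives of F have imaginary part zero; the real part differentiates to the partial derivatives
  of f.\<close>

lemma cext_partials:
  assumes "cext f F S" "emb p \<in> S"
  shows "diff2 f p" "pdx F (emb p) = of_real (pdx f p)" "pdy F (emb p) = of_real (pdy f p)"
proof -
  define A B where "A = pdx F (emb p)" and "B = pdy F (emb p)"
  have ev: "\<forall>\<^sub>F q in nhds p. F (emb q) = of_real (f q)"
    by (rule eventually_mono[OF eventually_emb[of S p]]) (use assms hol2_open in \<open>auto simp: cext_def\<close>)
  have "bounded_linear emb"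
    unfolding emb_def
    by (intro bounded_linear_Pair bounded_linear_compose[OF bounded_linear_of_real] bounded_linear_fst bounded_linear_snd)
  then have "(emb has_derivative emb) (at p)" by (rule bounded_linear_imp_has_derivative)
  moreover have "(F has_derivative (\<lambda>h. A * fst h + B * snd h)) (at (emb p))"
    using assms unfolding A_def B_def cext_def hol2_def diff2_def by blast
  ultimately have "(F \<circ> emb has_derivative (\<lambda>h. A * fst h + B * snd h) \<circ> emb) (at p)"
    by (rule diff_chain_at)
  then have d: "((\<lambda>q. F (emb q)) has_derivative (\<lambda>h. A * of_real (fst h) + B * of_real (snd h))) (at p)"
    by (simp add: o_def emb_def)
  have re: "((\<lambda>q. Re (F (emb q))) has_derivative (\<lambda>h. Re A * fst h + Re B * snd h)) (at p)"
    using bounded_linear.has_derivative[OF bounded_linear_Re d] by simp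
  have im: "((\<lambda>q. Im (F (emb q))) has_derivative (\<lambda>h. Im A * fst h + Im B * snd h)) (at p)"
    using bounded_linear.has_derivative[OF bounded_linear_Im d] by simp
  have ev_re: "\<forall>\<^sub>F q in nhds p. f q = Re (F (emb q))" and ev_im: "\<forall>\<^sub>F q in nhds p. 0 = Im (F (emb q))"
    using ev by (eventually_elim, simp)+
  note f = diff2_cong[OF diff2I(1)[OF re] ev_re, unfolded diff2I(2,3)[OF re]]
  note g = diff2_cong(2,3)[OF diff2I(1)[OF im] ev_im, unfolded diff2I(2,3)[OF im] diff2_const]
  show "diff2 f p" "pdx F (emb p) = of_real (pdx f p)" "pdy F (emb p) = of_real (pdy f p)"
    using f g[symmetric] by (simp_all add: A_def B_def complex_eq_iff)
qed

lemma cext_pdx: "cext f F S \<Longrightarrow> cext (pdx f) (pdx F) S"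
  using cext_partials(2) hol2_pdx by (simp add: cext_def)

lemma cext_pdy: "cext f F S \<Longrightarrow> cext (pdy f) (pdy F) S"
  using cext_partials(3) hol2_pdy by (simp add: cext_def)

text \<open>Each term at the single point (r, r) is at most the sum of all absolute values
  there.\<close>

lemma has_sum_imp_cbound:
  fixes c :: "nat \<Rightarrow> nat \<Rightarrow> real"
  assumes "r > 0" "(pterm c r r has_sum s) UNIV"
  obtains M where "cbound c M r"
proof -
  define S where "S = infsum (\<lambda>x. norm (pterm c r r x)) UNIV"
  have "pterm c r r summable_on UNIV" using assms(2) by (rule has_sum_imp_summable)
  then have s: "(\<lambda>x. norm (pterm c r r x)) summable_on UNIV"
    by (rule summable_on_iff_abs_summable_on_real[THEN iffD1])
  have b: "norm (pterm c r r ij) \<le> S" for ij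
  proof -
    have "(\<Sum>x\<in>{ij}. norm (pterm c r r x)) \<le> S"
      unfolding S_def by (rule finite_sum_le_infsum[OF s]) simp_all
    then show ?thesis by simp
  qed
  have "norm (c i j) \<le> S / r ^ (i + j)" for i j
    using b[of "(i, j)"] assms(1)
    by (simp add: pterm_def abs_mult power_abs power_add pos_le_divide_eq mult.assoc)
  then show ?thesis using that assms(1) unfolding cbound_def by blast
qed

text \<open>Forwards, the same coefficients are summed at complex points; backwards, the real parts
  of the coefficients from \<open>osgood\<close> are taken. From here on, closure properties of
  real-analytic functions reduce to those of \<open>hol2\<close>.\<close>

lemma analytic2_at_iff_cext: "analytic2_at f p \<longleftrightarrow> (\<exists>F S. cext f F S \<and> emb p \<in> S)"
proof
  obtain a b where p: "p = (a, b)" by (cases p)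
  assume "analytic2_at f p"
  then obtain c0 r where r: "r > 0" and
    hs0: "\<forall>x y. \<bar>x - a\<bar> < r \<and> \<bar>y - b\<bar> < r \<longrightarrow> ((\<lambda>(i, j). c0 (i, j) * (x - a) ^ i * (y - b) ^ j) has_sum f (x, y)) UNIV"
    unfolding analytic2_at_def p by auto
  define c where "c = (\<lambda>i j. c0 (i, j))"
  have hs: "(pterm c x y has_sum f (a + x, b + y)) UNIV" if "\<bar>x\<bar> < r" "\<bar>y\<bar> < r" for x y
    using hs0[rule_format, of "a + x" "b + y"] that by (simp add: pterm_def c_def)
  \<comment> \<open>The coefficients are bounded by the terms at the corner (R, R), which has to lie
    strictly inside the domain of convergence.\<close>
  define R where "R = r / 2"
  have R: "R > 0" "R < r" using r by (auto simp: R_def)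
  obtain M where M: "cbound c M R" using has_sum_imp_cbound[OF R(1) hs] R by auto
  define d where "d = (\<lambda>i j. complex_of_real (c i j))"
  have d: "cbound d M R" using M by (simp add: cbound_def d_def)
  define T where "T = {z::complex \<times> complex. (fst z - of_real a, snd z - of_real b) \<in> polydisc 0 R}"
  define F where "F = (\<lambda>z. psum d (fst z - of_real a) (snd z - of_real b))"
  have "hol2 F T"
    using hol2_compose[OF hol2_psum[OF d] hol2_intros(5)[OF hol2_intros(2) hol2_intros(1)]
        hol2_intros(5)[OF hol2_intros(3) hol2_intros(1)], of UNIV "of_real a" "of_real b"]
    by (simp add: T_def F_def)
  moreover have "F (emb q) = of_real (f q)" if "emb q \<in> T" for q
  proof -
    obtain x y where q: "q = (a + x, b + y)" by (metis add.commute diff_add_cancel prod.exhaust)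
    have xy: "\<bar>x\<bar> < R" "\<bar>y\<bar> < R"
      using that by (auto simp: T_def emb_def q polydisc_def simp flip: of_real_diff of_real_add)
    then have "((\<lambda>ij. complex_of_real (pterm c x y ij)) has_sum of_real (f q)) UNIV"
      unfolding q using R by (intro has_sum_bounded_linear[OF bounded_linear_of_real] hs) auto
    then have "(pterm d (of_real x) (of_real y) has_sum of_real (f q)) UNIV"
      by (simp add: pterm_def d_def case_prod_unfold)
    moreover have "(pterm d (of_real x) (of_real y) has_sum F (emb q)) UNIV"
      using pterm_has_sum[OF d, of "of_real x" "of_real y"] xy by (simp add: F_def emb_def q)
    ultimately show ?thesis using has_sum_unique by blast
  qed
  ultimately have "cext f F T" by (simp add: cext_def)
  moreover have "emb p \<in> T" using R by (simp add: T_def p emb_def polydisc_def)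
  ultimately show "\<exists>F S. cext f F S \<and> emb p \<in> S" by blast
next
  assume "\<exists>F S. cext f F S \<and> emb p \<in> S"
  then obtain F S where F: "cext f F S" "emb p \<in> S" by blast
  obtain r where r: "r > 0" "cpolydisc (emb p) r \<subseteq> S"
    using open_contains_cpolydisc F hol2_open unfolding cext_def by metis
  obtain c M where c: "cbound c M r"
    "\<And>z w. norm z < r \<Longrightarrow> norm w < r \<Longrightarrow> F (fst (emb p) + z, snd (emb p) + w) = psum c z w"
    using osgood[of F S "emb p" r] F r unfolding cext_def by metis
  have "((\<lambda>(i, j). Re (c i j) * (x - fst p) ^ i * (y - snd p) ^ j) has_sum f (x, y)) UNIV"
    if xy: "\<bar>x - fst p\<bar> < r" "\<bar>y - snd p\<bar> < r" for x y
  proof -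
    define u v where "u = x - fst p" and "v = y - snd p"
    have "emb (x, y) \<in> S"
      using r(2) xy by (auto simp: emb_def cpolydisc_def dist_norm abs_minus_commute simp flip: of_real_diff)
    then have "of_real (f (x, y)) = F (emb (x, y))" using F by (simp add: cext_def)
    also have "\<dots> = psum c (of_real u) (of_real v)"
      using c(2)[of "of_real u" "of_real v"] xy by (simp add: u_def v_def emb_def norm_of_real flip: of_real_diff of_real_add)
    finally have "Re (psum c (of_real u) (of_real v)) = f (x, y)" by (metis Re_complex_of_real)
    with has_sum_Re[OF pterm_has_sum[OF c(1), of "of_real u" "of_real v"]] xy
    have "((\<lambda>ij. Re (pterm c (of_real u) (of_real v) ij)) has_sum f (x, y)) UNIV"
      by (simp add: u_def v_def del: of_real_diff)
    moreover have "Re (pterm c (of_real u) (of_real v) (i, j)) = Re (c i j) * u ^ i * v ^ j" for i j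
      by (simp add: pterm_def flip: of_real_power)
    ultimately have "((\<lambda>(i, j). Re (c i j) * u ^ i * v ^ j) has_sum f (x, y)) UNIV"
      by (simp add: has_sum_cong[of UNIV "\<lambda>ij. Re (pterm c (of_real u) (of_real v) ij)"
          "\<lambda>(i, j). Re (c i j) * u ^ i * v ^ j"] split_paired_all)
    then show ?thesis by (simp only: u_def v_def)
  qed
  then show "analytic2_at f p"
    unfolding analytic2_at_def using r(1) by (intro exI[of _ "\<lambda>(i, j). Re (c i j)"] exI[of _ r]) auto
qed

lemma analytic2E:
  assumes "analytic2_at f p"
  obtains F S where "cext f F S" "emb p \<in> S" "open S"
  using assms hol2_open[OF cext_hol2] unfolding analytic2_at_iff_cext by metis

lemma analytic2_eventually:
  assumes "analytic2_at f p"
  shows "\<forall>\<^sub>F q in nhds p. analytic2_at f q"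
proof -
  obtain F S where F: "cext f F S" "emb p \<in> S" "open S" using assms by (rule analytic2E)
  show ?thesis
    by (rule eventually_mono[OF eventually_emb[OF F(3,2)]]) (use F(1) analytic2_at_iff_cext in blast)
qed

lemma analytic2_diff2: "analytic2_at f p \<Longrightarrow> diff2 f p"
  by (erule analytic2E) (rule cext_partials(1))

lemma analytic2_isCont: "analytic2_at f p \<Longrightarrow> isCont f p"
  by (rule diff2_isCont[OF analytic2_diff2])

lemma analytic2_pdx: "analytic2_at f p \<Longrightarrow> analytic2_at (pdx f) p"
  unfolding analytic2_at_iff_cext by (metis cext_pdx)

lemma analytic2_pdy: "analytic2_at f p \<Longrightarrow> analytic2_at (pdy f) p"
  unfolding analytic2_at_iff_cext by (metis cext_pdy)

lemma analytic2_cong: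
  assumes "analytic2_at f p" "\<forall>\<^sub>F q in nhds p. g q = f q"
  shows "analytic2_at g p"
proof -
  obtain r1 where r1: "r1 > 0" "\<And>q. dist q p < r1 \<Longrightarrow> g q = f q"
    using assms(2) unfolding eventually_nhds_metric by metis
  obtain c r where r: "r > 0" "\<forall>x y. \<bar>x - fst p\<bar> < r \<and> \<bar>y - snd p\<bar> < r \<longrightarrow>
        ((\<lambda>(i, j). c (i, j) * (x - fst p) ^ i * (y - snd p) ^ j) has_sum f (x, y)) UNIV"
    using assms(1) unfolding analytic2_at_def by (elim exE conjE)
  have "dist (x, y) p < r1" if "\<bar>x - fst p\<bar> < r1 / 2" "\<bar>y - snd p\<bar> < r1 / 2" for x y
  proof -
    have "dist (x, y) p \<le> \<bar>x - fst p\<bar> + \<bar>y - snd p\<bar>"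
      by (cases p) (simp add: dist_Pair_Pair dist_real_def sqrt_sum_squares_le_sum_abs)
    then show ?thesis using that by simp
  qed
  then have "\<forall>x y. \<bar>x - fst p\<bar> < min r (r1 / 2) \<and> \<bar>y - snd p\<bar> < min r (r1 / 2) \<longrightarrow>
        ((\<lambda>(i, j). c (i, j) * (x - fst p) ^ i * (y - snd p) ^ j) has_sum g (x, y)) UNIV"
    using r(2) r1(2) by simp
  then show ?thesis unfolding analytic2_at_def using r(1) r1(1)
    by (intro exI[of _ c] exI[of _ "min r (r1 / 2)"]) simp
qed

lemma cext_subset: "cext f F S \<Longrightarrow> open T \<Longrightarrow> T \<subseteq> S \<Longrightarrow> cext f F T"
  unfolding cext_def by (metis hol2_subset subsetD)

lemma cext_const: "open S \<Longrightarrow> cext (\<lambda>z. c) (\<lambda>z. of_real c) S"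
  by (simp add: cext_def hol2_intros(1))

lemma cext_fst: "open S \<Longrightarrow> cext fst fst S"
  by (simp add: cext_def hol2_intros(2) emb_def)

lemma cext_snd: "open S \<Longrightarrow> cext snd snd S"
  by (simp add: cext_def hol2_intros(3) emb_def)

lemma cext_add:
  assumes "cext f F S" "cext g G S"
  shows "cext (\<lambda>z. f z + g z) (\<lambda>z. F z + G z) S"
  using hol2_intros(4)[OF assms[THEN cext_hol2]] cextD[OF assms(1)] cextD[OF assms(2)]
  by (simp add: cext_def del: split_paired_All)

lemma cext_diff:
  assumes "cext f F S" "cext g G S"
  shows "cext (\<lambda>z. f z - g z) (\<lambda>z. F z - G z) S"
  using hol2_intros(5)[OF assms[THEN cext_hol2]] cextD[OF assms(1)] cextD[OF assms(2)]
  by (simp add: cext_def del: split_paired_All)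

lemma cext_mult:
  assumes "cext f F S" "cext g G S"
  shows "cext (\<lambda>z. f z * g z) (\<lambda>z. F z * G z) S"
  using hol2_intros(6)[OF assms[THEN cext_hol2]] cextD[OF assms(1)] cextD[OF assms(2)]
  by (simp add: cext_def del: split_paired_All)

lemma analytic2_common_ext:
  assumes "analytic2_at f p" "analytic2_at g p"
  obtains F G S where "cext f F S" "cext g G S" "emb p \<in> S" "open S"
proof -
  obtain F S where F: "cext f F S" "emb p \<in> S" "open S" using assms(1) by (rule analytic2E)
  obtain G T where G: "cext g G T" "emb p \<in> T" "open T" using assms(2) by (rule analytic2E)
  show ?thesis
    using that[of F "S \<inter> T" G] F G cext_subset[of _ _ _ "S \<inter> T"] by auto
qed

lemma analytic2_const: "analytic2_at (\<lambda>z. c) p"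
  unfolding analytic2_at_iff_cext by (metis cext_const UNIV_I open_UNIV)

lemma analytic2_fst: "analytic2_at fst p"
  unfolding analytic2_at_iff_cext by (metis cext_fst UNIV_I open_UNIV)

lemma analytic2_snd: "analytic2_at snd p"
  unfolding analytic2_at_iff_cext by (metis cext_snd UNIV_I open_UNIV)

lemma analytic2_add: "analytic2_at f p \<Longrightarrow> analytic2_at g p \<Longrightarrow> analytic2_at (\<lambda>z. f z + g z) p"
  by (erule (1) analytic2_common_ext) (use cext_add in \<open>fastforce simp: analytic2_at_iff_cext\<close>)

lemma analytic2_diff: "analytic2_at f p \<Longrightarrow> analytic2_at g p \<Longrightarrow> analytic2_at (\<lambda>z. f z - g z) p"
  by (erule (1) analytic2_common_ext) (use cext_diff in \<open>fastforce simp: analytic2_at_iff_cext\<close>)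

lemma analytic2_mult: "analytic2_at f p \<Longrightarrow> analytic2_at g p \<Longrightarrow> analytic2_at (\<lambda>z. f z * g z) p"
  by (erule (1) analytic2_common_ext) (use cext_mult in \<open>fastforce simp: analytic2_at_iff_cext\<close>)

lemma analytic2_power: "analytic2_at f p \<Longrightarrow> analytic2_at (\<lambda>z. f z ^ n) p"
  by (induction n) (auto intro: analytic2_const analytic2_mult)

lemma analytic2_compose:
  assumes "analytic2_at f (g1 p, g2 p)" "analytic2_at g1 p" "analytic2_at g2 p"
  shows "analytic2_at (\<lambda>z. f (g1 z, g2 z)) p"
proof -
  obtain F S where F: "cext f F S" "emb (g1 p, g2 p) \<in> S" using assms(1) by (rule analytic2E)
  obtain G1 G2 T where G: "cext g1 G1 T" "cext g2 G2 T" "emb p \<in> T" using assms(2,3) by (rule analytic2_common_ext)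
  define U where "U = {z\<in>T. (G1 z, G2 z) \<in> S}"
  have e: "(G1 (emb q), G2 (emb q)) = emb (g1 q, g2 q)" if "emb q \<in> T" for q
    using cextD[OF G(1) that] cextD[OF G(2) that] by (simp add: emb_def)
  have "cext (\<lambda>z. f (g1 z, g2 z)) (\<lambda>z. F (G1 z, G2 z)) U"
    using hol2_compose[OF F(1)[THEN cext_hol2] G(1)[THEN cext_hol2] G(2)[THEN cext_hol2]] cextD[OF F(1)]
    unfolding cext_def U_def by (metis (no_types, lifting) e mem_Collect_eq)
  moreover have "emb p \<in> U" using e F G by (simp add: U_def)
  ultimately show ?thesis unfolding analytic2_at_iff_cext by blast
qed

section \<open>Real-analytic germs of one variable\<close>

lemma analytic1_at_iff_ext:
  "analytic1_at f a \<longleftrightarrow> (\<exists>F A. open A \<and> of_real a \<in> A \<and> F holomorphic_on A \<and>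
      (\<forall>t. complex_of_real t \<in> A \<longrightarrow> F (of_real t) = of_real (f t)))"
proof
  assume "analytic1_at f a"
  then obtain c r where r: "r > 0" "\<And>t. \<bar>t - a\<bar> < r \<Longrightarrow> (\<lambda>n. c n * (t - a) ^ n) sums f t"
    unfolding analytic1_at_def by blast
  define F where "F = (\<lambda>z. \<Sum>n. complex_of_real (c n) * (z - of_real a) ^ n)"
  have s: "(\<lambda>n. complex_of_real (c n) * (z - of_real a) ^ n) sums F z"
    if z: "z \<in> ball (of_real a) r" for z
  proof -
    \<comment> \<open>Convergence is known at real points only; a real point between the modulus of
      z - a and r gives it at the complex point z.\<close>
    obtain u where u: "norm (z - of_real a) < u" "u < r"
      using z dense by (auto simp: dist_norm norm_minus_commute)
    have u0: "0 < u" using u norm_ge_zero[of "z - of_real a"] by linarith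
    then have "summable (\<lambda>n. c n * u ^ n)" using r(2)[of "a + u"] u by (simp add: sums_iff)
    then have "summable (\<lambda>n. complex_of_real (c n * u ^ n))" by (rule summable_of_real)
    then have "summable (\<lambda>n. complex_of_real (c n) * (of_real u) ^ n)" by simp
    then have "summable (\<lambda>n. complex_of_real (c n) * (z - of_real a) ^ n)"
      by (rule powser_inside) (use u u0 in simp)
    then show ?thesis by (simp add: F_def summable_sums)
  qed
  have "F holomorphic_on ball (of_real a) r"
    using power_series_holomorphic[of "of_real a" r "\<lambda>n. complex_of_real (c n)" F] s by blast
  moreover have "F (of_real t) = of_real (f t)" if "complex_of_real t \<in> ball (of_real a) r" for t
  proof -
    have "\<bar>t - a\<bar> < r" using that by (simp add: dist_norm norm_minus_commute flip: of_real_diff)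
    from sums_of_real[OF r(2)[OF this], where 'a=complex] s[OF that] show ?thesis
      using sums_unique2 by fastforce
  qed
  ultimately show "\<exists>F A. open A \<and> of_real a \<in> A \<and> F holomorphic_on A \<and>
      (\<forall>t. complex_of_real t \<in> A \<longrightarrow> F (of_real t) = of_real (f t))"
    using r(1) by (intro exI[of _ F] exI[of _ "ball (of_real a) r"]) auto
next
  assume "\<exists>F A. open A \<and> of_real a \<in> A \<and> F holomorphic_on A \<and>
      (\<forall>t. complex_of_real t \<in> A \<longrightarrow> F (of_real t) = of_real (f t))"
  then obtain F A where F: "open A" "of_real a \<in> A" "F holomorphic_on A"
    "\<And>t. complex_of_real t \<in> A \<Longrightarrow> F (of_real t) = of_real (f t)" by blast
  obtain r where r: "r > 0" "ball (of_real a) r \<subseteq> A" using F open_contains_ball by blast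
  define d where "d = (\<lambda>n. (deriv ^^ n) F (of_real a) / fact n)"
  have "(\<lambda>n. Re (d n) * (t - a) ^ n) sums f t" if "\<bar>t - a\<bar> < r" for t
  proof -
    have t: "complex_of_real t \<in> ball (of_real a) r"
      using that by (simp add: dist_norm norm_minus_commute flip: of_real_diff)
    have "(\<lambda>n. d n * (of_real t - of_real a) ^ n) sums F (of_real t)"
      unfolding d_def by (rule holomorphic_power_series[OF holomorphic_on_subset[OF F(3) r(2)] t])
    then have "(\<lambda>n. d n * of_real ((t - a) ^ n)) sums of_real (f t)"
      using F(4)[of t] r(2) t by (simp add: subset_iff del: mem_ball flip: of_real_diff)
    from sums_Re[OF this] show ?thesis by simp
  qed
  then show "analytic1_at f a"
    unfolding analytic1_at_def using r(1) by (intro exI[of _ "\<lambda>n. Re (d n)"] exI[of _ r]) simp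
qed

lemma analytic2_compose1:
  assumes "analytic1_at f (g p)" "analytic2_at g p"
  shows "analytic2_at (\<lambda>z. f (g z)) p"
proof -
  obtain F A where F: "open A" "of_real (g p) \<in> A" "F holomorphic_on A"
    "\<And>t. complex_of_real t \<in> A \<Longrightarrow> F (of_real t) = of_real (f t)"
    using assms(1) unfolding analytic1_at_iff_ext by blast
  obtain G T where G: "cext g G T" "emb p \<in> T" using assms(2) by (rule analytic2E)
  have "cext (\<lambda>z. f (g z)) (\<lambda>z. F (G z)) {z\<in>T. G z \<in> A}"
    using hol2_compose1[OF F(3,1), of G T] F G by (auto simp: cext_def)
  moreover have "emb p \<in> {z\<in>T. G z \<in> A}" using F(2) G(2) cextD[OF G] by simp
  ultimately show ?thesis unfolding analytic2_at_iff_cext by blast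
qed

lemma analytic1_slice:
  assumes "analytic2_at f (a, b)"
  shows "analytic1_at (\<lambda>t. f (t, b)) a"
proof -
  obtain F S where F: "cext f F S" "emb (a, b) \<in> S" "open S" using assms by (rule analytic2E)
  define A where "A = {z. (z, complex_of_real b) \<in> S}"
  have "open ((\<lambda>z. (z, complex_of_real b)) -` S)"
    by (intro open_vimage F continuous_intros)
  then have "open A" by (simp add: A_def vimage_def)
  moreover have "(\<lambda>z. F (z, of_real b)) holomorphic_on A"
    using F by (intro hol2_slice_x[of F S]) (auto simp: cext_def A_def)
  moreover have "F (of_real t, of_real b) = of_real (f (t, b))" if "of_real t \<in> A" for t
    using F that by (auto simp: cext_def A_def emb_def)
  ultimately show ?thesis unfolding analytic1_at_iff_ext
    using F by (intro exI[of _ "\<lambda>z. F (z, of_real b)"] exI[of _ A]) (auto simp: A_def emb_def)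
qed

text \<open>One-variable germs are treated as two-variable germs independent of the second
  coordinate; the rules for sums, products, composition and derivatives are then inherited by
  slicing.\<close>

lemma analytic1_iff_analytic2: "analytic1_at f a \<longleftrightarrow> analytic2_at (\<lambda>z. f (fst z)) (a, b)"
proof
  show "analytic1_at f a \<Longrightarrow> analytic2_at (\<lambda>z. f (fst z)) (a, b)"
    using analytic2_compose1[of f fst "(a, b)"] analytic2_fst by simp
  show "analytic2_at (\<lambda>z. f (fst z)) (a, b) \<Longrightarrow> analytic1_at f a"
    using analytic1_slice[of "\<lambda>z. f (fst z)" a b] by simp
qed

lemmas analytic1_imp_analytic2 = analytic1_iff_analytic2[THEN iffD1]

lemma analytic1_const: "analytic1_at (\<lambda>t. c) a"
  using analytic1_slice[OF analytic2_const] .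

lemma analytic1_id: "analytic1_at (\<lambda>t. t) a"
  using analytic1_slice[OF analytic2_fst, of a] by simp

lemma analytic1_compose:
  "analytic1_at f (g a) \<Longrightarrow> analytic1_at g a \<Longrightarrow> analytic1_at (\<lambda>t. f (g t)) a"
  using analytic1_slice[OF analytic2_compose1[of f "\<lambda>z. g (fst z)" "(a, 0)"]] analytic1_imp_analytic2 by simp

lemma analytic1_add: "analytic1_at f a \<Longrightarrow> analytic1_at g a \<Longrightarrow> analytic1_at (\<lambda>t. f t + g t) a"
  using analytic1_slice[OF analytic2_add[OF analytic1_imp_analytic2 analytic1_imp_analytic2]] by simp

lemma analytic1_diff: "analytic1_at f a \<Longrightarrow> analytic1_at g a \<Longrightarrow> analytic1_at (\<lambda>t. f t - g t) a"
  using analytic1_slice[OF analytic2_diff[OF analytic1_imp_analytic2 analytic1_imp_analytic2]] by simp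

lemma analytic1_mult: "analytic1_at f a \<Longrightarrow> analytic1_at g a \<Longrightarrow> analytic1_at (\<lambda>t. f t * g t) a"
  using analytic1_slice[OF analytic2_mult[OF analytic1_imp_analytic2 analytic1_imp_analytic2]] by simp

lemma analytic1_power: "analytic1_at f a \<Longrightarrow> analytic1_at (\<lambda>t. f t ^ n) a"
  by (induction n) (auto intro: analytic1_const analytic1_mult)

lemma analytic1_inverse: "a \<noteq> 0 \<Longrightarrow> analytic1_at (\<lambda>t. inverse t) a"
  unfolding analytic1_at_iff_ext
  by (intro exI[of _ inverse] exI[of _ "- {0}"]) (auto intro!: holomorphic_intros)

lemma analytic1_divide:
  "analytic1_at f a \<Longrightarrow> analytic1_at g a \<Longrightarrow> g a \<noteq> 0 \<Longrightarrow> analytic1_at (\<lambda>t. f t / g t) a"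
  unfolding divide_inverse by (rule analytic1_mult[OF _ analytic1_compose[OF analytic1_inverse, of g a]])

lemma analytic2_divide:
  "analytic2_at f p \<Longrightarrow> analytic2_at g p \<Longrightarrow> g p \<noteq> 0 \<Longrightarrow> analytic2_at (\<lambda>z. f z / g z) p"
  unfolding divide_inverse by (rule analytic2_mult[OF _ analytic2_compose1[OF analytic1_inverse, of g p]])

lemma analytic1_deriv:
  assumes "analytic1_at f a"
  shows "(f has_field_derivative deriv f a) (at a)" "analytic1_at (deriv f) a"
proof -
  have f: "analytic2_at (\<lambda>z. f (fst z)) (a, 0)" by (rule analytic1_imp_analytic2[OF assms])
  have p: "pdx (\<lambda>z. f (fst z)) (t, 0) = deriv f t" for t by (simp add: pdx_def)
  show "(f has_field_derivative deriv f a) (at a)"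
    using diff2_slices(1)[OF analytic2_diff2[OF f]] p by simp
  show "analytic1_at (deriv f) a"
    using analytic1_slice[OF analytic2_pdx[OF f]] p by simp
qed

lemma analytic1_isCont: "analytic1_at f a \<Longrightarrow> isCont f a"
  by (rule DERIV_isCont[OF analytic1_deriv(1)])

lemma analytic1_eventually:
  assumes "analytic1_at f a"
  shows "\<forall>\<^sub>F t in nhds a. analytic1_at f t"
proof -
  obtain F A where F: "open A" "of_real a \<in> A" "F holomorphic_on A"
    "\<And>t. complex_of_real t \<in> A \<Longrightarrow> F (of_real t) = of_real (f t)"
    using assms(1) unfolding analytic1_at_iff_ext by blast
  have "open (complex_of_real -` A)" by (intro open_vimage F continuous_intros)
  then have "\<forall>\<^sub>F t in nhds a. t \<in> complex_of_real -` A"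
    using F(2) by (intro eventually_nhds_in_open) auto
  then show ?thesis by eventually_elim (use F in \<open>auto simp: analytic1_at_iff_ext\<close>)
qed

subsection \<open>Taylor coefficients at the origin\<close>

lemma eventually_nhds_zero_iff:
  "(\<forall>\<^sub>F z in nhds (0 :: real \<times> real). P z) \<longleftrightarrow> (\<exists>r>0. \<forall>x y. \<bar>x\<bar> < r \<and> \<bar>y\<bar> < r \<longrightarrow> P (x, y))"
proof
  assume "\<forall>\<^sub>F z in nhds (0 :: real \<times> real). P z"
  then obtain e where e: "e > 0" "\<forall>z. dist z (0 :: real \<times> real) < e \<longrightarrow> P z"
    unfolding eventually_nhds_metric by metis
  have "P (x, y)" if "\<bar>x\<bar> < e / 2" "\<bar>y\<bar> < e / 2" for x y
  proof -
    have "dist (x, y) (0 :: real \<times> real) \<le> \<bar>x\<bar> + \<bar>y\<bar>"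
      by (simp add: norm_Pair sqrt_sum_squares_le_sum_abs)
    then show ?thesis using that e(2) by auto
  qed
  then show "\<exists>r>0. \<forall>x y. \<bar>x\<bar> < r \<and> \<bar>y\<bar> < r \<longrightarrow> P (x, y)"
    using e(1) by (intro exI[of _ "e / 2"]) auto
next
  assume "\<exists>r>0. \<forall>x y. \<bar>x\<bar> < r \<and> \<bar>y\<bar> < r \<longrightarrow> P (x, y)"
  then obtain r where r: "r > 0" "\<forall>x y. \<bar>x\<bar> < r \<and> \<bar>y\<bar> < r \<longrightarrow> P (x, y)" by (elim exE conjE)
  have "open ({-r<..<r} \<times> {-r<..<r})" by (intro open_Times open_greaterThanLessThan)
  then have "\<forall>\<^sub>F z in nhds (0 :: real \<times> real). z \<in> {-r<..<r} \<times> {-r<..<r}"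
    by (rule eventually_nhds_in_open) (use r in \<open>auto simp: zero_prod_def\<close>)
  then show "\<forall>\<^sub>F z in nhds (0 :: real \<times> real). P z"
    by (rule eventually_mono) (use r(2) in \<open>auto simp: abs_less_iff\<close>)
qed

lemma eventually_nhds_nhds: "(\<forall>\<^sub>F x in nhds a. P x) \<Longrightarrow> \<forall>\<^sub>F x in nhds a. \<forall>\<^sub>F y in nhds x. P y"
  by (simp add: eventually_eventually)

text \<open>The bounds are existential, so that c describes the germ of f at 0: it determines f near
  0 by \<open>ps_eq\<close> and is determined by it by \<open>ps_unique\<close>.\<close>

definition ps :: "(nat \<Rightarrow> nat \<Rightarrow> real) \<Rightarrow> (real \<times> real \<Rightarrow> real) \<Rightarrow> bool" where
  "ps c f \<longleftrightarrow> (\<exists>M R. cbound c M R \<and> (\<forall>x y. \<bar>x\<bar> < R \<and> \<bar>y\<bar> < R \<longrightarrow> f (x, y) = psum c x y))"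

lemma cbound_nonneg: "cbound c M R \<Longrightarrow> 0 \<le> M"
  unfolding cbound_def by (metis add_0 norm_ge_zero order_trans power_0 div_by_1)

lemma cbound_shrink:
  assumes "cbound c M R" "0 < r" "r \<le> R"
  shows "cbound c M r"
proof -
  have "norm (c i j) \<le> M / r ^ (i + j)" for i j
  proof -
    have "norm (c i j) \<le> M / R ^ (i + j)" using assms by (simp add: cbound_def)
    also have "\<dots> \<le> M / r ^ (i + j)"
      using assms cbound_nonneg[OF assms(1)] by (intro divide_left_mono power_mono) auto
    finally show ?thesis .
  qed
  then show ?thesis using assms(2) by (simp add: cbound_def)
qed

lemma ps_analytic2: "ps c f \<Longrightarrow> analytic2_at f 0"
proof -
  assume "ps c f"
  then obtain M R where R: "cbound c M R" "\<forall>x y. \<bar>x\<bar> < R \<and> \<bar>y\<bar> < R \<longrightarrow> f (x, y) = psum c x y"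
    unfolding ps_def by (elim exE conjE)
  have "\<forall>x y. \<bar>x\<bar> < R \<and> \<bar>y\<bar> < R \<longrightarrow> ((\<lambda>(i, j). c i j * x ^ i * y ^ j) has_sum f (x, y)) UNIV"
    using pterm_has_sum[OF R(1)] R(2) by (simp add: pterm_def)
  then show ?thesis unfolding analytic2_at_def using R(1)
    by (intro exI[of _ "\<lambda>(i, j). c i j"] exI[of _ R]) (simp add: cbound_def)
qed

lemma ps_exists:
  assumes "analytic2_at f 0"
  obtains c where "ps c f"
proof -
  obtain c0 r where r: "r > 0" and
    hs0: "\<forall>x y. \<bar>x - fst (0 :: real \<times> real)\<bar> < r \<and> \<bar>y - snd (0 :: real \<times> real)\<bar> < r \<longrightarrow>
      ((\<lambda>(i, j). c0 (i, j) * (x - fst (0 :: real \<times> real)) ^ i * (y - snd (0 :: real \<times> real)) ^ j) has_sum f (x, y)) UNIV"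
    using assms unfolding analytic2_at_def by (elim exE conjE)
  define c where "c = (\<lambda>i j. c0 (i, j))"
  have hs: "(pterm c x y has_sum f (x, y)) UNIV" if "\<bar>x\<bar> < r" "\<bar>y\<bar> < r" for x y
    using hs0[rule_format, of x y] that by (simp add: pterm_def c_def)
  obtain M where M: "cbound c M (r / 2)" using has_sum_imp_cbound[of "r / 2" c, OF _ hs] r by auto
  have "f (x, y) = psum c x y" if "\<bar>x\<bar> < r / 2" "\<bar>y\<bar> < r / 2" for x y
    unfolding psum_def using infsumI[OF hs[of x y]] that by simp
  then have "ps c f" unfolding ps_def using M by (intro exI[of _ M] exI[of _ "r / 2"]) simp
  then show ?thesis by (rule that)
qed

lemma psI:
  assumes "cbound c M R" "r > 0" "\<And>x y. \<bar>x\<bar> < r \<Longrightarrow> \<bar>y\<bar> < r \<Longrightarrow> (pterm c x y has_sum f (x, y)) UNIV"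
  shows "ps c f"
proof -
  have "R > 0" using assms by (simp add: cbound_def)
  then have "cbound c M (min r R)" using cbound_shrink[OF assms(1)] assms(2) by simp
  moreover have "f (x, y) = psum c x y" if "\<bar>x\<bar> < r" "\<bar>y\<bar> < r" for x y
    unfolding psum_def using infsumI[OF assms(3)] that by simp
  ultimately show ?thesis unfolding ps_def by (intro exI[of _ M] exI[of _ "min r R"]) simp
qed

lemma psD:
  assumes "ps c f"
  obtains M R where "cbound c M R" "R > 0" "\<And>x y. \<bar>x\<bar> < R \<Longrightarrow> \<bar>y\<bar> < R \<Longrightarrow> (pterm c x y has_sum f (x, y)) UNIV"
proof -
  obtain M R where R: "cbound c M R" "\<forall>x y. \<bar>x\<bar> < R \<and> \<bar>y\<bar> < R \<longrightarrow> f (x, y) = psum c x y"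
    using assms(1) unfolding ps_def by (elim exE conjE)
  show ?thesis
    using that[OF R(1)] pterm_has_sum[OF R(1)] R by (simp add: cbound_def)
qed

lemma psD2:
  assumes "ps c f" "ps d g"
  obtains M R where "cbound c M R" "cbound d M R" "R > 0" "M \<ge> 0"
    "\<And>x y. \<bar>x\<bar> < R \<Longrightarrow> \<bar>y\<bar> < R \<Longrightarrow> (pterm c x y has_sum f (x, y)) UNIV"
    "\<And>x y. \<bar>x\<bar> < R \<Longrightarrow> \<bar>y\<bar> < R \<Longrightarrow> (pterm d x y has_sum g (x, y)) UNIV"
proof -
  obtain M1 R1 where 1: "cbound c M1 R1" "R1 > 0" "\<And>x y. \<bar>x\<bar> < R1 \<Longrightarrow> \<bar>y\<bar> < R1 \<Longrightarrow> (pterm c x y has_sum f (x, y)) UNIV"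
    using psD[OF assms(1)] by metis
  obtain M2 R2 where 2: "cbound d M2 R2" "R2 > 0" "\<And>x y. \<bar>x\<bar> < R2 \<Longrightarrow> \<bar>y\<bar> < R2 \<Longrightarrow> (pterm d x y has_sum g (x, y)) UNIV"
    using psD[OF assms(2)] by metis
  have mono: "cbound e (max M1 M2) R" if "cbound e M R" "M \<le> max M1 M2" for e :: "nat \<Rightarrow> nat \<Rightarrow> real" and M R
    using that unfolding cbound_def
    by (meson divide_right_mono order_trans zero_le_power less_imp_le)
  have "cbound c (max M1 M2) (min R1 R2)" "cbound d (max M1 M2) (min R1 R2)"
    using cbound_shrink[OF 1(1), of "min R1 R2"] cbound_shrink[OF 2(1), of "min R1 R2"] 1 2
    by (auto intro: mono)
  moreover have "max M1 M2 \<ge> 0" using cbound_nonneg[OF 1(1)] by simp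
  ultimately show ?thesis using that[of "max M1 M2" "min R1 R2"] 1 2 by simp
qed

lemma ps_add:
  assumes "ps c f" "ps d g"
  shows "ps (\<lambda>i j. c i j + d i j) (\<lambda>z. f z + g z)"
proof -
  obtain M R where *: "cbound c M R" "cbound d M R" "R > 0" "M \<ge> 0"
    "\<And>x y. \<bar>x\<bar> < R \<Longrightarrow> \<bar>y\<bar> < R \<Longrightarrow> (pterm c x y has_sum f (x, y)) UNIV"
    "\<And>x y. \<bar>x\<bar> < R \<Longrightarrow> \<bar>y\<bar> < R \<Longrightarrow> (pterm d x y has_sum g (x, y)) UNIV"
    using psD2[OF assms] by metis
  have "norm (c i j + d i j) \<le> 2 * M / R ^ (i + j)" for i j
  proof -
    have "norm (c i j) \<le> M / R ^ (i + j)" "norm (d i j) \<le> M / R ^ (i + j)"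
      using *(1,2) unfolding cbound_def by auto
    then show ?thesis using norm_triangle_ineq[of "c i j" "d i j"] by simp
  qed
  then have "cbound (\<lambda>i j. c i j + d i j) (2 * M) R" using *(3) unfolding cbound_def by simp
  then show ?thesis
    by (rule psI[OF _ *(3)]) (use has_sum_add[OF *(5,6)] in \<open>simp add: pterm_def case_prod_unfold algebra_simps\<close>)
qed

lemma ps_cmult:
  assumes "ps c f"
  shows "ps (\<lambda>i j. a * c i j) (\<lambda>z. a * f z)"
proof -
  obtain M R where *: "cbound c M R" "R > 0" "\<And>x y. \<bar>x\<bar> < R \<Longrightarrow> \<bar>y\<bar> < R \<Longrightarrow> (pterm c x y has_sum f (x, y)) UNIV"
    using psD[OF assms] by metis
  have "cbound (\<lambda>i j. a * c i j) (\<bar>a\<bar> * M) R"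
    using *(1) mult_left_mono[of "norm (c _ _)" _ "\<bar>a\<bar>"] unfolding cbound_def
    by (metis abs_ge_zero norm_mult real_norm_def times_divide_eq_right)
  then show ?thesis
    by (rule psI[OF _ *(2)]) (use has_sum_cmult_right[OF *(3), of _ _ a] in \<open>simp add: pterm_def case_prod_unfold algebra_simps\<close>)
qed

lemma ps_diff:
  assumes "ps c f" "ps d g"
  shows "ps (\<lambda>i j. c i j - d i j) (\<lambda>z. f z - g z)"
  using ps_add[OF assms(1) ps_cmult[OF assms(2), of "-1"]] by simp

lemma ps_swap:
  assumes "ps c f"
  shows "ps (\<lambda>i j. c j i) (\<lambda>z. f (snd z, fst z))"
proof -
  obtain M R where *: "cbound c M R" "R > 0" "\<And>x y. \<bar>x\<bar> < R \<Longrightarrow> \<bar>y\<bar> < R \<Longrightarrow> (pterm c x y has_sum f (x, y)) UNIV"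
    using psD[OF assms] by metis
  have "cbound (\<lambda>i j. c j i) M R" using *(1) unfolding cbound_def by (metis add.commute)
  then show ?thesis
  proof (rule psI[OF _ *(2)])
    fix x y :: real assume "\<bar>x\<bar> < R" "\<bar>y\<bar> < R"
    then have "((\<lambda>ij. pterm c y x (prod.swap ij)) has_sum f (y, x)) UNIV"
      using *(3)[of y x] by (subst has_sum_reindex_bij_betw[OF bij_swap])
    then show "(pterm (\<lambda>i j. c j i) x y has_sum f (snd (x, y), fst (x, y))) UNIV"
      by (simp add: pterm_def case_prod_unfold prod.swap_def mult.commute mult.left_commute)
  qed
qed

text \<open>Used for multiplication by x and for differentiation in x, both of which shift the first
  index by one.\<close>

lemma has_sum_shift_x:
  fixes g :: "nat \<times> nat \<Rightarrow> real"
  assumes "\<And>j. g (0, j) = 0"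
  shows "(g has_sum s) UNIV \<longleftrightarrow> ((\<lambda>(i, j). g (Suc i, j)) has_sum s) UNIV"
proof -
  define h where "h = (\<lambda>(i::nat, j::nat). (Suc i, j))"
  have "inj h" by (auto simp: h_def inj_on_def)
  have "(g has_sum s) UNIV \<longleftrightarrow> (g has_sum s) (range h)"
  proof (rule has_sum_cong_neutral)
    fix x assume "x \<in> UNIV - range h"
    then have "fst x = 0" by (cases x; cases "fst x") (auto simp: h_def image_iff)
    then show "g x = 0" using assms by (cases x) simp
  qed auto
  also have "\<dots> \<longleftrightarrow> ((g \<circ> h) has_sum s) UNIV" by (rule has_sum_reindex[OF \<open>inj h\<close>])
  finally show ?thesis by (simp add: h_def o_def case_prod_unfold)
qed

lemma ps_mulx:
  assumes "ps c f"
  shows "ps (\<lambda>i j. if i = 0 then 0 else c (i - 1) j) (\<lambda>z. fst z * f z)"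
proof -
  obtain M R where *: "cbound c M R" "R > 0" "\<And>x y. \<bar>x\<bar> < R \<Longrightarrow> \<bar>y\<bar> < R \<Longrightarrow> (pterm c x y has_sum f (x, y)) UNIV"
    using psD[OF assms] by metis
  have "norm (if i = 0 then 0 else c (i - 1) j) \<le> M * R / R ^ (i + j)" for i j
  proof (cases i)
    case (Suc k)
    have "norm (c k j) \<le> M / R ^ (k + j)" using *(1) by (simp add: cbound_def)
    then show ?thesis using Suc *(2) by simp
  qed (use *(2) cbound_nonneg[OF *(1)] in simp)
  then have "cbound (\<lambda>i j. if i = 0 then 0 else c (i - 1) j) (M * R) R"
    using *(2) by (simp only: cbound_def simp_thms)
  then show ?thesis
  proof (rule psI[OF _ *(2)])
    fix x y :: real assume xy: "\<bar>x\<bar> < R" "\<bar>y\<bar> < R"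
    have "((\<lambda>(i, j). pterm (\<lambda>i j. if i = 0 then 0 else c (i - 1) j) x y (Suc i, j)) has_sum x * f (x, y)) UNIV"
      using has_sum_cmult_right[OF *(3)[OF xy], of x] by (simp add: pterm_def case_prod_unfold mult_ac)
    then show "(pterm (\<lambda>i j. if i = 0 then 0 else c (i - 1) j) x y has_sum fst (x, y) * f (x, y)) UNIV"
      by (subst has_sum_shift_x) (auto simp: pterm_def)
  qed
qed

lemma ps_muly:
  assumes "ps c f"
  shows "ps (\<lambda>i j. if j = 0 then 0 else c i (j - 1)) (\<lambda>z. snd z * f z)"
  using ps_swap[OF ps_mulx[OF ps_swap[OF assms]]] by simp

lemma ps_pdx:
  assumes "ps c f"
  shows "ps (\<lambda>i j. of_nat (Suc i) * c (Suc i) j) (pdx f)"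
proof -
  obtain M R where *: "cbound c M R" "R > 0" "\<And>x y. \<bar>x\<bar> < R \<Longrightarrow> \<bar>y\<bar> < R \<Longrightarrow> (pterm c x y has_sum f (x, y)) UNIV"
    using psD[OF assms] by metis
  \<comment> \<open>Termwise differentiation is available for complex series, so the real series is
    extended and the result restricted again.\<close>
  define d where "d = (\<lambda>i j. complex_of_real (c i j))"
  have d: "cbound d M R" using *(1) by (simp add: cbound_def d_def)
  define F where "F = (\<lambda>z. psum d (fst z) (snd z))"
  have inR: "emb (x, y) \<in> polydisc 0 R \<longleftrightarrow> \<bar>x\<bar> < R \<and> \<bar>y\<bar> < R" for x y
    by (simp add: emb_def polydisc_def)
  have ext: "F (emb (x, y)) = of_real (f (x, y))" if "\<bar>x\<bar> < R" "\<bar>y\<bar> < R" for x y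
  proof -
    have "((\<lambda>ij. complex_of_real (pterm c x y ij)) has_sum of_real (f (x, y))) UNIV"
      by (rule has_sum_bounded_linear[OF bounded_linear_of_real *(3)[OF that]])
    then have "(pterm d (of_real x) (of_real y) has_sum of_real (f (x, y))) UNIV"
      by (simp add: pterm_def d_def case_prod_unfold)
    then show ?thesis unfolding F_def psum_def emb_def by (simp add: infsumI)
  qed
  have cx: "cext f F (polydisc 0 R)"
    unfolding cext_def using hol2_psum[OF d] ext inR by (simp add: F_def split_paired_all)
  have hs: "((\<lambda>(i, j). of_nat i * c i j * x ^ (i - 1) * y ^ j) has_sum pdx f (x, y)) UNIV"
    if xy: "\<bar>x\<bar> < R" "\<bar>y\<bar> < R" for x y
  proof -
    have "((\<lambda>(i, j). of_nat i * d i j * of_real x ^ (i - 1) * of_real y ^ j) has_sum of_real (pdx f (x, y))) UNIV"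
      using psum_pdx[OF d, of "of_real x" "of_real y"] cext_partials(2)[OF cx, of "(x, y)"] inR[of x y] xy
      by (simp add: F_def emb_def)
    from has_sum_Re[OF this] show ?thesis
      by (simp add: d_def case_prod_unfold flip: of_real_power)
  qed
  \<comment> \<open>Halving the radius absorbs the factor i + 1, since i + 1 is at most 2^i.\<close>
  have "norm (of_nat (Suc i) * c (Suc i) j) \<le> M / R / (R / 2) ^ (i + j)" for i j
  proof -
    have n: "of_nat (Suc i) \<le> (2::real) ^ (i + j)"
    proof -
      have "Suc i \<le> 2 ^ i" by (simp add: Suc_leI)
      also have "\<dots> \<le> 2 ^ (i + j)" by simp
      finally show ?thesis by (metis of_nat_le_iff of_nat_numeral of_nat_power)
    qed
    have "norm (c (Suc i) j) \<le> M / R ^ (Suc i + j)" using *(1) unfolding cbound_def by blast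
    then have "norm (of_nat (Suc i) * c (Suc i) j) \<le> 2 ^ (i + j) * (M / R ^ (Suc i + j))"
      unfolding norm_mult using n by (intro mult_mono) auto
    then show ?thesis using *(2) by (simp add: power_divide mult_ac)
  qed
  then have "cbound (\<lambda>i j. of_nat (Suc i) * c (Suc i) j) (M / R) (R / 2)"
    using *(2) unfolding cbound_def by simp
  then show ?thesis
  proof (rule psI[OF _ *(2)])
    fix x y :: real assume xy: "\<bar>x\<bar> < R" "\<bar>y\<bar> < R"
    show "(pterm (\<lambda>i j. of_nat (Suc i) * c (Suc i) j) x y has_sum pdx f (x, y)) UNIV"
      using hs[OF xy] by (subst (asm) has_sum_shift_x) (simp_all add: pterm_def)
  qed
qed

lemma ps_pdy:
  assumes "ps c f"
  shows "ps (\<lambda>i j. of_nat (Suc j) * c i (Suc j)) (pdy f)"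
proof -
  have "pdy f = (\<lambda>z. pdx (\<lambda>z. f (snd z, fst z)) (snd z, fst z))"
    by (simp add: pdx_def pdy_def fun_eq_iff)
  then show ?thesis using ps_swap[OF ps_pdx[OF ps_swap[OF assms]]] by simp
qed

lemma ps_eq:
  assumes "ps c f" "ps c g"
  shows "\<forall>\<^sub>F z in nhds 0. f z = g z"
proof -
  obtain M R where *: "cbound c M R" "cbound c M R" "R > 0" "M \<ge> 0"
    "\<And>x y. \<bar>x\<bar> < R \<Longrightarrow> \<bar>y\<bar> < R \<Longrightarrow> (pterm c x y has_sum f (x, y)) UNIV"
    "\<And>x y. \<bar>x\<bar> < R \<Longrightarrow> \<bar>y\<bar> < R \<Longrightarrow> (pterm c x y has_sum g (x, y)) UNIV"
    using psD2[OF assms] by metis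
  have "f (x, y) = g (x, y)" if "\<bar>x\<bar> < R" "\<bar>y\<bar> < R" for x y
    by (rule has_sum_unique[OF *(5)[OF that] *(6)[OF that]])
  then show ?thesis unfolding eventually_nhds_zero_iff using *(3) by (intro exI[of _ R]) simp
qed

lemma ps_at_zero: "ps c f \<Longrightarrow> f 0 = c 0 0"
proof -
  assume "ps c f"
  then obtain M R where *: "cbound c M R" "R > 0" "\<And>x y. \<bar>x\<bar> < R \<Longrightarrow> \<bar>y\<bar> < R \<Longrightarrow> (pterm c x y has_sum f (x, y)) UNIV"
    using psD by metis
  have h1: "(pterm c 0 0 has_sum f 0) UNIV" using *(3)[of 0 0] *(2) by (simp add: zero_prod_def)
  have "(pterm c 0 0 has_sum (\<Sum>ij\<in>{(0,0)}. pterm c 0 0 ij)) {(0,0)}"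
    by (rule has_sum_finite) simp
  then have h2: "(pterm c 0 0 has_sum (\<Sum>ij\<in>{(0,0)}. pterm c 0 0 ij)) UNIV"
    by (rule has_sum_cong_neutral[THEN iffD1, rotated -1]) (auto simp: pterm_def power_0_left split: if_splits)
  show "f 0 = c 0 0" using has_sum_unique[OF h1 h2] by (simp add: pterm_def)
qed

lemma analytic2_locally_zero_partials:
  assumes "\<forall>\<^sub>F z in nhds p. f z = 0"
  shows "\<forall>\<^sub>F z in nhds p. pdx f z = 0" "\<forall>\<^sub>F z in nhds p. pdy f z = 0"
proof -
  have "\<forall>\<^sub>F z in nhds p. pdx f z = 0 \<and> pdy f z = 0"
    using eventually_nhds_nhds[OF assms]
  proof eventually_elim
    case (elim z)
    show ?case using diff2_cong(2,3)[OF diff2_const(1) elim] by (simp add: diff2_const)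
  qed
  then show "\<forall>\<^sub>F z in nhds p. pdx f z = 0" "\<forall>\<^sub>F z in nhds p. pdy f z = 0"
    by (auto elim: eventually_mono)
qed

text \<open>Differentiation lowers an index and multiplies the coefficient by a nonzero number,
  until only the value at 0 is left. The induction has to be general in f for this.\<close>

lemma ps_zero_coeffs:
  assumes "ps c f" "\<forall>\<^sub>F z in nhds 0. f z = 0"
  shows "c i j = 0"
  using assms
proof (induction i arbitrary: c f)
  case 0
  then show ?case
  proof (induction j arbitrary: c f)
    case 0
    then show ?case using ps_at_zero[of c f] eventually_nhds_x_imp_x[of "\<lambda>z. f z = 0" 0] by simp
  next
    case (Suc j)
    from Suc.IH[OF ps_pdy[OF Suc.prems(1)] analytic2_locally_zero_partials(2)[OF Suc.prems(2)]]
    show ?case by (simp add: add_nonneg_eq_0_iff flip: of_nat_Suc)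
  qed
next
  case (Suc i)
  from Suc.IH[OF ps_pdx[OF Suc.prems(1)] analytic2_locally_zero_partials(1)[OF Suc.prems(2)]]
  show ?case by (simp flip: of_nat_Suc)
qed

lemma ps_unique:
  assumes "ps c f" "ps d g" "\<forall>\<^sub>F z in nhds 0. f z = g z"
  shows "c = d"
proof -
  have "c i j - d i j = 0" for i j
    by (rule ps_zero_coeffs[OF ps_diff[OF assms(1,2)]]) (use assms(3) in simp)
  then show ?thesis by (simp add: fun_eq_iff)
qed

text \<open>Both sides have the coefficients (i + 1) (j + 1) c (i + 1) (j + 1).\<close>

lemma pdx_pdy_commute:
  assumes "analytic2_at f 0"
  shows "\<forall>\<^sub>F z in nhds 0. pdx (pdy f) z = pdy (pdx f) z"
proof -
  obtain c where "ps c f" using ps_exists[OF assms] by metis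
  from ps_pdx[OF ps_pdy[OF this]] ps_pdy[OF ps_pdx[OF this]] show ?thesis
    by (intro ps_eq) (simp_all add: mult_ac)
qed

text \<open>The derivative in y of a function of x alone is zero, which kills all coefficients with
  positive second index.\<close>

lemma ps_first_kind:
  assumes "analytic1_at f 0"
  obtains c where "ps (\<lambda>i j. if j = 0 then c i else 0) (\<lambda>z. f (fst z))"
proof -
  obtain c where c: "ps c (\<lambda>z. f (fst z))"
    using ps_exists analytic1_imp_analytic2[OF assms, of 0] unfolding zero_prod_def by metis
  have "ps (\<lambda>i j. of_nat (Suc j) * c i (Suc j)) (pdy (\<lambda>z. f (fst z)))" by (rule ps_pdy[OF c])
  moreover have "pdy (\<lambda>z. f (fst z)) = (\<lambda>z. 0)" by (simp add: pdy_def fun_eq_iff)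
  ultimately have "of_nat (Suc j) * c i (Suc j) = 0" for i j
    using ps_zero_coeffs[of "\<lambda>i j. of_nat (Suc j) * c i (Suc j)" "\<lambda>z. 0"] by simp
  then have z: "c i j = 0" if "j \<noteq> 0" for i j
    using that by (cases j) (auto simp flip: of_nat_Suc)
  have "c = (\<lambda>i j. if j = 0 then c i 0 else 0)"
    using z by (simp add: fun_eq_iff)
  then show ?thesis using c that[of "\<lambda>i. c i 0"] by simp
qed

lemma ps_constant_in_y:
  assumes "ps c f" "\<And>i j. j \<noteq> 0 \<Longrightarrow> c i j = 0"
  shows "\<forall>\<^sub>F z in nhds 0. f z = f (fst z, 0)"
proof -
  obtain M R where *: "cbound c M R" "R > 0" "\<And>x y. \<bar>x\<bar> < R \<Longrightarrow> \<bar>y\<bar> < R \<Longrightarrow> (pterm c x y has_sum f (x, y)) UNIV"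
    using psD[OF assms(1)] by metis
  have "f (x, y) = f (fst (x, y), 0)" if "\<bar>x\<bar> < R \<and> \<bar>y\<bar> < R" for x y
  proof (rule has_sum_unique)
    show "(pterm c x y has_sum f (x, y)) UNIV" using *(3) that by simp
    have "pterm c x y ij = pterm c x 0 ij" for ij
      using assms(2) by (cases ij; cases "snd ij = 0") (auto simp: pterm_def)
    then have "pterm c x y = pterm c x 0" by blast
    then show "(pterm c x y has_sum f (fst (x, y), 0)) UNIV" using *(3)[of x 0] that *(2) by simp
  qed
  then show ?thesis unfolding eventually_nhds_zero_iff using *(2) by (intro exI[of _ R] conjI allI impI)
qed

subsection \<open>The analytic inverse function theorem\<close>

definition jac :: "('a::real_normed_field \<times> 'a \<Rightarrow> 'a) \<Rightarrow> ('a \<times> 'a \<Rightarrow> 'a) \<Rightarrow> 'a \<times> 'a \<Rightarrow> 'a" where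
  "jac u v z = pdx u z * pdy v z - pdy u z * pdx v z"

definition lin2 :: "'a::real_normed_field \<Rightarrow> 'a \<Rightarrow> 'a \<Rightarrow> 'a \<Rightarrow> 'a \<times> 'a \<Rightarrow> 'a \<times> 'a" where
  "lin2 a b c d h = (a * fst h + b * snd h, c * fst h + d * snd h)"

lemma bounded_linear_lin2: "bounded_linear (lin2 a b c d)"
  unfolding lin2_def
  by (intro bounded_linear_Pair bounded_linear_add bounded_linear_const_mult bounded_linear_fst bounded_linear_snd)

lemma lin2_adjugate:
  assumes "a * d - b * c \<noteq> 0"
  defines "D \<equiv> a * d - b * c"
  shows "lin2 a b c d (lin2 (d / D) (- b / D) (- c / D) (a / D) h) = h"
    and "lin2 (d / D) (- b / D) (- c / D) (a / D) (lin2 a b c d h) = h"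
proof -
  have D: "D \<noteq> 0" using assms by simp
  have "a * (d * x - b * y) + b * (a * y - c * x) = D * x" for x y
    by (simp add: D_def algebra_simps)
  moreover have "c * (d * x - b * y) + d * (a * y - c * x) = D * y" for x y
    by (simp add: D_def algebra_simps)
  ultimately show "lin2 a b c d (lin2 (d / D) (- b / D) (- c / D) (a / D) h) = h"
    using D by (cases h) (simp add: lin2_def field_simps)
  have "d * (a * x + b * y) - b * (c * x + d * y) = D * x" for x y
    by (simp add: D_def algebra_simps)
  moreover have "a * (c * x + d * y) - c * (a * x + b * y) = D * y" for x y
    by (simp add: D_def algebra_simps)
  ultimately show "lin2 (d / D) (- b / D) (- c / D) (a / D) (lin2 a b c d h) = h"
    using D by (cases h) (simp add: lin2_def field_simps)
qed

lemma inj_lin2_det: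
  assumes "inj (lin2 a b c d)"
  shows "a * d - b * c \<noteq> 0"
proof
  assume D: "a * d - b * c = 0"
  have e: "lin2 a b c d (d, - c) = lin2 a b c d (0, 0)" "lin2 a b c d (- b, a) = lin2 a b c d (0, 0)"
    using D by (simp_all add: lin2_def algebra_simps)
  have "d = 0" "c = 0" "b = 0" "a = 0" using injD[OF assms e(1)] injD[OF assms e(2)] by simp_all
  then have "lin2 a b c d (1, 0) = lin2 a b c d (0, 0)" by (simp add: lin2_def)
  from injD[OF assms this] show False by simp
qed

text \<open>The scalar type is left open because the lemma is applied to u and v and also to their
  complex extensions. The derivative of the inverse is given by the adjugate matrix divided by the
  Jacobian and is therefore linear over the same scalars, which over the complex numbers makes the
  inverse holomorphic.\<close>

lemma inverse_function_2:
  fixes u v :: "'a::{real_normed_field, euclidean_space} \<times> 'a \<Rightarrow> 'a"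
  assumes S: "open S" "p \<in> S" and d: "\<And>q. q \<in> S \<Longrightarrow> diff2 u q" "\<And>q. q \<in> S \<Longrightarrow> diff2 v q"
    and c: "continuous_on S (pdx u)" "continuous_on S (pdy u)" "continuous_on S (pdx v)" "continuous_on S (pdy v)"
    and J: "jac u v p \<noteq> 0"
  obtains U V g where "open U" "U \<subseteq> S" "p \<in> U" "open V" "homeomorphism U V (\<lambda>z. (u z, v z)) g"
    "\<forall>y\<in>V. diff2 (\<lambda>y. fst (g y)) y \<and> diff2 (\<lambda>y. snd (g y)) y"
proof -
  define L where "L = (\<lambda>q. lin2 (pdx u q) (pdy u q) (pdx v q) (pdy v q))"
  define f' where "f' = (\<lambda>q. Blinfun (L q))"
  have f': "blinfun_apply (f' q) = L q" for q
    unfolding f'_def L_def by (rule bounded_linear_Blinfun_apply[OF bounded_linear_lin2])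
  define D where "D = jac u v p"
  define M where "M = lin2 (pdy v p / D) (- pdy u p / D) (- pdx v p / D) (pdx u p / D)"
  define M' where "M' = Blinfun M"
  have M': "blinfun_apply M' = M"
    unfolding M'_def M_def by (rule bounded_linear_Blinfun_apply[OF bounded_linear_lin2])
  have der: "((\<lambda>z. (u z, v z)) has_derivative blinfun_apply (f' q)) (at q)" if "q \<in> S" for q
    using has_derivative_Pair[OF diff2D[OF d(1)[OF that]] diff2D[OF d(2)[OF that]]]
    by (simp add: f' L_def lin2_def[abs_def])
  have cont: "continuous_on S f'"
    by (rule continuous_on_blinfun_componentwise)
       (auto simp: f' L_def lin2_def intro!: continuous_intros c)
  have inv: "M' o\<^sub>L f' p = id_blinfun"
    using lin2_adjugate(2)[of "pdx u p" "pdy v p" "pdy u p" "pdx v p"] J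
    by (intro blinfun_eqI) (simp add: M' f' L_def M_def D_def jac_def)
  show thesis
  proof (rule inverse_function_theorem[OF S(1) der cont S(2) inv])
    fix U V g g'
    assume *: "open U" "U \<subseteq> S" "p \<in> U" "open V" "homeomorphism U V (\<lambda>z. (u z, v z)) g"
      and d': "\<And>y. y \<in> V \<Longrightarrow> (g has_derivative (g' y)) (at y)"
        "\<And>y. y \<in> V \<Longrightarrow> g' y = inv (blinfun_apply (f' (g y)))"
        "\<And>y. y \<in> V \<Longrightarrow> bij (blinfun_apply (f' (g y)))"
  have "diff2 (\<lambda>y. fst (g y)) y \<and> diff2 (\<lambda>y. snd (g y)) y" if y: "y \<in> V" for y
  proof -
    define q where "q = g y"
    define E where "E = pdx u q * pdy v q - pdy u q * pdx v q"
    have E: "E \<noteq> 0"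
      using d'(3)[OF y] inj_lin2_det unfolding E_def f' L_def q_def[symmetric] bij_def by blast
    have "inv (L q) = lin2 (pdy v q / E) (- pdy u q / E) (- pdx v q / E) (pdx u q / E)"
      using lin2_adjugate[of "pdx u q" "pdy v q" "pdy u q" "pdx v q"] E
      unfolding L_def E_def by (intro inv_equality) auto
    then have g: "(g has_derivative lin2 (pdy v q / E) (- pdy u q / E) (- pdx v q / E) (pdx u q / E)) (at y)"
      using d'(1,2)[OF y] by (simp add: f' q_def)
    show ?thesis
      using diff2I(1)[OF has_derivative_fst[OF g, unfolded lin2_def fst_conv]]
        diff2I(1)[OF has_derivative_snd[OF g, unfolded lin2_def snd_conv]] by blast
  qed
  then have "\<forall>y\<in>V. diff2 (\<lambda>y. fst (g y)) y \<and> diff2 (\<lambda>y. snd (g y)) y" by blast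
  then show thesis by (rule that[OF *(1-5)])
  qed
qed

lemma cext_jac: "cext u U S \<Longrightarrow> cext v V S \<Longrightarrow> cext (jac u v) (jac U V) S"
  unfolding jac_def[abs_def] by (intro cext_diff cext_mult cext_pdx cext_pdy)

lemma analytic2_jac: "analytic2_at u p \<Longrightarrow> analytic2_at v p \<Longrightarrow> analytic2_at (jac u v) p"
  unfolding jac_def[abs_def] by (intro analytic2_diff analytic2_mult analytic2_pdx analytic2_pdy)

text \<open>The inverse function theorem is used twice, for (u, v) and for the extension. By
  injectivity of the complex map the two inverses agree at real points, so the complex inverse is
  the extension that proves the real one analytic.\<close>

lemma analytic_inverse_function_2:
  assumes u: "analytic2_at u p" and v: "analytic2_at v p" and J: "jac u v p \<noteq> 0"
  obtains U V g where "open U" "p \<in> U" "open V" "homeomorphism U V (\<lambda>z. (u z, v z)) g"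
    "\<forall>z\<in>U. analytic2_at u z \<and> analytic2_at v z"
    "\<forall>y\<in>V. analytic2_at (\<lambda>y. fst (g y)) y \<and> analytic2_at (\<lambda>y. snd (g y)) y"
proof -
  obtain Fu Fv S where S: "cext u Fu S" "cext v Fv S" "emb p \<in> S" "open S"
    using u v by (rule analytic2_common_ext)
  have contC: "continuous_on S (pdx F)" "continuous_on S (pdy F)" if "cext f F S" for f F
    using that hol2_pdx hol2_pdy hol2_continuous_on cext_hol2 by blast+
  have JC: "jac Fu Fv (emb p) \<noteq> 0" using cextD[OF cext_jac[OF S(1,2)] S(3)] J by simp
  have dC: "diff2 Fu q" "diff2 Fv q" if "q \<in> S" for q
    using that S(1,2)[THEN cext_hol2] by (simp_all add: hol2_def)
  obtain UC VC G where C: "open UC" "UC \<subseteq> S" "emb p \<in> UC" "open VC" "homeomorphism UC VC (\<lambda>z. (Fu z, Fv z)) G"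
    "\<forall>y\<in>VC. diff2 (\<lambda>y. fst (G y)) y \<and> diff2 (\<lambda>y. snd (G y)) y"
    by (rule inverse_function_2[OF S(4,3) dC(1) dC(2) contC[OF S(1)] contC[OF S(2)] JC]; (rule that; assumption)?)
  \<comment> \<open>Confining the real theorem to real points of \<open>UC\<close> keeps
    \<open>emb (g x)\<close> in the set on which G inverts the extension.\<close>
  define SR where "SR = emb -` UC"
  have SR: "open SR" "p \<in> SR" "\<And>z. z \<in> SR \<Longrightarrow> emb z \<in> S"
    using C(1-3) open_emb_vimage unfolding SR_def by auto
  have an: "analytic2_at u z" "analytic2_at v z" if "z \<in> SR" for z
    using SR(3)[OF that] S(1,2) unfolding analytic2_at_iff_cext by blast+
  have contR: "continuous_on SR (pdx f)" "continuous_on SR (pdy f)"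
    if "\<And>z. z \<in> SR \<Longrightarrow> analytic2_at f z" for f
    using analytic2_isCont[OF analytic2_pdx[OF that]] analytic2_isCont[OF analytic2_pdy[OF that]]
    by (blast intro: continuous_at_imp_continuous_on)+
  obtain U V g where R: "open U" "U \<subseteq> SR" "p \<in> U" "open V" "homeomorphism U V (\<lambda>z. (u z, v z)) g"
    "\<forall>y\<in>V. diff2 (\<lambda>y. fst (g y)) y \<and> diff2 (\<lambda>y. snd (g y)) y"
    by (rule inverse_function_2[OF SR(1,2) analytic2_diff2[OF an(1)] analytic2_diff2[OF an(2)]
          contR[OF an(1)] contR[OF an(2)] J]; (rule that; assumption)?)
  have "analytic2_at (\<lambda>y. fst (g y)) y \<and> analytic2_at (\<lambda>y. snd (g y)) y" if y: "y \<in> V" for y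
  proof -
    have G: "G (emb x) = emb (g x)" "emb x \<in> VC" if "x \<in> V" for x
    proof -
      have gx: "g x \<in> U" using R(5) that unfolding homeomorphism_def by blast
      then have gS: "emb (g x) \<in> UC" using R(2) SR_def by auto
      have "(u (g x), v (g x)) = x" using R(5) that unfolding homeomorphism_def by blast
      moreover have "(Fu (emb (g x)), Fv (emb (g x))) = emb (u (g x), v (g x))"
        using cextD[OF S(1), of "g x"] cextD[OF S(2), of "g x"] gS C(2) by (auto simp: emb_def)
      ultimately have e: "(Fu (emb (g x)), Fv (emb (g x))) = emb x" by simp
      show "G (emb x) = emb (g x)" using C(5) gS unfolding homeomorphism_def e[symmetric] by blast
      show "emb x \<in> VC" using C(5) gS unfolding homeomorphism_def e[symmetric] by blast
    qed
    obtain r where r: "r > 0" "cpolydisc (emb y) r \<subseteq> VC" using open_contains_cpolydisc[OF C(4) G(2)[OF y]] by metis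
    obtain r' where r': "r' > 0" "ball y r' \<subseteq> V" using R(4) y open_contains_ball by metis
    \<comment> \<open>All real points of P must lie in V, because \<open>cext\<close> demands
      agreement at each of them. The half of r' passes from the maximum norm to the Euclidean
      one.\<close>
    define P where "P = polydisc (emb y) (min r (r' / 2))"
    have P1: "P \<subseteq> VC"
      using r(2) unfolding P_def polydisc_def cpolydisc_def by (auto simp: subset_iff)
    have P2: "x \<in> V" if "emb x \<in> P" for x
    proof -
      have "\<bar>fst x - fst y\<bar> < r' / 2" "\<bar>snd x - snd y\<bar> < r' / 2"
        using that unfolding P_def polydisc_def emb_def
        by (auto simp: dist_norm abs_minus_commute simp flip: of_real_diff)
      moreover have "dist x y \<le> \<bar>fst x - fst y\<bar> + \<bar>snd x - snd y\<bar>"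
        unfolding dist_prod_def dist_real_def by (simp add: sqrt_sum_squares_le_sum_abs)
      ultimately have "dist y x < r'" by (simp add: dist_commute)
      then show ?thesis using r'(2) by (metis mem_ball subsetD)
    qed
    have Py: "emb y \<in> P" unfolding P_def using r r' by (intro centre_in_polydisc) auto
    have "open P" by (simp add: P_def open_polydisc)
    have h: "hol2 (\<lambda>y. fst (G y)) P" "hol2 (\<lambda>y. snd (G y)) P"
      using C(6) P1 \<open>open P\<close> unfolding hol2_def by blast+
    have "fst (G (emb x)) = of_real (fst (g x))" "snd (G (emb x)) = of_real (snd (g x))" if "emb x \<in> P" for x
      using G(1)[OF P2[OF that]] by (simp_all add: emb_def)
    then have "cext (\<lambda>y. fst (g y)) (\<lambda>y. fst (G y)) P" "cext (\<lambda>y. snd (g y)) (\<lambda>y. snd (G y)) P"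
      using h unfolding cext_def by blast+
    then show ?thesis using Py unfolding analytic2_at_iff_cext by blast
  qed
  then show ?thesis using that[OF R(1,3,4,5)] an R(2) by blast
qed

text \<open>The two-variable theorem for the map (t, s) to (k t, s), restricted to the line s =
  0.\<close>

lemma analytic1_inverse_function:
  assumes k: "analytic1_at k 0" "k 0 = 0" "deriv k 0 \<noteq> 0"
  obtains m where "analytic1_at m 0" "m 0 = 0" "deriv m 0 \<noteq> 0"
    "\<forall>\<^sub>F t in nhds 0. m (k t) = t" "\<forall>\<^sub>F t in nhds 0. k (m t) = t"
proof -
  define u where "u = (\<lambda>z::real \<times> real. k (fst z))"
  have pd: "pdx u (t, s) = deriv k t" "pdy u (t, s) = 0" for t s by (simp_all add: u_def pdx_def pdy_def)
  have u: "analytic2_at u (0, 0)" unfolding u_def by (rule analytic1_imp_analytic2[OF k(1)])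
  have J: "jac u snd (0, 0) \<noteq> 0" by (simp add: jac_def pd diff2_snd k)
  obtain U V g where *: "open U" "(0, 0) \<in> U" "open V" "homeomorphism U V (\<lambda>z. (u z, snd z)) g"
    "\<forall>z\<in>U. analytic2_at u z \<and> analytic2_at snd z"
    "\<forall>y\<in>V. analytic2_at (\<lambda>y. fst (g y)) y \<and> analytic2_at (\<lambda>y. snd (g y)) y"
    by (rule analytic_inverse_function_2[OF u analytic2_snd J]; (rule that; assumption)?)
  have u0: "u (0, 0) = 0" by (simp add: u_def k)
  have gf: "g (u z, snd z) = z" "(u z, snd z) \<in> V" if "z \<in> U" for z
    using *(4) that unfolding homeomorphism_def by blast+
  have fg: "(u (g y), snd (g y)) = y" "g y \<in> U" if "y \<in> V" for y
    using *(4) that unfolding homeomorphism_def by blast+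
  have V0: "(0, 0) \<in> V" using gf(2)[OF *(2)] u0 by simp
  define m where "m = (\<lambda>t. fst (g (t, 0)))"
  have m: "analytic1_at m 0" unfolding m_def by (rule analytic1_slice) (use *(6) V0 in blast)
  have m0: "m 0 = 0" using gf(1)[OF *(2)] u0 by (simp add: m_def)
  have sl: "\<forall>\<^sub>F t in nhds 0. (t, 0) \<in> S" if "open S" "(0, 0) \<in> S" for S :: "(real \<times> real) set"
  proof -
    have "open ((\<lambda>t. (t, 0)) -` S)" using that by (intro open_vimage continuous_intros)
    from eventually_nhds_in_open[OF this, of 0] show ?thesis using that by simp
  qed
  have mk: "\<forall>\<^sub>F t in nhds 0. m (k t) = t"
    using sl[OF *(1,2)] by eventually_elim (use gf(1) in \<open>force simp: m_def u_def\<close>)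
  have km: "\<forall>\<^sub>F t in nhds 0. k (m t) = t"
    using sl[OF *(3) V0]
  proof eventually_elim
    case (elim t)
    show ?case using fg(1)[OF elim] by (simp add: m_def u_def)
  qed
  have "((\<lambda>t. k (m t)) has_field_derivative deriv k 0 * deriv m 0) (at 0)"
    by (rule DERIV_chain2) (use analytic1_deriv(1)[OF m] analytic1_deriv(1)[OF k(1)] m0 in simp_all)
  moreover have "((\<lambda>t. k (m t)) has_field_derivative 1) (at 0)"
  proof -
    have e: "\<forall>\<^sub>F t in nhds 0. t = k (m t)" using km by eventually_elim simp
    show ?thesis using DERIV_cong_ev[OF refl e refl, of 1] DERIV_ident by blast
  qed
  ultimately have "deriv m 0 \<noteq> 0" using DERIV_unique by fastforce
  then show ?thesis using that m m0 mk km by blast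
qed

subsection \<open>The Brieskorn lattice of the cusp\<close>

lemma cusp_eq: "cusp z = snd z ^ 3 - fst z ^ 2"
  by (simp add: cusp_def case_prod_unfold)

text \<open>The coefficient of dH \<and> df with respect to dx \<and> dy, where dH = - 2 x dx + 3
  y^2 dy; this is the bracket of H with f.\<close>

definition hbr :: "(real \<times> real \<Rightarrow> real) \<Rightarrow> real \<times> real \<Rightarrow> real" where
  "hbr f z = - 2 * fst z * pdy f z - 3 * snd z ^ 2 * pdx f z"

lemma cusp_diff2: "diff2 cusp p" "pdx cusp p = - 2 * fst p" "pdy cusp p = 3 * snd p ^ 2"
proof -
  have "(cusp has_derivative (\<lambda>h. (- 2 * fst p) * fst h + (3 * snd p ^ 2) * snd h)) (at p)"
    unfolding cusp_eq[abs_def] by (auto intro!: derivative_eq_intros simp: algebra_simps)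
  from diff2I[OF this] show "diff2 cusp p" "pdx cusp p = - 2 * fst p" "pdy cusp p = 3 * snd p ^ 2" by auto
qed

lemma analytic2_cusp: "analytic2_at cusp p"
  unfolding cusp_eq[abs_def] by (intro analytic2_diff analytic2_power analytic2_fst analytic2_snd)

lemma hbr_eq_jac: "hbr f z = jac cusp f z"
  by (simp add: hbr_def jac_def cusp_diff2)

lemma hbr_add: "diff2 f p \<Longrightarrow> diff2 g p \<Longrightarrow> hbr (\<lambda>z. f z + g z) p = hbr f p + hbr g p"
  by (simp add: hbr_def diff2_add algebra_simps)

lemma hbr_diff: "diff2 f p \<Longrightarrow> diff2 g p \<Longrightarrow> hbr (\<lambda>z. f z - g z) p = hbr f p - hbr g p"
  by (simp add: hbr_def diff2_diff algebra_simps)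

lemma hbr_mult: "diff2 f p \<Longrightarrow> diff2 g p \<Longrightarrow> hbr (\<lambda>z. f z * g z) p = hbr f p * g p + f p * hbr g p"
  by (simp add: hbr_def diff2_mult algebra_simps)

lemma hbr_cmult: "diff2 f p \<Longrightarrow> hbr (\<lambda>z. c * f z) p = c * hbr f p"
  by (simp add: hbr_def diff2_cmult algebra_simps)

lemma hbr_const: "hbr (\<lambda>z. c) p = 0"
  by (simp add: hbr_def diff2_const)

lemma hbr_fst: "hbr fst p = - 3 * snd p ^ 2"
  by (simp add: hbr_def diff2_fst)

lemma hbr_snd: "hbr snd p = - 2 * fst p"
  by (simp add: hbr_def diff2_snd)

text \<open>H has bracket zero with itself, so only the derivative in y contributes, with the factor
  {H, y} = - 2 x.\<close>

lemma hbr_comp_cusp_snd: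
  assumes "diff2 F (cusp p, snd p)"
  shows "hbr (\<lambda>z. F (cusp z, snd z)) p = - 2 * fst p * pdy F (cusp p, snd p)"
  using diff2_comp2[OF assms cusp_diff2(1) diff2_snd(1)]
  by (simp add: hbr_def cusp_diff2 diff2_snd algebra_simps)

lemma hbr_comp_cusp:
  assumes "(h has_field_derivative d) (at (cusp p))"
  shows "diff2 (\<lambda>z. h (cusp z)) p" "hbr (\<lambda>z. h (cusp z)) p = 0"
  using diff2_comp1[OF assms cusp_diff2(1)] by (simp_all add: hbr_def cusp_diff2)

lemma hbr_cong:
  assumes "diff2 f p" "\<forall>\<^sub>F q in nhds p. g q = f q"
  shows "hbr g p = hbr f p"
  using diff2_cong[OF assms] by (simp add: hbr_def)

lemma analytic2_hbr: "analytic2_at f p \<Longrightarrow> analytic2_at (hbr f) p"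
  unfolding hbr_def[abs_def]
  by (intro analytic2_diff analytic2_mult analytic2_const analytic2_power analytic2_fst analytic2_snd
      analytic2_pdx analytic2_pdy)

lemma eventually_cusp_snd:
  assumes "\<forall>\<^sub>F z in nhds (0 :: real \<times> real). P z"
  shows "\<forall>\<^sub>F z in nhds 0. P (cusp z, snd z)"
proof -
  have "isCont (\<lambda>z. (cusp z, snd z)) 0"
    by (intro continuous_intros analytic2_isCont analytic2_cusp)
  then have "filterlim (\<lambda>z. (cusp z, snd z)) (nhds (cusp 0, snd (0 :: real \<times> real))) (nhds 0)"
    using tendsto_at_iff_tendsto_nhds[of "\<lambda>z. (cusp z, snd z)" "0 :: real \<times> real"]
    by (simp only: isCont_def)
  then have "filterlim (\<lambda>z. (cusp z, snd z)) (nhds (0 :: real \<times> real)) (nhds 0)"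
    by (simp add: cusp_eq zero_prod_def)
  then show ?thesis using assms by (rule eventually_compose_filterlim[rotated])
qed

lemma eventually_cusp:
  assumes "\<forall>\<^sub>F t in nhds (0 :: real). P t"
  shows "\<forall>\<^sub>F z in nhds 0. P (cusp z)"
proof -
  have "filterlim cusp (nhds (cusp 0)) (nhds 0)"
    using analytic2_isCont[OF analytic2_cusp, of 0] by (simp only: isCont_def tendsto_at_iff_tendsto_nhds)
  then have "filterlim cusp (nhds 0) (nhds 0)" by (simp add: cusp_eq)
  then show ?thesis using assms by (rule eventually_compose_filterlim[rotated])
qed

text \<open>The coefficients are sorted by the parity of the exponent of x.\<close>

lemma analytic2_even_odd:
  assumes "analytic2_at a 0"
  obtains b c where "analytic2_at b 0" "analytic2_at c 0"
    "\<forall>\<^sub>F z in nhds 0. a z = b (fst z ^ 2, snd z) + fst z * c (fst z ^ 2, snd z)"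
proof -
  obtain \<alpha> where "ps \<alpha> a" using ps_exists[OF assms] by metis
  then obtain M R where R: "cbound \<alpha> M R" "R > 0"
    "\<And>x y. \<bar>x\<bar> < R \<Longrightarrow> \<bar>y\<bar> < R \<Longrightarrow> (pterm \<alpha> x y has_sum a (x, y)) UNIV"
    using psD by metis
  have M: "M \<ge> 0" by (rule cbound_nonneg[OF R(1)])
  \<comment> \<open>As x^2 becomes a variable of its own, its radius must be at most R^2, while that
    of y stays at most R.\<close>
  define \<rho> where "\<rho> = min R (R ^ 2)"
  have \<rho>: "\<rho> > 0" "\<rho> \<le> R" "\<rho> \<le> R ^ 2" using R(2) by (auto simp: \<rho>_def)
  have pw: "\<rho> ^ (i + j) \<le> R ^ (2 * i + j)" for i j
  proof -
    have "\<rho> ^ (i + j) \<le> (R ^ 2) ^ i * R ^ j"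
      unfolding power_add using \<rho> by (intro mult_mono power_mono) auto
    then show ?thesis by (simp add: power_mult power_add)
  qed
  define \<beta> where "\<beta> = (\<lambda>i j. \<alpha> (2 * i) j)"
  define \<gamma> where "\<gamma> = (\<lambda>i j. \<alpha> (2 * i + 1) j)"
  have "norm (\<beta> i j) \<le> M / \<rho> ^ (i + j)" for i j
  proof -
    have "norm (\<alpha> (2 * i) j) \<le> M / R ^ (2 * i + j)" using R(1) unfolding cbound_def by blast
    also have "\<dots> \<le> M / \<rho> ^ (i + j)" using pw M \<rho> R by (intro divide_left_mono) auto
    finally show ?thesis by (simp add: \<beta>_def)
  qed
  then have \<beta>: "cbound \<beta> M \<rho>" using \<rho>(1) unfolding cbound_def by blast
  have "norm (\<gamma> i j) \<le> M / R / \<rho> ^ (i + j)" for i j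
  proof -
    have "norm (\<alpha> (2 * i + 1) j) \<le> M / R ^ (2 * i + 1 + j)" using R(1) unfolding cbound_def by blast
    also have "\<dots> = M / R / R ^ (2 * i + j)" by simp
    also have "\<dots> \<le> M / R / \<rho> ^ (i + j)" using pw M \<rho> R by (intro divide_left_mono) auto
    finally show ?thesis by (simp add: \<gamma>_def)
  qed
  then have \<gamma>: "cbound \<gamma> (M / R) \<rho>" using \<rho>(1) unfolding cbound_def by blast
  define b where "b = (\<lambda>z. psum \<beta> (fst z) (snd z))"
  define c where "c = (\<lambda>z. psum \<gamma> (fst z) (snd z))"
  have "ps \<beta> b" "ps \<gamma> c" using \<beta> \<gamma> unfolding ps_def b_def c_def by auto
  then have "analytic2_at b 0" "analytic2_at c 0" by (auto intro: ps_analytic2)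
  moreover have "a (x, y) = b (x ^ 2, y) + x * c (x ^ 2, y)" if xy: "\<bar>x\<bar> < min \<rho> 1" "\<bar>y\<bar> < min \<rho> 1" for x y
  proof -
    have "\<bar>x\<bar> * \<bar>x\<bar> \<le> \<bar>x\<bar> * 1" using xy by (intro mult_left_mono) auto
    then have x2: "\<bar>x ^ 2\<bar> < \<rho>" using xy by (simp add: power2_eq_square abs_mult)
    define g where "g = pterm \<alpha> x y"
    define he ho where "he = (\<lambda>(i::nat, j::nat). (2 * i, j))" and "ho = (\<lambda>(i::nat, j::nat). (2 * i + 1, j))"
    have inj: "inj he" "inj ho" by (auto simp: he_def ho_def inj_on_def)
    have disj: "range he \<inter> range ho = {}" by (auto simp: he_def ho_def) presburger
    have un: "range he \<union> range ho = UNIV"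
    proof -
      have "(i, j) \<in> range he \<union> range ho" for i j
      proof (cases "even i")
        case True
        then obtain k where "i = 2 * k" by (elim evenE)
        then have "(i, j) = he (k, j)" by (simp add: he_def)
        then show ?thesis by blast
      next
        case False
        then obtain k where "i = 2 * k + 1" by (elim oddE)
        then have "(i, j) = ho (k, j)" by (simp add: ho_def)
        then show ?thesis by blast
      qed
      then show ?thesis by auto
    qed
    have "((g \<circ> he) has_sum b (x ^ 2, y)) UNIV"
      using pterm_has_sum[OF \<beta>, of "x ^ 2" y] x2 xy
      by (simp add: g_def he_def b_def pterm_def o_def case_prod_unfold \<beta>_def power_mult)
    then have e: "(g has_sum b (x ^ 2, y)) (range he)" by (subst has_sum_reindex[OF inj(1)])
    have gho: "g \<circ> ho = (\<lambda>ij. x * pterm \<gamma> (x ^ 2) y ij)"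
      by (simp add: g_def ho_def pterm_def o_def case_prod_unfold \<gamma>_def power_mult fun_eq_iff)
    have "((g \<circ> ho) has_sum x * c (x ^ 2, y)) UNIV"
      unfolding gho c_def fst_conv snd_conv
      using x2 xy by (intro has_sum_cmult_right pterm_has_sum[OF \<gamma>]) auto
    then have o: "(g has_sum x * c (x ^ 2, y)) (range ho)" by (subst has_sum_reindex[OF inj(2)])
    have "(g has_sum (b (x ^ 2, y) + x * c (x ^ 2, y))) UNIV"
      using has_sum_Un_disjoint[OF e o disj] by (simp add: un)
    moreover have "(g has_sum a (x, y)) UNIV" unfolding g_def using R(3) xy \<rho> by simp
    ultimately show ?thesis using has_sum_unique by metis
  qed
  then have "\<forall>\<^sub>F z in nhds 0. a z = b (fst z ^ 2, snd z) + fst z * c (fst z ^ 2, snd z)"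
    unfolding eventually_nhds_zero_iff using \<rho>(1) by (intro exI[of _ "min \<rho> 1"]) simp
  ultimately show ?thesis by (rule that)
qed

text \<open>Division with remainder by H: as x^2 = y^3 - H, the even and the odd part in x are
  functions of (H, y). The germs are thus free over the germs in (H, y) with basis 1, x.\<close>

lemma cusp_division:
  assumes "analytic2_at a 0"
  obtains B C where "analytic2_at B 0" "analytic2_at C 0"
    "\<forall>\<^sub>F z in nhds 0. a z = B (cusp z, snd z) + fst z * C (cusp z, snd z)"
proof -
  obtain b c where bc: "analytic2_at b 0" "analytic2_at c 0"
    "\<forall>\<^sub>F z in nhds 0. a z = b (fst z ^ 2, snd z) + fst z * c (fst z ^ 2, snd z)"
    by (rule analytic2_even_odd[OF assms])
  define S where "S = (\<lambda>(f :: real \<times> real \<Rightarrow> real) z. f (snd z ^ 3 - fst z, snd z))"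
  have S: "analytic2_at (S f) 0" if "analytic2_at f 0" for f
    unfolding S_def using that
    by (intro analytic2_compose analytic2_diff analytic2_power analytic2_fst analytic2_snd) (simp add: zero_prod_def)
  have "S f (cusp z, snd z) = f (fst z ^ 2, snd z)" for f z
    by (simp add: S_def cusp_eq)
  then show ?thesis using that[OF S[OF bc(1)] S[OF bc(2)]] bc(3) by simp
qed

lemma antiderivative_y:
  assumes "analytic2_at C 0"
  obtains P where "analytic2_at P 0" "\<forall>\<^sub>F z in nhds 0. pdy P z = C z"
proof -
  obtain c where c: "ps c C" using ps_exists[OF assms] by metis
  then obtain M R where R: "cbound c M R" "R > 0" using psD by metis
  define d where "d = (\<lambda>i j. if j = 0 then 0 else c i (j - 1) / of_nat j)"
  have "norm (d i j) \<le> M * R / R ^ (i + j)" for i j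
  proof (cases j)
    case (Suc k)
    have "norm (d i j) \<le> norm (c i k)"
      using Suc by (simp add: d_def divide_le_eq mult_le_cancel_left1)
    also have "\<dots> \<le> M / R ^ (i + k)" using R(1) unfolding cbound_def by blast
    finally show ?thesis using Suc R(2) by simp
  qed (use R cbound_nonneg[OF R(1)] in \<open>simp add: d_def\<close>)
  then have "cbound d (M * R) R" using R(2) unfolding cbound_def by blast
  then have P: "ps d (\<lambda>z. psum d (fst z) (snd z))" unfolding ps_def by auto
  have "(\<lambda>i j. of_nat (Suc j) * d i (Suc j)) = c" by (simp add: d_def fun_eq_iff)
  then have "ps c (pdy (\<lambda>z. psum d (fst z) (snd z)))" using ps_pdy[OF P] by simp
  from ps_eq[OF this c] ps_analytic2[OF P] show ?thesis by (rule that[rotated])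
qed

text \<open>
  In the coordinates \<open>(H, y)\<close>, this is the bracket of \<open>H\<close> with \<open>x \<xi>(H, y)\<close>.
\<close>

definition cusp_ode :: "(real \<times> real \<Rightarrow> real) \<Rightarrow> real \<times> real \<Rightarrow> real" where
  "cusp_ode \<xi> z = 2 * (fst z - snd z ^ 3) * pdy \<xi> z - 3 * snd z ^ 2 * \<xi> z"

text \<open>The factor 2 m - 1 collects 2 (m - 2) from y^3 times the derivative and 3 from the term
  with y^2.\<close>

lemma ps_cusp_ode:
  assumes "ps x \<xi>"
  shows "ps (\<lambda>p m. (if p = 0 then 0 else 2 * real (Suc m) * x (p - 1) (Suc m))
      - (if m < 2 then 0 else (2 * real m - 1) * x p (m - 2))) (cusp_ode \<xi>)"
proof -
  note y = ps_pdy[OF assms]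
  have f: "cusp_ode \<xi> = (\<lambda>z. (2 * (fst z * pdy \<xi> z) - 2 * (snd z * (snd z * (snd z * pdy \<xi> z)))) - 3 * (snd z * (snd z * \<xi> z)))"
    by (simp add: cusp_ode_def fun_eq_iff power2_eq_square power3_eq_cube algebra_simps)
  have "ps (\<lambda>p m. 2 * (if p = 0 then 0 else real (Suc m) * x (p - 1) (Suc m))
     - 2 * (if m = 0 then 0 else if m - 1 = 0 then 0 else if m - 1 - 1 = 0 then 0 else real (Suc (m - 1 - 1 - 1)) * x p (Suc (m - 1 - 1 - 1)))
     - 3 * (if m = 0 then 0 else if m - 1 = 0 then 0 else x p (m - 1 - 1))) (cusp_ode \<xi>)"
    unfolding f by (intro ps_diff ps_cmult ps_mulx ps_muly y assms)
  moreover have "2 * (if p = 0 then 0 else real (Suc m) * x (p - 1) (Suc m))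
     - 2 * (if m = 0 then 0 else if m - 1 = 0 then 0 else if m - 1 - 1 = 0 then 0 else real (Suc (m - 1 - 1 - 1)) * x p (Suc (m - 1 - 1 - 1)))
     - 3 * (if m = 0 then 0 else if m - 1 = 0 then 0 else x p (m - 1 - 1)) =
     (if p = 0 then 0 else 2 * real (Suc m) * x (p - 1) (Suc m))
      - (if m < 2 then 0 else (2 * real m - 1) * x p (m - 2))" for p m
  proof -
    consider "m = 0" | "m = 1" | "m = 2" | k where "m = Suc (Suc (Suc k))"
      by (metis One_nat_def Suc_1 not0_implies_Suc)
    then show ?thesis by cases (simp_all add: algebra_simps)
  qed
  ultimately show ?thesis by simp
qed

text \<open>
  Comparing the coefficients of \<open>H\<^sup>p y\<^sup>m\<close> for \<open>m \<ge> 2\<close> in \<open>cusp_ode \<xi> = b\<close> determines \<open>\<xi>\<close>. The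
  coefficients with \<open>m < 2\<close> are the obstruction, whence the terms \<open>f0 + f1 y\<close>.
\<close>

primrec ode_coeffs :: "(nat \<Rightarrow> nat \<Rightarrow> real) \<Rightarrow> nat \<Rightarrow> nat \<Rightarrow> real" where
  "ode_coeffs b 0 n = - b 0 (n + 2) / (2 * real n + 3)"
| "ode_coeffs b (Suc p) n = (2 * (real n + 3) * ode_coeffs b p (n + 3) - b (Suc p) (n + 2)) / (2 * real n + 3)"

text \<open>Each step of the recursion raises p by one and looks three places further in n, so a
  radius R in y allows a radius of order R^3 in H. The divisor 4 and the factor 2 in the constant
  make each of the two summands at most half of the bound.\<close>

lemma ode_coeffs_cbound:
  assumes "cbound b M R" "R \<le> 1"
  shows "cbound (ode_coeffs b) (2 * M / R ^ 2) (R ^ 3 / 4)"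
proof -
  define K where "K = 2 * M / R ^ 2"
  define s where "s = R ^ 3 / 4"
  have R: "R > 0" and b: "\<bar>b i j\<bar> \<le> M / R ^ (i + j)" for i j using assms(1) by (auto simp: cbound_def)
  have M: "M \<ge> 0" by (rule cbound_nonneg[OF assms(1)])
  have R3: "R ^ 3 \<le> R ^ 1" using R assms(2) by (intro power_decreasing) auto
  have s: "s > 0" "s \<le> R" using R R3 by (auto simp: s_def)
  have K: "K \<ge> 0" using M by (simp add: K_def)
  \<comment> \<open>The induction keeps the radius s in H apart from R in y. The common radius s is
    substituted only afterwards, where s \<le> R relies on R \<le> 1.\<close>
  have main: "\<bar>ode_coeffs b p n\<bar> \<le> K / (s ^ p * R ^ n)" for p n
  proof (induction p arbitrary: n)
    case 0
    have "\<bar>ode_coeffs b 0 n\<bar> = \<bar>b 0 (n + 2)\<bar> / (2 * real n + 3)"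
      by (simp add: abs_divide)
    also have "\<dots> \<le> \<bar>b 0 (n + 2)\<bar> / 1" by (intro divide_left_mono) auto
    also have "\<dots> \<le> M / R ^ (0 + (n + 2))" using b[of 0 "n + 2"] by simp
    also have "\<dots> = (K / 2) / R ^ n" using R by (simp add: K_def power_add power2_eq_square)
    also have "\<dots> \<le> K / R ^ n" using K R by (intro divide_right_mono) auto
    finally show ?case by simp
  next
    case (Suc p)
    have "\<bar>ode_coeffs b (Suc p) n\<bar> = \<bar>2 * (real n + 3) * ode_coeffs b p (n + 3) - b (Suc p) (n + 2)\<bar> / (2 * real n + 3)"
      by (simp add: abs_divide)
    also have "\<dots> \<le> (2 * (real n + 3) * \<bar>ode_coeffs b p (n + 3)\<bar> + \<bar>b (Suc p) (n + 2)\<bar>) / (2 * real n + 3)"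
      by (intro divide_right_mono order_trans[OF abs_triangle_ineq4]) (auto simp: abs_mult)
    also have "\<dots> \<le> 2 * \<bar>ode_coeffs b p (n + 3)\<bar> + \<bar>b (Suc p) (n + 2)\<bar>"
    proof -
      have "2 * (real n + 3) * \<bar>ode_coeffs b p (n + 3)\<bar> \<le> (2 * \<bar>ode_coeffs b p (n + 3)\<bar>) * (2 * real n + 3)"
        using mult_nonneg_nonneg[of "real n" "\<bar>ode_coeffs b p (n + 3)\<bar>"] by (simp add: algebra_simps)
      moreover have "\<bar>b (Suc p) (n + 2)\<bar> * 1 \<le> \<bar>b (Suc p) (n + 2)\<bar> * (2 * real n + 3)"
        by (intro mult_left_mono) auto
      ultimately show ?thesis by (simp add: divide_le_eq distrib_right)
    qed
    also have "\<dots> \<le> K / (s ^ Suc p * R ^ n) / 2 + K / (s ^ Suc p * R ^ n) / 2"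
    proof (rule add_mono)
      have "2 * \<bar>ode_coeffs b p (n + 3)\<bar> \<le> 2 * (K / (s ^ p * R ^ (n + 3)))" using Suc[of "n + 3"] by simp
      also have "\<dots> = K / (s ^ Suc p * R ^ n) / 2"
        using R s by (simp add: s_def power_add field_simps)
      finally show "2 * \<bar>ode_coeffs b p (n + 3)\<bar> \<le> K / (s ^ Suc p * R ^ n) / 2" .
      have "\<bar>b (Suc p) (n + 2)\<bar> \<le> M / R ^ (Suc p + (n + 2))" by (rule b)
      also have "\<dots> = K / 2 / (R ^ Suc p * R ^ n)" using R by (simp add: K_def power_add power2_eq_square)
      also have "\<dots> \<le> K / 2 / (s ^ Suc p * R ^ n)"
        using R s K by (intro divide_left_mono mult_right_mono power_mono) auto
      finally show "\<bar>b (Suc p) (n + 2)\<bar> \<le> K / (s ^ Suc p * R ^ n) / 2" by simp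
    qed
    finally show ?case by (simp only: field_sum_of_halves)
  qed
  have "\<bar>ode_coeffs b p n\<bar> \<le> K / s ^ (p + n)" for p n
  proof -
    have "K / (s ^ p * R ^ n) \<le> K / (s ^ p * s ^ n)"
      using R s K by (intro divide_left_mono mult_left_mono power_mono) auto
    then show ?thesis using main[of p n] by (simp add: power_add)
  qed
  then show ?thesis using s unfolding cbound_def K_def s_def by simp
qed

lemma cusp_ode_solvable:
  assumes "analytic2_at B 0"
  obtains \<xi> f0 f1 where "analytic2_at \<xi> 0" "analytic1_at f0 0" "analytic1_at f1 0"
    "\<forall>\<^sub>F z in nhds 0. B z = f0 (fst z) + f1 (fst z) * snd z + cusp_ode \<xi> z"
proof -
  obtain b where b: "ps b B" using ps_exists[OF assms] by metis
  then obtain M R0 where R0: "cbound b M R0" "R0 > 0" using psD by metis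
  define R where "R = min R0 1"
  have R: "cbound b M R" "R \<le> 1" using cbound_shrink[OF R0(1), of R] R0 by (auto simp: R_def)
  define x where "x = ode_coeffs b"
  define \<xi> where "\<xi> = (\<lambda>z. psum x (fst z) (snd z))"
  have \<xi>: "ps x \<xi>" unfolding ps_def \<xi>_def x_def using ode_coeffs_cbound[OF R] by auto
  define c where "c = (\<lambda>p m. b p m - ((if p = 0 then 0 else 2 * real (Suc m) * x (p - 1) (Suc m))
      - (if m < 2 then 0 else (2 * real m - 1) * x p (m - 2))))"
  define g where "g = (\<lambda>z. B z - cusp_ode \<xi> z)"
  have g: "ps c g" unfolding c_def g_def by (intro ps_diff b ps_cusp_ode \<xi>)
  \<comment> \<open>So the remainder g has degree at most one in y: \<open>pdy g\<close> and g - y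
    \<open>pdy g\<close> are free of y, and their values at y = 0 become f1 and f0.\<close>
  have c0: "c p (Suc (Suc n)) = 0" for p n
  proof (cases p)
    case 0
    have "2 * real n + 3 > 0" by simp
    then show ?thesis using 0 by (simp add: c_def x_def field_simps)
  next
    case (Suc q)
    have "2 * real n + 3 > 0" by simp
    then have "(2 * real n + 3) * x (Suc q) n = 2 * (real n + 3) * x q (n + 3) - b (Suc q) (n + 2)"
      by (simp add: x_def)
    then show ?thesis using Suc by (simp add: c_def algebra_simps numeral_3_eq_3)
  qed
  have gan: "analytic2_at g 0" by (rule ps_analytic2[OF g])
  have "\<forall>\<^sub>F z in nhds 0. pdy g z = pdy g (fst z, 0)"
  proof (rule ps_constant_in_y[OF ps_pdy[OF g]])
    fix i j :: nat assume "j \<noteq> 0"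
    then show "real (Suc j) * c i (Suc j) = 0" using c0 by (cases j) simp_all
  qed
  moreover have "\<forall>\<^sub>F z in nhds 0. g z - snd z * pdy g z = g (fst z, 0) - snd (fst z, 0::real) * pdy g (fst z, 0)"
  proof -
    have "\<forall>\<^sub>F z in nhds 0. (\<lambda>z. g z - snd z * pdy g z) z = (\<lambda>z. g z - snd z * pdy g z) (fst z, 0)"
    proof (rule ps_constant_in_y[OF ps_diff[OF g ps_muly[OF ps_pdy[OF g]]]])
      fix i j :: nat assume "j \<noteq> 0"
      then consider "j = 1" | k where "j = Suc (Suc k)" by (metis One_nat_def not0_implies_Suc)
      then show "c i j - (if j = 0 then 0 else real (Suc (j - 1)) * c i (Suc (j - 1))) = 0"
        using c0 by cases simp_all
    qed
    then show ?thesis by simp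
  qed
  ultimately have "\<forall>\<^sub>F z in nhds 0. B z = g (fst z, 0) + pdy g (fst z, 0) * snd z + cusp_ode \<xi> z"
    by eventually_elim (simp add: g_def algebra_simps)
  moreover have "analytic1_at (\<lambda>t. g (t, 0)) 0" "analytic1_at (\<lambda>t. pdy g (t, 0)) 0"
    using analytic1_slice[of _ 0 0] gan analytic2_pdy[OF gan] by (auto simp: zero_prod_def)
  ultimately show ?thesis using that[OF ps_analytic2[OF \<xi>], of "\<lambda>t. g (t, 0)" "\<lambda>t. pdy g (t, 0)"] by simp
qed

text \<open>Differentiating \<xi> produces a factor x^2, which equals y^3 - H and so leaves an
  expression in (H, y).\<close>

lemma hbr_fst_times:
  assumes "diff2 \<xi> (cusp p, snd p)"
  shows "hbr (\<lambda>z. fst z * \<xi> (cusp z, snd z)) p = cusp_ode \<xi> (cusp p, snd p)"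
proof -
  have "diff2 (\<lambda>z. \<xi> (cusp z, snd z)) p" using diff2_comp2(1)[OF assms cusp_diff2(1) diff2_snd(1)] .
  then have "hbr (\<lambda>z. fst z * \<xi> (cusp z, snd z)) p =
      - 3 * snd p ^ 2 * \<xi> (cusp p, snd p) + fst p * (- 2 * fst p * pdy \<xi> (cusp p, snd p))"
    by (simp add: hbr_mult diff2_fst hbr_fst hbr_comp_cusp_snd[OF assms])
  then show ?thesis by (simp add: cusp_ode_def cusp_eq algebra_simps power2_eq_square)
qed

text \<open>In a = B(H, y) + x C(H, y) the second summand is the bracket of H with - P(H, y) / 2,
  where P is an antiderivative of C in y. The first one is treated by
  \<open>cusp_ode_solvable\<close>, whose \<xi> contributes the bracket with x \<xi>(H, y).\<close>

lemma brieskorn_decomposition: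
  assumes "analytic2_at a 0"
  obtains f0 f1 \<eta> where "analytic1_at f0 0" "analytic1_at f1 0" "analytic2_at \<eta> 0" "\<eta> 0 = 0"
    "\<forall>\<^sub>F z in nhds 0. a z = f0 (cusp z) + f1 (cusp z) * snd z + hbr \<eta> z"
proof -
  obtain B C where BC: "analytic2_at B 0" "analytic2_at C 0"
    "\<forall>\<^sub>F z in nhds 0. a z = B (cusp z, snd z) + fst z * C (cusp z, snd z)"
    by (rule cusp_division[OF assms])
  obtain P where P: "analytic2_at P 0" "\<forall>\<^sub>F z in nhds 0. pdy P z = C z"
    by (rule antiderivative_y[OF BC(2)])
  obtain \<xi> f0 f1 where f: "analytic2_at \<xi> 0" "analytic1_at f0 0" "analytic1_at f1 0"
    "\<forall>\<^sub>F z in nhds 0. B z = f0 (fst z) + f1 (fst z) * snd z + cusp_ode \<xi> z"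
    by (rule cusp_ode_solvable[OF BC(1)])
  define \<eta>1 where "\<eta>1 = (\<lambda>z. fst z * \<xi> (cusp z, snd z))"
  define \<eta>2 where "\<eta>2 = (\<lambda>z. P (cusp z, snd z))"
  \<comment> \<open>The constant is subtracted so that \<eta> vanishes at 0 and can serve as a small
    time in the Lie series.\<close>
  define \<eta> where "\<eta> = (\<lambda>z. (\<eta>1 z - 1 / 2 * \<eta>2 z) - (\<eta>1 0 - 1 / 2 * \<eta>2 0))"
  have pull: "analytic2_at (\<lambda>z. F (cusp z, snd z)) 0" if "analytic2_at F 0" for F
    using that by (intro analytic2_compose analytic2_cusp analytic2_snd) (simp add: cusp_eq zero_prod_def)
  have an: "analytic2_at \<eta>1 0" "analytic2_at \<eta>2 0"
    unfolding \<eta>1_def \<eta>2_def by (intro analytic2_mult analytic2_fst pull f(1) P(1))+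
  have "analytic2_at \<eta> 0"
    unfolding \<eta>_def by (intro analytic2_diff analytic2_mult an analytic2_const)
  moreover have "\<eta> 0 = 0" by (simp add: \<eta>_def)
  moreover have "\<forall>\<^sub>F z in nhds 0. a z = f0 (cusp z) + f1 (cusp z) * snd z + hbr \<eta> z"
    using BC(3) eventually_cusp_snd[OF P(2)] eventually_cusp_snd[OF f(4)]
      eventually_cusp_snd[OF analytic2_eventually[OF P(1)]] eventually_cusp_snd[OF analytic2_eventually[OF f(1)]]
      analytic2_eventually[OF an(1)] analytic2_eventually[OF an(2)]
  proof eventually_elim
    case (elim z)
    note d = elim(6,7)[THEN analytic2_diff2]
    have "hbr \<eta> z = hbr \<eta>1 z - 1 / 2 * hbr \<eta>2 z"
      unfolding \<eta>_def by (simp only: hbr_diff hbr_cmult hbr_const diff2_diff diff2_cmult diff2_const d diff_zero)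
    also have "hbr \<eta>1 z = cusp_ode \<xi> (cusp z, snd z)"
      unfolding \<eta>1_def by (rule hbr_fst_times[OF analytic2_diff2[OF elim(5)]])
    also have "hbr \<eta>2 z = - 2 * fst z * C (cusp z, snd z)"
      unfolding \<eta>2_def using hbr_comp_cusp_snd[OF analytic2_diff2[OF elim(4)]] elim(2) by simp
    finally show ?case using elim(1,3) by simp
  qed
  ultimately show ?thesis by (rule that[OF f(2,3)])
qed

text \<open>All derivatives vanish on W and, by continuity, at 0. The origin is only asked to lie in
  the closure because the points (H, y) with real x fill just one side of the curve H = y^3.\<close>

lemma ps_zero_of_zero_on_open:
  assumes "ps c f" "open W" "0 \<in> closure W" "\<And>z. z \<in> W \<Longrightarrow> f z = 0"
  shows "c i j = 0"
proof -
  have partials: "pdx f z = 0" "pdy f z = 0" if "\<And>z. z \<in> W \<Longrightarrow> f z = 0" "z \<in> W" for f z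
  proof -
    have "\<forall>\<^sub>F q in nhds z. f q = 0"
      using eventually_nhds_in_open[OF assms(2) that(2)] by eventually_elim (rule that(1))
    then show "pdx f z = 0" "pdy f z = 0"
      using diff2_cong(2,3)[OF diff2_const(1)[of 0 z], of f] by (simp_all add: diff2_const)
  qed
  have zero: "f 0 = 0" if "ps c f" "\<And>z. z \<in> W \<Longrightarrow> f z = 0" for c f
  proof (rule ccontr)
    assume "f 0 \<noteq> 0"
    have "isCont f 0" by (rule analytic2_isCont[OF ps_analytic2[OF that(1)]])
    then obtain T where T: "open T" "0 \<in> T" "\<forall>z\<in>T. f z \<noteq> 0"
      using continuous_at_avoid[of 0 f 0] \<open>f 0 \<noteq> 0\<close>
      by (metis open_ball centre_in_ball mem_ball dist_commute)
    then have "T \<inter> W \<noteq> {}" using assms(3) open_Int_closure_eq_empty by blast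
    then show False using T(3) that(2) by blast
  qed
  show ?thesis using assms(1,4)
  proof (induction i arbitrary: c f)
    case 0
    then show ?case
    proof (induction j arbitrary: c f)
      case 0
      then show ?case using ps_at_zero[of c f] zero[of c f] by simp
    next
      case (Suc j)
      have "real (Suc j) * c 0 (Suc j) = 0"
        by (rule Suc.IH[OF ps_pdy[OF Suc.prems(1)]]) (rule partials(2)[OF Suc.prems(2)])
      then show ?case by (simp del: of_nat_Suc)
    qed
  next
    case (Suc i)
    have "real (Suc i) * c (Suc i) j = 0"
      by (rule Suc.IH[OF ps_pdx[OF Suc.prems(1)]]) (rule partials(1)[OF Suc.prems(2)])
    then show ?case by (simp del: of_nat_Suc)
  qed
qed

text \<open>Splitting \<eta> as A(H, y) + x \<xi>(H, y) and separating parities in x gives f0 + f1 y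
  = \<open>cusp_ode\<close> \<xi> wherever (H, y) comes from a real x. The identity theorem turns
  this into an identity of coefficients, and the recursion then has only the zero solution.\<close>

lemma brieskorn_independence:
  assumes f: "analytic1_at f0 0" "analytic1_at f1 0" and \<eta>: "analytic2_at \<eta> 0"
    and eq: "\<forall>\<^sub>F z in nhds 0. f0 (cusp z) + f1 (cusp z) * snd z = hbr \<eta> z"
  shows "\<forall>\<^sub>F t in nhds 0. f0 t = 0" "\<forall>\<^sub>F t in nhds 0. f1 t = 0"
proof -
  obtain A \<xi> where A: "analytic2_at A 0" "analytic2_at \<xi> 0"
    "\<forall>\<^sub>F z in nhds 0. \<eta> z = A (cusp z, snd z) + fst z * \<xi> (cusp z, snd z)"
    by (rule cusp_division[OF \<eta>])
  define g where "g = (\<lambda>z. f0 (fst z) + snd z * f1 (fst z) - cusp_ode \<xi> z)"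
  obtain a0 where a0: "ps (\<lambda>i j. if j = 0 then a0 i else 0) (\<lambda>z. f0 (fst z))" using ps_first_kind[OF f(1)] by metis
  obtain a1 where a1: "ps (\<lambda>i j. if j = 0 then a1 i else 0) (\<lambda>z. f1 (fst z))" using ps_first_kind[OF f(2)] by metis
  obtain x where x: "ps x \<xi>" using ps_exists[OF A(2)] by metis
  define c where "c = (\<lambda>i j. (if j = 0 then a0 i else 0) + (if j = 0 then 0 else if j - 1 = 0 then a1 i else 0)
      - ((if i = 0 then 0 else 2 * real (Suc j) * x (i - 1) (Suc j)) - (if j < 2 then 0 else (2 * real j - 1) * x i (j - 2))))"
  have g: "ps c g" unfolding c_def g_def by (intro ps_diff ps_add ps_muly a0 a1 ps_cusp_ode x)
  have ev: "\<forall>\<^sub>F z in nhds 0. g (cusp z, snd z) = - 2 * fst z * pdy A (cusp z, snd z)"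
    using eq eventually_nhds_nhds[OF A(3)] eventually_cusp_snd[OF analytic2_eventually[OF A(1)]]
      eventually_cusp_snd[OF analytic2_eventually[OF A(2)]]
  proof eventually_elim
    case (elim z)
    note d = elim(3,4)[THEN analytic2_diff2]
    note d' = d[THEN diff2_comp2(1)[OF _ cusp_diff2(1) diff2_snd(1)]]
    have "hbr \<eta> z = hbr (\<lambda>z. A (cusp z, snd z) + fst z * \<xi> (cusp z, snd z)) z"
      by (rule hbr_cong[OF _ elim(2)]) (intro diff2_add diff2_mult diff2_fst d')
    also have "\<dots> = hbr (\<lambda>z. A (cusp z, snd z)) z + hbr (\<lambda>z. fst z * \<xi> (cusp z, snd z)) z"
      by (intro hbr_add diff2_mult diff2_fst d')
    also have "\<dots> = - 2 * fst z * pdy A (cusp z, snd z) + cusp_ode \<xi> (cusp z, snd z)"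
      by (simp only: hbr_comp_cusp_snd[OF d(1)] hbr_fst_times[OF d(2)])
    finally show ?case using elim(1) by (simp add: g_def algebra_simps)
  qed
  then obtain r where r: "r > 0" "\<forall>x y. \<bar>x\<bar> < r \<and> \<bar>y\<bar> < r \<longrightarrow>
      g (cusp (x, y), snd (x, y)) = - 2 * fst (x, y) * pdy A (cusp (x, y), snd (x, y))"
    unfolding eventually_nhds_zero_iff by (elim exE conjE)
  \<comment> \<open>The left side is even in x and the right side is odd, so both vanish.\<close>
  have g0: "g (y ^ 3 - x ^ 2, y) = 0" if "\<bar>x\<bar> < r" "\<bar>y\<bar> < r" for x y
    using r(2)[rule_format, of x y] r(2)[rule_format, of "- x" y] that by (simp add: cusp_eq)
  define s where "s = min r (min 1 (r ^ 2 / 4))"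
  have s: "s > 0" "s \<le> r" "s \<le> 1" "s \<le> r ^ 2 / 4" using r(1) by (auto simp: s_def)
  \<comment> \<open>For (h, y) in W the number y^3 - h is positive, so x = sqrt (y^3 - h) exists.
    Moreover x^2 < 2 y^3 < 2 s, and the choice of s makes this less than r^2.\<close>
  define W where "W = {z :: real \<times> real. 0 < snd z \<and> snd z < s \<and> \<bar>fst z\<bar> < snd z ^ 3}"
  have "open W" unfolding W_def
    by (intro open_Collect_conj open_Collect_less continuous_intros)
  moreover have "0 \<in> closure W"
  proof (rule closure_approachable[THEN iffD2], intro allI impI)
    fix e :: real assume e: "e > 0"
    define y where "y = min (s / 2) (e / 2)"
    have "y > 0" "y < s" "y < e" using s e by (auto simp: y_def)
    then show "\<exists>w\<in>W. dist w 0 < e" by (intro bexI[of _ "(0, y)"]) (auto simp: W_def norm_Pair)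
  qed
  moreover have "g z = 0" if zW: "z \<in> W" for z
  proof -
    obtain h y where z: "z = (h, y)" by (cases z)
    have hy: "0 < y" "y < s" "\<bar>h\<bar> < y ^ 3" using zW z by (auto simp: W_def)
    define x where "x = sqrt (y ^ 3 - h)"
    have x2: "x ^ 2 = y ^ 3 - h" using hy by (simp add: x_def)
    have "y ^ 3 \<le> y ^ 1" using hy s by (intro power_decreasing) auto
    then have "x ^ 2 < 2 * s" using x2 hy by simp
    also have "\<dots> < r ^ 2" using s r by simp
    finally have "\<bar>x\<bar> < r" using r(1) power2_less_imp_less[of "\<bar>x\<bar>" r] by simp
    moreover have "\<bar>y\<bar> < r" using hy s by simp
    ultimately show ?thesis using g0[of x y] x2 z by simp
  qed
  ultimately have c0: "c i j = 0" for i j by (rule ps_zero_of_zero_on_open[OF g])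
  \<comment> \<open>The equations in y-degree n + 2 express x p n through the previous row p - 1,
    which is already zero.\<close>
  have x0: "x p n = 0" for p n
  proof (induction p arbitrary: n)
    case 0
    have "(2 * real (n + 2) - 1) * x 0 n = 0" using c0[of 0 "n + 2"] by (simp add: c_def)
    moreover have "2 * real (n + 2) - 1 > 0" by simp
    ultimately show ?case by (metis less_irrefl mult_eq_0_iff)
  next
    case (Suc p)
    have "(2 * real (n + 2) - 1) * x (Suc p) n = 0" using c0[of "Suc p" "n + 2"] Suc by (simp add: c_def)
    moreover have "2 * real (n + 2) - 1 > 0" by simp
    ultimately show ?case by (metis less_irrefl mult_eq_0_iff)
  qed
  have a: "a0 p = 0" "a1 p = 0" for p using c0[of p 0] c0[of p 1] x0 by (simp_all add: c_def)
  have "ps (\<lambda>i j. 0) (\<lambda>z. f0 (fst z))" using a0 unfolding a if_cancel .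
  moreover have "ps (\<lambda>i j. 0) (\<lambda>z. f1 (fst z))" using a1 unfolding a if_cancel .
  ultimately have z: "ps (\<lambda>i j. 0) (\<lambda>z. f0 (fst z))" "ps (\<lambda>i j. 0) (\<lambda>z. f1 (fst z))" .
  have zz: "ps (\<lambda>i j. 0) (\<lambda>z. 0)" using ps_cmult[OF z(1), of 0] by simp
  have "\<forall>\<^sub>F t in nhds 0. h t = 0" if h: "ps (\<lambda>i j. 0) (\<lambda>z. h (fst z))" for h :: "real \<Rightarrow> real"
  proof -
    obtain r where "r > 0" "\<forall>x y. \<bar>x\<bar> < r \<and> \<bar>y\<bar> < r \<longrightarrow> h (fst (x, y)) = 0"
      using ps_eq[OF h zz] unfolding eventually_nhds_zero_iff by (elim exE conjE)
    then have "\<forall>t. dist t 0 < r \<longrightarrow> h t = 0" by (metis abs_zero dist_0_norm dist_commute fst_conv real_norm_def)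
    then show ?thesis unfolding eventually_nhds_metric using \<open>r > 0\<close> by blast
  qed
  then show "\<forall>\<^sub>F t in nhds 0. f0 t = 0" "\<forall>\<^sub>F t in nhds 0. f1 t = 0" using z by blast+
qed

subsection \<open>Lie series\<close>

definition lie :: "('a::real_normed_field \<times> 'a \<Rightarrow> 'a) \<Rightarrow> ('a \<times> 'a \<Rightarrow> 'a) \<Rightarrow> ('a \<times> 'a \<Rightarrow> 'a) \<Rightarrow> 'a \<times> 'a \<Rightarrow> 'a" where
  "lie P Q u z = P z * pdx u z + Q z * pdy u z"

text \<open>
  \<open>lie_exp P Q T u\<close> is the pullback of \<open>u\<close> under the flow of the vector field \<open>(P, Q)\<close> for the
  variable time \<open>T\<close>. All that is needed of it follows from the series: it is multiplicative in \<open>u\<close>,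
  and the field acts on it by \<open>X (E u) = (1 + X T) E (X u)\<close>.
\<close>

definition lie_term :: "('a::{real_normed_field} \<times> 'a \<Rightarrow> 'a) \<Rightarrow> ('a \<times> 'a \<Rightarrow> 'a) \<Rightarrow> ('a \<times> 'a \<Rightarrow> 'a) \<Rightarrow>
    ('a \<times> 'a \<Rightarrow> 'a) \<Rightarrow> nat \<Rightarrow> 'a \<times> 'a \<Rightarrow> 'a" where
  "lie_term P Q T u n z = T z ^ n / fact n * (lie P Q ^^ n) u z"

definition lie_exp :: "('a::{real_normed_field} \<times> 'a \<Rightarrow> 'a) \<Rightarrow> ('a \<times> 'a \<Rightarrow> 'a) \<Rightarrow> ('a \<times> 'a \<Rightarrow> 'a) \<Rightarrow>
    ('a \<times> 'a \<Rightarrow> 'a) \<Rightarrow> 'a \<times> 'a \<Rightarrow> 'a" where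
  "lie_exp P Q T u z = (\<Sum>n. lie_term P Q T u n z)"

lemma lie_mult:
  assumes "diff2 f p" "diff2 g p"
  shows "lie P Q (\<lambda>z. f z * g z) p = lie P Q f p * g p + f p * lie P Q g p"
  using diff2_mult[OF assms] by (simp add: lie_def algebra_simps)

lemma lie_add:
  assumes "diff2 f p" "diff2 g p"
  shows "lie P Q (\<lambda>z. f z + g z) p = lie P Q f p + lie P Q g p"
  using diff2_add[OF assms] by (simp add: lie_def algebra_simps)

lemma lie_cmult:
  assumes "diff2 f p"
  shows "lie P Q (\<lambda>z. c * f z) p = c * lie P Q f p"
  using diff2_cmult[OF assms] by (simp add: lie_def algebra_simps)

lemma lie_const: "lie P Q (\<lambda>z. c) p = 0"
  by (simp add: lie_def diff2_const)

lemma diff2_sum: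
  "(\<And>n. n \<in> A \<Longrightarrow> diff2 (F n) p) \<Longrightarrow> diff2 (\<lambda>z. \<Sum>n\<in>A. F n z) p"
  by (induction A rule: infinite_finite_induct) (simp_all add: diff2_const diff2_add)

lemma lie_sum:
  "(\<And>n. n \<in> A \<Longrightarrow> diff2 (F n) p) \<Longrightarrow> lie P Q (\<lambda>z. \<Sum>n\<in>A. F n z) p = (\<Sum>n\<in>A. lie P Q (F n) p)"
  by (induction A rule: infinite_finite_induct) (simp_all add: lie_const lie_add diff2_sum)

lemma lie_cong:
  assumes "diff2 f p" "\<forall>\<^sub>F q in nhds p. g q = f q"
  shows "lie P Q g p = lie P Q f p"
  using diff2_cong[OF assms] by (simp add: lie_def)

lemma lie_power:
  assumes "diff2 f p"
  shows "diff2 (\<lambda>z. f z ^ n) p" "lie P Q (\<lambda>z. f z ^ n) p = of_nat n * f p ^ (n - 1) * lie P Q f p"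
proof -
  have "((\<lambda>t. t ^ n) has_field_derivative of_nat n * f p ^ (n - 1)) (at (f p))"
    by (auto intro!: derivative_eq_intros)
  from diff2_comp1[of "\<lambda>t. t ^ n", OF this assms]
  show "diff2 (\<lambda>z. f z ^ n) p" "lie P Q (\<lambda>z. f z ^ n) p = of_nat n * f p ^ (n - 1) * lie P Q f p"
    by (simp_all add: lie_def algebra_simps)
qed

lemma hol2_lie: "hol2 P S \<Longrightarrow> hol2 Q S \<Longrightarrow> hol2 U S \<Longrightarrow> hol2 (lie P Q U) S"
  unfolding lie_def[abs_def] by (intro hol2_intros hol2_pdx hol2_pdy)

lemma hol2_lie_funpow: "hol2 P S \<Longrightarrow> hol2 Q S \<Longrightarrow> hol2 U S \<Longrightarrow> hol2 ((lie P Q ^^ n) U) S"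
  by (induction n) (simp_all add: hol2_lie)

lemma cext_lie: "cext P PC S \<Longrightarrow> cext Q QC S \<Longrightarrow> cext u U S \<Longrightarrow> cext (lie P Q u) (lie PC QC U) S"
  unfolding lie_def[abs_def] by (intro cext_add cext_mult cext_pdx cext_pdy)

lemma cext_lie_funpow: "cext P PC S \<Longrightarrow> cext Q QC S \<Longrightarrow> cext u U S \<Longrightarrow> cext ((lie P Q ^^ n) u) ((lie PC QC ^^ n) U) S"
  by (induction n) (simp_all add: cext_lie)

lemma cauchy_partials:
  assumes U: "hol2 U (polydisc 0 r)" and B: "\<And>z. z \<in> polydisc 0 r \<Longrightarrow> norm (U z) \<le> B"
    and s: "0 < s" and z: "z \<in> polydisc 0 (r - s)"
  shows "norm (pdx U z) \<le> B / s" "norm (pdy U z) \<le> B / s"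
proof -
  obtain x y where xy: "z = (x, y)" by (cases z)
  have n: "norm x < r - s" "norm y < r - s" using z xy by (auto simp: polydisc_def)
  have in1: "(t, y) \<in> polydisc 0 r" if "t \<in> cball x s" for t
  proof -
    have "norm t \<le> norm x + norm (t - x)" by (metis add.commute diff_add_cancel norm_triangle_ineq)
    then show ?thesis using that n s by (auto simp: polydisc_def dist_norm norm_minus_commute)
  qed
  have in2: "(x, t) \<in> polydisc 0 r" if "t \<in> cball y s" for t
  proof -
    have "norm t \<le> norm y + norm (t - y)" by (metis add.commute diff_add_cancel norm_triangle_ineq)
    then show ?thesis using that n s by (auto simp: polydisc_def dist_norm norm_minus_commute)
  qed
  have h1: "(\<lambda>t. U (t, y)) holomorphic_on cball x s" by (rule hol2_slice_x[OF U in1])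
  have "norm ((deriv ^^ 1) (\<lambda>t. U (t, y)) x) \<le> fact 1 * B / s ^ 1"
  proof (rule Cauchy_inequality[OF holomorphic_on_subset[OF h1 ball_subset_cball] holomorphic_on_imp_continuous_on[OF h1] s])
    show "norm (U (t, y)) \<le> B" if "norm (x - t) = s" for t
      by (rule B[OF in1]) (use that in \<open>simp add: dist_norm\<close>)
  qed
  then show "norm (pdx U z) \<le> B / s" by (simp add: pdx_def xy)
  have h2: "(\<lambda>t. U (x, t)) holomorphic_on cball y s" by (rule hol2_slice_y[OF U in2])
  have "norm ((deriv ^^ 1) (\<lambda>t. U (x, t)) y) \<le> fact 1 * B / s ^ 1"
  proof (rule Cauchy_inequality[OF holomorphic_on_subset[OF h2 ball_subset_cball] holomorphic_on_imp_continuous_on[OF h2] s])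
    show "norm (U (x, t)) \<le> B" if "norm (y - t) = s" for t
      by (rule B[OF in2]) (use that in \<open>simp add: dist_norm\<close>)
  qed
  then show "norm (pdy U z) \<le> B / s" by (simp add: pdy_def xy)
qed

text \<open>A single term of the exponential series at n. It converts the power n^n caused by n
  Cauchy estimates into the factorial that the Lie series cancels.\<close>

lemma power_self_le_fact_exp: "real n ^ n \<le> fact n * exp 1 ^ n"
proof -
  have "(\<Sum>k\<in>{n}. real n ^ k /\<^sub>R fact k) \<le> (\<Sum>k. real n ^ k /\<^sub>R fact k)"
    by (rule sum_le_suminf[OF summable_exp_generic]) auto
  then have "real n ^ n / fact n \<le> exp (real n)" by (simp add: exp_def divide_inverse mult.commute)
  also have "exp (real n) = exp 1 ^ n" using exp_of_nat_mult[of n "1::real"] by simp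
  finally show ?thesis by (simp add: divide_le_eq mult.commute)
qed

text \<open>Cauchy's estimate is applied \<open>n\<close> times, shrinking the polydisc by \<open>r / (2 n)\<close> each time.\<close>

lemma lie_funpow_bound:
  assumes P: "hol2 P (polydisc 0 r)" and Q: "hol2 Q (polydisc 0 r)" and U: "hol2 U (polydisc 0 r)"
    and K: "\<And>z. z \<in> polydisc 0 r \<Longrightarrow> norm (P z) \<le> K" "\<And>z. z \<in> polydisc 0 r \<Longrightarrow> norm (Q z) \<le> K"
    and M: "\<And>z. z \<in> polydisc 0 r \<Longrightarrow> norm (U z) \<le> M" and r: "r > 0"
    and z: "z \<in> polydisc 0 (r / 2)"
  shows "norm ((lie P Q ^^ n) U z) \<le> M * fact n * (4 * K * exp 1 / r) ^ n"
proof (cases "n = 0")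
  case True
  have "z \<in> polydisc 0 r" using z r by (auto simp: polydisc_def)
  then show ?thesis using True M by simp
next
  case False
  have z0: "(0 :: complex \<times> complex) \<in> polydisc 0 r" by (rule centre_in_polydisc[OF r])
  have K0: "0 \<le> K" using K(1)[OF z0] norm_ge_zero order_trans by blast
  have M0: "0 \<le> M" using M[OF z0] norm_ge_zero order_trans by blast
  define s where "s = r / (2 * real n)"
  have s: "s > 0" using r False by (simp add: s_def)
  have "norm ((lie P Q ^^ k) U w) \<le> M * (2 * K / s) ^ k" if "w \<in> polydisc 0 (r - real k * s)" for k w
    using that
  proof (induction k arbitrary: w)
    case 0
    then show ?case using M by simp
  next
    case (Suc k)
    define B where "B = M * (2 * K / s) ^ k"
    have sub: "polydisc 0 (r - real k * s) \<subseteq> polydisc 0 r" "polydisc 0 (r - real k * s - s) \<subseteq> polydisc 0 r"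
      using s by (auto simp: polydisc_def intro: less_le_trans mult_nonneg_nonneg)
         (smt (verit) mult_nonneg_nonneg of_nat_0_le_iff)+
    have w: "w \<in> polydisc 0 (r - real k * s - s)" using Suc.prems by (simp add: algebra_simps)
    then have wr: "w \<in> polydisc 0 r" using sub by blast
    have h: "hol2 ((lie P Q ^^ k) U) (polydisc 0 (r - real k * s))"
      using hol2_subset[OF hol2_lie_funpow[OF P Q U] open_polydisc sub(1)] .
    note c = cauchy_partials[OF h Suc.IH s w]
    have "norm ((lie P Q ^^ Suc k) U w) \<le> norm (P w) * norm (pdx ((lie P Q ^^ k) U) w) + norm (Q w) * norm (pdy ((lie P Q ^^ k) U) w)"
      by (simp add: lie_def[of P] norm_mult[symmetric] norm_triangle_ineq)
    also have "\<dots> \<le> K * (B / s) + K * (B / s)"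
      unfolding B_def by (intro add_mono mult_mono K wr c K0 norm_ge_zero)
    also have "\<dots> = M * (2 * K / s) ^ Suc k" by (simp add: B_def)
    finally show ?case .
  qed
  from this[of z n] have "norm ((lie P Q ^^ n) U z) \<le> M * (2 * K / s) ^ n"
    using z False by (simp add: s_def)
  also have "2 * K / s = 4 * K / r * real n" using False by (simp add: s_def)
  also have "M * (4 * K / r * real n) ^ n = M * (4 * K / r) ^ n * real n ^ n" by (simp only: power_mult_distrib mult.assoc)
  also have "\<dots> \<le> M * (4 * K / r) ^ n * (fact n * exp 1 ^ n)"
    using power_self_le_fact_exp[of n] K0 M0 r by (intro mult_left_mono) auto
  finally show ?thesis by (simp add: power_mult_distrib power_divide mult_ac)
qed

text \<open>By Leibniz, differentiating T^n / n! gives T^(n-1) / (n-1)! times X T, which shifts the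
  index; differentiating the other factor gives the series of X u. The limit is X (E u) = (1 + X T)
  E (X u).\<close>

lemma lie_partial_sum:
  assumes T: "diff2 T p" and d: "\<And>n. diff2 ((lie P Q ^^ n) u) p"
  shows "lie P Q (\<lambda>z. \<Sum>n<Suc N. lie_term P Q T u n z) p =
     lie P Q T p * (\<Sum>n<N. lie_term P Q T (lie P Q u) n p) + (\<Sum>n<Suc N. lie_term P Q T (lie P Q u) n p)"
proof -
  have sw: "(lie P Q ^^ n) (lie P Q u) = (lie P Q ^^ Suc n) u" for n by (simp add: funpow_swap1)
  have T': "diff2 (\<lambda>z. T z ^ n / fact n) p" "lie P Q (\<lambda>z. T z ^ n / fact n) p = of_nat n * T p ^ (n - 1) * lie P Q T p / fact n" for n
    using diff2_cmult(1)[OF lie_power(1)[OF T, of n], of "1 / fact n"]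
      lie_cmult[OF lie_power(1)[OF T, of n], of P Q "1 / fact n"] lie_power(2)[OF T, of P Q n] by simp_all
  have "lie P Q (lie_term P Q T u n) p = of_nat n * T p ^ (n - 1) * lie P Q T p / fact n * (lie P Q ^^ n) u p
     + lie_term P Q T (lie P Q u) n p" for n
    unfolding lie_term_def[abs_def] lie_mult[OF T'(1) d] T'(2) sw by simp
  moreover have "lie P Q (\<lambda>z. \<Sum>n<Suc N. lie_term P Q T u n z) p = (\<Sum>n<Suc N. lie P Q (lie_term P Q T u n) p)"
    unfolding lie_term_def[abs_def] by (intro lie_sum diff2_mult T' d)
  ultimately have "lie P Q (\<lambda>z. \<Sum>n<Suc N. lie_term P Q T u n z) p =
     (\<Sum>n<Suc N. of_nat n * T p ^ (n - 1) * lie P Q T p / fact n * (lie P Q ^^ n) u p)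
     + (\<Sum>n<Suc N. lie_term P Q T (lie P Q u) n p)" by (simp only: sum.distrib)
  also have "(\<Sum>n<Suc N. of_nat n * T p ^ (n - 1) * lie P Q T p / fact n * (lie P Q ^^ n) u p)
      = (\<Sum>n<N. of_nat (Suc n) * T p ^ n * lie P Q T p / fact (Suc n) * (lie P Q ^^ Suc n) u p)"
    by (subst sum.lessThan_Suc_shift) simp
  also have "\<dots> = lie P Q T p * (\<Sum>n<N. lie_term P Q T (lie P Q u) n p)"
    unfolding sum_distrib_left lie_term_def sw
  proof (rule sum.cong[OF refl])
    fix n
    have "of_nat (Suc n) / fact (Suc n) = (1 / fact n :: 'a)" by (simp add: fact_Suc del: of_nat_Suc)
    then have "of_nat (Suc n) * T p ^ n * lie P Q T p / fact (Suc n) = T p ^ n * lie P Q T p * (1 / fact n)"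
      by (metis (no_types, lifting) mult.commute mult.left_commute times_divide_eq_right)
    then show "of_nat (Suc n) * T p ^ n * lie P Q T p / fact (Suc n) * (lie P Q ^^ Suc n) u p =
        lie P Q T p * (T p ^ n / fact n * (lie P Q ^^ Suc n) u p)" by simp
  qed
  finally show ?thesis .
qed

text \<open>Where T is small, \<open>lie_funpow_bound\<close> dominates the terms for U by M / 2^n
  and those for X U by a multiple of (n + 1) / 2^n. The series for U converges uniformly, so it may
  be differentiated termwise.\<close>

lemma lie_exp_complex:
  assumes P: "hol2 P (polydisc 0 r)" and Q: "hol2 Q (polydisc 0 r)" and U: "hol2 U (polydisc 0 r)" and T: "hol2 T (polydisc 0 r)"
    and K': "\<forall>z\<in>polydisc 0 r. norm (P z) \<le> K" "\<forall>z\<in>polydisc 0 r. norm (Q z) \<le> K"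
    and M': "\<forall>z\<in>polydisc 0 r. norm (U z) \<le> M" and s: "0 < s" "s \<le> r / 2"
    and Ts': "\<forall>z\<in>polydisc 0 s. norm (T z) * (4 * K * exp 1 / r) \<le> 1 / 2"
  shows "hol2 (lie_exp P Q T U) (polydisc 0 s)"
    and "z \<in> polydisc 0 s \<Longrightarrow> summable (\<lambda>n. norm (lie_term P Q T U n z))"
    and "z \<in> polydisc 0 s \<Longrightarrow> lie P Q (lie_exp P Q T U) z = (1 + lie P Q T z) * lie_exp P Q T (lie P Q U) z"
    and "z \<in> polydisc 0 s \<Longrightarrow> summable (\<lambda>n. lie_term P Q T (lie P Q U) n z)"
proof -
  have r: "r > 0" using s by simp
  note K = K'[rule_format] and M = M'[rule_format] and Ts = Ts'[rule_format]
  define C where "C = 4 * K * exp 1 / r"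
  have z0: "(0 :: complex \<times> complex) \<in> polydisc 0 r" by (rule centre_in_polydisc[OF r])
  have K0: "0 \<le> K" using K(1)[OF z0] norm_ge_zero order_trans by blast
  have M0: "0 \<le> M" using M[OF z0] norm_ge_zero order_trans by blast
  have C0: "0 \<le> C" using K0 r by (simp add: C_def)
  have sub: "polydisc 0 s \<subseteq> polydisc 0 (r / 2)" "polydisc 0 s \<subseteq> polydisc 0 r"
    using s by (auto simp: polydisc_def)
  have Xb: "norm ((lie P Q ^^ n) U z) \<le> M * fact n * C ^ n" if "z \<in> polydisc 0 s" for n z
    using lie_funpow_bound[OF P Q U K M r] sub that unfolding C_def by blast
  have q: "0 \<le> norm (T z) * C" "norm (T z) * C \<le> 1 / 2" if "z \<in> polydisc 0 s" for z
    using mult_nonneg_nonneg[OF norm_ge_zero C0] Ts[OF that, folded C_def] by simp_all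
  have tb: "norm (lie_term P Q T U n z) \<le> M * (1 / 2) ^ n" if z: "z \<in> polydisc 0 s" for n z
  proof -
    have "norm (lie_term P Q T U n z) = norm (T z) ^ n / fact n * norm ((lie P Q ^^ n) U z)"
      by (simp add: lie_term_def norm_mult norm_divide norm_power)
    also have "\<dots> \<le> norm (T z) ^ n / fact n * (M * fact n * C ^ n)"
      by (intro mult_left_mono Xb z) auto
    also have "\<dots> = M * (norm (T z) * C) ^ n" by (simp add: power_mult_distrib)
    also have "\<dots> \<le> M * (1 / 2) ^ n"
      using q[OF z] C0 M0 by (intro mult_left_mono power_mono mult_nonneg_nonneg) simp_all
    finally show ?thesis .
  qed
  have tb': "norm (lie_term P Q T (lie P Q U) n z) \<le> M * C * (real (Suc n) * (1 / 2) ^ n)"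
    if z: "z \<in> polydisc 0 s" for n z
  proof -
    have "norm (lie_term P Q T (lie P Q U) n z) = norm (T z) ^ n / fact n * norm ((lie P Q ^^ Suc n) U z)"
      by (simp add: lie_term_def norm_mult norm_divide norm_power funpow_swap1)
    also have "\<dots> \<le> norm (T z) ^ n / fact n * (M * fact (Suc n) * C ^ Suc n)"
      by (intro mult_left_mono Xb z) auto
    also have "\<dots> = M * C * (real (Suc n) * (norm (T z) * C) ^ n)" by (simp add: power_mult_distrib)
    also have "\<dots> \<le> M * C * (real (Suc n) * (1 / 2) ^ n)"
      using q[OF z] C0 M0 by (intro mult_left_mono power_mono mult_nonneg_nonneg) simp_all
    finally show ?thesis .
  qed
  have s1: "summable (\<lambda>n. M * (1 / 2 :: real) ^ n)" by (intro summable_mult summable_geometric) simp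
  \<comment> \<open>The series of (n + 1) / 2^n is the derivative of the geometric series at
    1/2.\<close>
  have "summable (\<lambda>n. diffs (\<lambda>n. 1 :: real) n * (1 / 2) ^ n)"
    by (rule termdiff_converges[of _ 1]) (auto intro: summable_geometric)
  then have "summable (\<lambda>n. real (Suc n) * (1 / 2 :: real) ^ n)" by (simp add: diffs_def)
  then have s2: "summable (\<lambda>n. M * C * (real (Suc n) * (1 / 2 :: real) ^ n))" by (rule summable_mult)
  show sm: "summable (\<lambda>n. norm (lie_term P Q T U n z))" if "z \<in> polydisc 0 s" for z
    using tb[OF that] by (intro summable_comparison_test'[OF s1]) simp
  show sm': "summable (\<lambda>n. lie_term P Q T (lie P Q U) n z)" if "z \<in> polydisc 0 s" for z
    using tb'[OF that] by (intro summable_comparison_test'[OF s2]) simp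
  have ul: "uniform_limit (polydisc 0 s) (\<lambda>N z. \<Sum>n<N. lie_term P Q T U n z) (lie_exp P Q T U) sequentially"
    unfolding lie_exp_def[abs_def] by (rule Weierstrass_m_test[OF tb s1])
  have hd: "hol2 ((lie P Q ^^ n) U) (polydisc 0 s)" "hol2 T (polydisc 0 s)" for n
    using hol2_subset[OF hol2_lie_funpow[OF P Q U] open_polydisc sub(2)] hol2_subset[OF T open_polydisc sub(2)] .
  have hT: "hol2 (\<lambda>z. T z ^ n / fact n) (polydisc 0 s)" for n
    unfolding divide_inverse by (intro hol2_intros hol2_power hd open_polydisc)
  have hs: "hol2 (\<lambda>z. \<Sum>n<N. lie_term P Q T U n z) (polydisc 0 s)" for N
    unfolding lie_term_def by (intro hol2_sum hol2_intros(6) open_polydisc hd hT)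
  note lim = hol2_uniform_limit[OF hs ul]
  show "hol2 (lie_exp P Q T U) (polydisc 0 s)" using lim(1) by simp
  show "lie P Q (lie_exp P Q T U) z = (1 + lie P Q T z) * lie_exp P Q T (lie P Q U) z" if z: "z \<in> polydisc 0 s"
  proof -
    define E where "E = lie_exp P Q T (lie P Q U) z"
    have "(\<lambda>N. lie P Q (\<lambda>z. \<Sum>n<N. lie_term P Q T U n z) z) \<longlonglongrightarrow> lie P Q (lie_exp P Q T U) z"
      unfolding lie_def[of P Q "\<lambda>z. \<Sum>n<_. lie_term P Q T U n z"] lie_def[of P Q "lie_exp P Q T U"]
      using z by (intro tendsto_intros lim) simp_all
    then have 1: "(\<lambda>N. lie P Q (\<lambda>z. \<Sum>n<Suc N. lie_term P Q T U n z) z) \<longlonglongrightarrow> lie P Q (lie_exp P Q T U) z"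
      by (rule LIMSEQ_Suc)
    have E: "(\<lambda>N. \<Sum>n<N. lie_term P Q T (lie P Q U) n z) \<longlonglongrightarrow> E"
      using summable_LIMSEQ[OF sm'[OF z]] by (simp add: E_def lie_exp_def)
    have 2: "(\<lambda>N. lie P Q T z * (\<Sum>n<N. lie_term P Q T (lie P Q U) n z) + (\<Sum>n<Suc N. lie_term P Q T (lie P Q U) n z))
        \<longlonglongrightarrow> lie P Q T z * E + E"
      by (intro tendsto_add tendsto_mult tendsto_const E LIMSEQ_Suc[OF E])
    have "lie P Q (\<lambda>z. \<Sum>n<Suc N. lie_term P Q T U n z) z = lie P Q T z * (\<Sum>n<N. lie_term P Q T (lie P Q U) n z) + (\<Sum>n<Suc N. lie_term P Q T (lie P Q U) n z)" for N
      by (rule lie_partial_sum) (use hd z in \<open>auto simp: hol2_def\<close>)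
    with 1 have "(\<lambda>N. lie P Q T z * (\<Sum>n<N. lie_term P Q T (lie P Q U) n z) + (\<Sum>n<Suc N. lie_term P Q T (lie P Q U) n z))
        \<longlonglongrightarrow> lie P Q (lie_exp P Q T U) z" by simp
    from LIMSEQ_unique[OF this 2] show ?thesis by (simp add: E_def algebra_simps)
  qed
qed

text \<open>T vanishes at 0, so the smallness required by \<open>lie_exp_complex\<close> holds near
  0. The terms are real at real points, hence the complex sum extends the real one.\<close>

lemma lie_exp_analytic:
  assumes P: "analytic2_at P 0" and Q: "analytic2_at Q 0" and T: "analytic2_at T 0" "T 0 = 0" and u: "analytic2_at u 0"
  shows "analytic2_at (lie_exp P Q T u) 0"
    and "\<forall>\<^sub>F z in nhds 0. summable (\<lambda>n. norm (lie_term P Q T u n z))"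
    and "\<forall>\<^sub>F z in nhds 0. lie P Q (lie_exp P Q T u) z = (1 + lie P Q T z) * lie_exp P Q T (lie P Q u) z"
proof -
  obtain PC QC S1 where 1: "cext P PC S1" "cext Q QC S1" "emb 0 \<in> S1" "open S1"
    using P Q by (rule analytic2_common_ext)
  obtain TC U S2 where 2: "cext T TC S2" "cext u U S2" "emb 0 \<in> S2" "open S2"
    using T(1) u by (rule analytic2_common_ext)
  have e0: "emb 0 = 0" by (simp add: emb_def zero_prod_def)
  obtain r where r: "r > 0" "cpolydisc 0 r \<subseteq> S1 \<inter> S2"
    using open_contains_cpolydisc[of "S1 \<inter> S2" 0] 1 2 e0 by auto
  define D where "D = polydisc 0 r"
  have D: "D \<subseteq> cpolydisc 0 r" "open D" by (auto simp: D_def open_polydisc polydisc_subset_cpolydisc)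
  have ext: "cext P PC D" "cext Q QC D" "cext T TC D" "cext u U D"
    using 1 2 r(2) D by (auto intro: cext_subset)
  note h = ext[THEN cext_hol2, unfolded D_def]
  obtain K1 where K1: "K1 > 0" "\<And>q. q \<in> cpolydisc 0 r \<Longrightarrow> norm (PC q) \<le> K1"
    using bounded_on_cpolydisc[OF cext_hol2[OF 1(1)], of 0 r] r by blast
  obtain K2 where K2: "K2 > 0" "\<And>q. q \<in> cpolydisc 0 r \<Longrightarrow> norm (QC q) \<le> K2"
    using bounded_on_cpolydisc[OF cext_hol2[OF 1(2)], of 0 r] r by blast
  obtain M where M: "M > 0" "\<And>q. q \<in> cpolydisc 0 r \<Longrightarrow> norm (U q) \<le> M"
    using bounded_on_cpolydisc[OF cext_hol2[OF 2(2)], of 0 r] r by blast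
  define K where "K = max K1 K2"
  have K: "norm (PC z) \<le> K" "norm (QC z) \<le> K" if "z \<in> polydisc 0 r" for z
    using K1(2)[of z] K2(2)[of z] that D by (auto simp: K_def D_def le_max_iff_disj)
  have M': "norm (U z) \<le> M" if "z \<in> polydisc 0 r" for z using M(2)[of z] that D by (auto simp: D_def)
  define C where "C = 4 * K * exp 1 / r"
  have C: "C > 0" using K1 r by (simp add: C_def K_def less_max_iff_disj)
  have "isCont TC 0"
    using hol2_continuous_on[OF h(3)] centre_in_polydisc[OF r(1)] open_polydisc continuous_on_eq_continuous_at by blast
  moreover have "TC 0 = 0" using cextD[OF 2(1,3)] e0 T(2) by simp
  ultimately have "\<forall>\<^sub>F z in nhds 0. norm (TC z) < 1 / (2 * C)"
  proof -
    assume c: "isCont TC 0" and z: "TC 0 = 0"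
    from c have "(TC \<longlongrightarrow> TC 0) (nhds 0)" by (simp only: isCont_def tendsto_at_iff_tendsto_nhds)
    from order_tendstoD(2)[OF tendsto_norm[OF this], of "1 / (2 * C)"] z C show ?thesis by simp
  qed
  then obtain e where e: "e > 0" "\<forall>z. dist z 0 < e \<longrightarrow> norm (TC z) < 1 / (2 * C)"
    unfolding eventually_nhds_metric by (elim exE conjE)
  \<comment> \<open>The bound r / 2 is the room needed by \<open>lie_funpow_bound\<close>; a
    polydisc of radius e / 2 lies in the ball of radius e on which T is small.\<close>
  define s where "s = min (r / 2) (e / 2)"
  have s: "0 < s" "s \<le> r / 2" using r e by (auto simp: s_def)
  have Ts: "norm (TC z) * (4 * K * exp 1 / r) \<le> 1 / 2" if z: "z \<in> polydisc 0 s" for z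
  proof -
    have n: "norm (fst z) < e / 2" "norm (snd z) < e / 2" using z by (auto simp: polydisc_def s_def mem_Times_iff)
    have "norm z \<le> norm (fst z) + norm (snd z)" by (metis norm_Pair_le prod.collapse)
    then have "norm z < e" using n by simp
    then have "norm (TC z) < 1 / (2 * C)" using e(2)[rule_format, of z] by simp
    then show ?thesis unfolding C_def[symmetric] using C by (simp add: field_simps)
  qed
  have KB: "\<forall>z\<in>polydisc 0 r. norm (PC z) \<le> K" "\<forall>z\<in>polydisc 0 r. norm (QC z) \<le> K"
    and MB: "\<forall>z\<in>polydisc 0 r. norm (U z) \<le> M"
    and TB: "\<forall>z\<in>polydisc 0 s. norm (TC z) * (4 * K * exp 1 / r) \<le> 1 / 2"
    by (rule ballI, erule K(1), rule ballI, erule K(2), rule ballI, erule M', rule ballI, erule Ts)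
  note L = lie_exp_complex[OF h(1,2,4,3) KB MB s TB]
  have Ds: "polydisc 0 s \<subseteq> D" using s by (auto simp: D_def polydisc_def)
  have exts: "cext P PC (polydisc 0 s)" "cext Q QC (polydisc 0 s)" "cext T TC (polydisc 0 s)" "cext u U (polydisc 0 s)"
    using ext Ds by (auto intro: cext_subset open_polydisc)
  have extl: "cext (lie P Q f) (lie PC QC F) (polydisc 0 s)" if "cext f F (polydisc 0 s)" for f F
    using cext_lie_funpow[OF exts(1,2) that, of 1] by simp
  have trm: "lie_term PC QC TC F n (emb z) = of_real (lie_term P Q T f n z)"
    if "cext f F (polydisc 0 s)" "emb z \<in> polydisc 0 s" for f F n z
    using cextD[OF cext_lie_funpow[OF exts(1,2) that(1)] that(2)] cextD[OF exts(3) that(2)]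
    by (simp add: lie_term_def)
  have sm: "summable (\<lambda>n. norm (lie_term P Q T u n z))" if z: "emb z \<in> polydisc 0 s" for z
    using L(2)[OF z] unfolding trm[OF exts(4) z] by simp
  have sm': "summable (\<lambda>n. lie_term P Q T (lie P Q u) n z)" if z: "emb z \<in> polydisc 0 s" for z
    using L(4)[OF z] unfolding trm[OF extl[OF exts(4)] z] by (simp add: summable_complex_of_real)
  have E: "lie_exp PC QC TC U (emb z) = of_real (lie_exp P Q T u z)" if z: "emb z \<in> polydisc 0 s" for z
    unfolding lie_exp_def trm[OF exts(4) z] by (rule suminf_of_real[OF summable_norm_cancel[OF sm[OF z]], symmetric])
  have E': "lie_exp PC QC TC (lie PC QC U) (emb z) = of_real (lie_exp P Q T (lie P Q u) z)" if z: "emb z \<in> polydisc 0 s" for z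
    unfolding lie_exp_def trm[OF extl[OF exts(4)] z] by (rule suminf_of_real[OF sm'[OF z], symmetric])
  have extE: "cext (lie_exp P Q T u) (lie_exp PC QC TC U) (polydisc 0 s)"
    unfolding cext_def using L(1) E by blast
  have 0: "emb 0 \<in> polydisc 0 s" using centre_in_polydisc[OF s(1)] e0 by simp
  show "analytic2_at (lie_exp P Q T u) 0" unfolding analytic2_at_iff_cext using extE 0 by blast
  note ev = eventually_emb[OF open_polydisc 0]
  show "\<forall>\<^sub>F z in nhds 0. summable (\<lambda>n. norm (lie_term P Q T u n z))"
    by (rule eventually_mono[OF ev sm])
  show "\<forall>\<^sub>F z in nhds 0. lie P Q (lie_exp P Q T u) z = (1 + lie P Q T z) * lie_exp P Q T (lie P Q u) z"
  proof (rule eventually_mono[OF ev])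
    fix z assume z: "emb z \<in> polydisc 0 s"
    have "complex_of_real (lie P Q (lie_exp P Q T u) z) = of_real ((1 + lie P Q T z) * lie_exp P Q T (lie P Q u) z)"
      using L(3)[OF z] cextD[OF extl[OF extE] z] cextD[OF extl[OF exts(3)] z] E'[OF z] by simp
    then show "lie P Q (lie_exp P Q T u) z = (1 + lie P Q T z) * lie_exp P Q T (lie P Q u) z"
      by (simp only: of_real_eq_iff)
  qed
qed

lemma analytic2_lie: "analytic2_at P p \<Longrightarrow> analytic2_at Q p \<Longrightarrow> analytic2_at u p \<Longrightarrow> analytic2_at (lie P Q u) p"
  unfolding lie_def[abs_def] by (intro analytic2_add analytic2_mult analytic2_pdx analytic2_pdy)

lemma analytic2_lie_funpow:
  "analytic2_at P p \<Longrightarrow> analytic2_at Q p \<Longrightarrow> analytic2_at u p \<Longrightarrow> analytic2_at ((lie P Q ^^ n) u) p"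
  by (induction n) (simp_all add: analytic2_lie)

text \<open>The term with indices (k, n + 1 - k) is produced k times from one factor and n + 1 - k
  times from the other, together n + 1 times.\<close>

lemma lie_leibniz_sum:
  fixes A :: "nat \<Rightarrow> nat \<Rightarrow> real"
  shows "(\<Sum>k\<le>n. real (Suc k) * A (Suc k) (n - k) + real (Suc (n - k)) * A k (Suc (n - k)))
     = real (Suc n) * (\<Sum>k\<le>Suc n. A k (Suc n - k))"
proof -
  have "real (Suc n) * (\<Sum>k\<le>Suc n. A k (Suc n - k)) =
      (\<Sum>k\<le>Suc n. real k * A k (Suc n - k)) + (\<Sum>k\<le>Suc n. real (Suc n - k) * A k (Suc n - k))"
    unfolding sum_distrib_left sum.distrib[symmetric]
    by (intro sum.cong refl) (auto simp: of_nat_diff algebra_simps)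
  also have "(\<Sum>k\<le>Suc n. real k * A k (Suc n - k)) = (\<Sum>k\<le>n. real (Suc k) * A (Suc k) (n - k))"
    by (subst sum.atMost_Suc_shift) simp
  also have "(\<Sum>k\<le>Suc n. real (Suc n - k) * A k (Suc n - k)) = (\<Sum>k\<le>n. real (Suc (n - k)) * A k (Suc (n - k)))"
    by (auto intro!: sum.cong simp: Suc_diff_le of_nat_diff)
  finally show ?thesis by (simp only: sum.distrib)
qed

text \<open>With derivatives divided by factorials the Leibniz rule has no binomial coefficients and
  matches the Cauchy product. It is proved on an open set because only an identity near a point can
  be differentiated.\<close>

lemma lie_funpow_mult:
  assumes W: "open W" and an: "\<And>z. z \<in> W \<Longrightarrow> analytic2_at P z" "\<And>z. z \<in> W \<Longrightarrow> analytic2_at Q z"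
    "\<And>z. z \<in> W \<Longrightarrow> analytic2_at u z" "\<And>z. z \<in> W \<Longrightarrow> analytic2_at v z"
  shows "z \<in> W \<Longrightarrow> (lie P Q ^^ n) (\<lambda>z. u z * v z) z / fact n =
     (\<Sum>k\<le>n. (lie P Q ^^ k) u z / fact k * ((lie P Q ^^ (n - k)) v z / fact (n - k)))"
proof (induction n arbitrary: z)
  case (Suc n)
  define a where "a = (\<lambda>k z. (1 / fact k) * (lie P Q ^^ k) u z)"
  define b where "b = (\<lambda>k z. (1 / fact k) * (lie P Q ^^ k) v z)"
  have an': "diff2 ((lie P Q ^^ k) u) z" "diff2 ((lie P Q ^^ k) v) z" for k
    using analytic2_lie_funpow[THEN analytic2_diff2] an Suc.prems by blast+
  have ab: "diff2 (a k) z" "diff2 (b k) z" for k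
    unfolding a_def b_def by (intro diff2_cmult an')+
  have Xa: "lie P Q (a k) z = real (Suc k) * a (Suc k) z" "lie P Q (b k) z = real (Suc k) * b (Suc k) z" for k
    unfolding a_def b_def lie_cmult[OF an'(1)] lie_cmult[OF an'(2)]
    by (simp_all add: fact_Suc divide_simps del: of_nat_Suc)
  have ev: "\<forall>\<^sub>F q in nhds z. (lie P Q ^^ n) (\<lambda>z. u z * v z) q = fact n * (\<Sum>k\<le>n. a k q * b (n - k) q)"
    using eventually_nhds_in_open[OF W Suc.prems]
  proof eventually_elim
    case (elim q)
    show ?case using Suc.IH[OF elim] by (simp add: a_def b_def field_simps)
  qed
  have "lie P Q ((lie P Q ^^ n) (\<lambda>z. u z * v z)) z = lie P Q (\<lambda>q. fact n * (\<Sum>k\<le>n. a k q * b (n - k) q)) z"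
    by (rule lie_cong[OF _ ev]) (intro diff2_cmult diff2_sum diff2_mult ab)
  also have "\<dots> = fact n * (\<Sum>k\<le>n. lie P Q (\<lambda>q. a k q * b (n - k) q) z)"
    by (subst lie_cmult, intro diff2_sum diff2_mult ab, subst lie_sum, intro diff2_mult ab, simp)
  also have "(\<Sum>k\<le>n. lie P Q (\<lambda>q. a k q * b (n - k) q) z) =
      (\<Sum>k\<le>n. real (Suc k) * (a (Suc k) z * b (n - k) z) + real (Suc (n - k)) * (a k z * b (Suc (n - k)) z))"
    by (intro sum.cong refl) (simp add: lie_mult[OF ab] Xa)
  also have "\<dots> = real (Suc n) * (\<Sum>k\<le>Suc n. a k z * b (Suc n - k) z)"
    by (rule lie_leibniz_sum[of "\<lambda>i j. a i z * b j z"])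
  finally have "(lie P Q ^^ Suc n) (\<lambda>z. u z * v z) z = fact (Suc n) * (\<Sum>k\<le>Suc n. a k z * b (Suc n - k) z)"
    by (simp add: fact_Suc mult_ac)
  then show ?case by (simp add: a_def b_def del: fact_Suc sum.atMost_Suc)
qed simp

text \<open>By \<open>lie_funpow_mult\<close> the series of the product is the Cauchy product of two
  absolutely convergent series.\<close>

lemma lie_exp_mult:
  assumes P: "analytic2_at P 0" and Q: "analytic2_at Q 0" and T: "analytic2_at T 0" "T 0 = 0"
    and u: "analytic2_at u 0" and v: "analytic2_at v 0"
  shows "\<forall>\<^sub>F z in nhds 0. lie_exp P Q T (\<lambda>z. u z * v z) z = lie_exp P Q T u z * lie_exp P Q T v z"
proof -
  have "\<forall>\<^sub>F z in nhds 0. analytic2_at P z \<and> analytic2_at Q z \<and> analytic2_at u z \<and> analytic2_at v z"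
    using assms(1,2,5,6) by (intro eventually_conj analytic2_eventually)
  then obtain W where W: "open W" "0 \<in> W"
    "\<forall>z\<in>W. analytic2_at P z \<and> analytic2_at Q z \<and> analytic2_at u z \<and> analytic2_at v z"
    unfolding eventually_nhds by (elim exE conjE)
  have "\<forall>\<^sub>F z in nhds 0. z \<in> W" using W by (intro eventually_nhds_in_open)
  then show ?thesis
    using lie_exp_analytic(2)[OF P Q T u] lie_exp_analytic(2)[OF P Q T v]
  proof eventually_elim
    case (elim z)
    have "lie_term P Q T (\<lambda>z. u z * v z) n z = (\<Sum>k\<le>n. lie_term P Q T u k z * lie_term P Q T v (n - k) z)" for n
    proof -
      have "lie_term P Q T (\<lambda>z. u z * v z) n z = T z ^ n * ((lie P Q ^^ n) (\<lambda>z. u z * v z) z / fact n)"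
        by (simp add: lie_term_def)
      also have "\<dots> = (\<Sum>k\<le>n. T z ^ n * ((lie P Q ^^ k) u z / fact k * ((lie P Q ^^ (n - k)) v z / fact (n - k))))"
        using lie_funpow_mult[OF W(1) _ _ _ _ elim(1), of P Q u v n] W(3) by (simp add: sum_distrib_left)
      also have "\<dots> = (\<Sum>k\<le>n. lie_term P Q T u k z * lie_term P Q T v (n - k) z)"
      proof (intro sum.cong refl)
        fix k assume "k \<in> {..n}"
        then have "T z ^ n = T z ^ k * T z ^ (n - k)" by (simp flip: power_add)
        then show "T z ^ n * ((lie P Q ^^ k) u z / fact k * ((lie P Q ^^ (n - k)) v z / fact (n - k)))
            = lie_term P Q T u k z * lie_term P Q T v (n - k) z" by (simp add: lie_term_def)
      qed
      finally show ?thesis .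
    qed
    then show ?case
      unfolding lie_exp_def using Cauchy_product[OF elim(2,3)] by simp
  qed
qed

lemma lie_exp_add:
  assumes P: "analytic2_at P 0" and Q: "analytic2_at Q 0" and T: "analytic2_at T 0" "T 0 = 0"
    and u: "analytic2_at u 0" and v: "analytic2_at v 0"
  shows "\<forall>\<^sub>F z in nhds 0. lie_exp P Q T (\<lambda>z. u z + v z) z = lie_exp P Q T u z + lie_exp P Q T v z"
proof -
  have "\<forall>\<^sub>F z in nhds 0. analytic2_at P z \<and> analytic2_at Q z \<and> analytic2_at u z \<and> analytic2_at v z"
    using assms(1,2,5,6) by (intro eventually_conj analytic2_eventually)
  then obtain W where W: "open W" "0 \<in> W"
    "\<forall>z\<in>W. analytic2_at P z \<and> analytic2_at Q z \<and> analytic2_at u z \<and> analytic2_at v z"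
    unfolding eventually_nhds by (elim exE conjE)
  have X: "(lie P Q ^^ n) (\<lambda>z. u z + v z) z = (lie P Q ^^ n) u z + (lie P Q ^^ n) v z" if "z \<in> W" for n z
    using that
  proof (induction n arbitrary: z)
    case (Suc n)
    have d: "diff2 ((lie P Q ^^ n) u) z" "diff2 ((lie P Q ^^ n) v) z"
      using analytic2_lie_funpow[THEN analytic2_diff2] W(3) Suc.prems by blast+
    have "\<forall>\<^sub>F q in nhds z. (lie P Q ^^ n) (\<lambda>z. u z + v z) q = (lie P Q ^^ n) u q + (lie P Q ^^ n) v q"
      using eventually_nhds_in_open[OF W(1) Suc.prems] by eventually_elim (rule Suc.IH)
    from lie_cong[OF diff2_add(1)[OF d] this] show ?case by (simp add: lie_add[OF d])
  qed simp
  have "\<forall>\<^sub>F z in nhds 0. z \<in> W" using W by (intro eventually_nhds_in_open)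
  then show ?thesis
    using lie_exp_analytic(2)[OF P Q T u] lie_exp_analytic(2)[OF P Q T v]
  proof eventually_elim
    case (elim z)
    have "lie_term P Q T (\<lambda>z. u z + v z) n z = lie_term P Q T u n z + lie_term P Q T v n z" for n
      by (simp add: lie_term_def X[OF elim(1)] algebra_simps)
    then show ?case
      unfolding lie_exp_def
      using suminf_add[OF elim(2,3)[THEN summable_norm_cancel]] by simp
  qed
qed

text \<open>Iterated derivatives at a point depend on the function near that point, so equality is
  propagated on an open neighbourhood.\<close>

lemma lie_exp_cong:
  assumes P: "analytic2_at P 0" and Q: "analytic2_at Q 0" and u: "analytic2_at u 0"
    and eq: "\<forall>\<^sub>F z in nhds 0. v z = u z"
  shows "\<forall>\<^sub>F z in nhds 0. lie_exp P Q T v z = lie_exp P Q T u z"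
proof -
  have "\<forall>\<^sub>F z in nhds 0. (analytic2_at P z \<and> analytic2_at Q z \<and> analytic2_at u z) \<and> v z = u z"
    using assms by (intro eventually_conj analytic2_eventually)
  then obtain W where W: "open W" "0 \<in> W"
    "\<forall>z\<in>W. (analytic2_at P z \<and> analytic2_at Q z \<and> analytic2_at u z) \<and> v z = u z"
    unfolding eventually_nhds by (elim exE conjE)
  have X: "(lie P Q ^^ n) v z = (lie P Q ^^ n) u z" if "z \<in> W" for n z
    using that
  proof (induction n arbitrary: z)
    case (Suc n)
    have d: "diff2 ((lie P Q ^^ n) u) z"
      using analytic2_lie_funpow[THEN analytic2_diff2] W(3) Suc.prems by blast
    have "\<forall>\<^sub>F q in nhds z. (lie P Q ^^ n) v q = (lie P Q ^^ n) u q"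
      using eventually_nhds_in_open[OF W(1) Suc.prems] by eventually_elim (rule Suc.IH)
    from lie_cong[OF d this] show ?case by simp
  qed (use W in simp)
  have "\<forall>\<^sub>F z in nhds 0. z \<in> W" using W by (intro eventually_nhds_in_open)
  then show ?thesis
    by eventually_elim (simp add: lie_exp_def lie_term_def X)
qed

text \<open>Only the zeroth term of the series survives. With u a function of H this says that the
  flow preserves the level sets.\<close>

lemma lie_exp_invariant:
  assumes "\<forall>\<^sub>F z in nhds 0. lie P Q u z = 0"
  shows "\<forall>\<^sub>F z in nhds 0. lie_exp P Q T u z = u z"
proof -
  obtain W where W: "open W" "0 \<in> W" "\<forall>z\<in>W. lie P Q u z = 0"
    using assms unfolding eventually_nhds by (elim exE conjE)
  have X: "(lie P Q ^^ Suc n) u z = 0" if "z \<in> W" for n z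
    using that
  proof (induction n arbitrary: z)
    case (Suc n)
    have "\<forall>\<^sub>F q in nhds z. (lie P Q ^^ Suc n) u q = 0"
      using eventually_nhds_in_open[OF W(1) Suc.prems] by eventually_elim (rule Suc.IH)
    from lie_cong[OF diff2_const(1) this] show ?case by (simp add: lie_const)
  qed (use W in simp)
  have "\<forall>\<^sub>F z in nhds 0. z \<in> W" using W by (intro eventually_nhds_in_open)
  then show ?thesis
  proof eventually_elim
    case (elim z)
    have "lie_term P Q T u n z = (if n = 0 then u z else 0)" for n
      using X[OF elim] by (cases n) (simp_all add: lie_term_def)
    then show ?case unfolding lie_exp_def
      using suminf_finite[of "{0}" "\<lambda>n. lie_term P Q T u n z"] by simp
  qed
qed

lemma lie_exp_at_zero: "T 0 = 0 \<Longrightarrow> lie_exp P Q T u 0 = (u 0 :: real)"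
proof -
  assume "T 0 = 0"
  then have "lie_term P Q T u n 0 = (if n = 0 then u 0 else 0)" for n
    by (cases n) (simp_all add: lie_term_def)
  then show ?thesis unfolding lie_exp_def
    using suminf_finite[of "{0}" "\<lambda>n. lie_term P Q T u n 0"] by simp
qed

subsection \<open>Existence of the normal form for germs\<close>

lemma cusp_nonzero_dense:
  assumes "open W" "(0 :: real \<times> real) \<in> W"
  shows "open {z\<in>W. cusp z \<noteq> 0}" "0 \<in> closure {z\<in>W. cusp z \<noteq> 0}"
proof -
  have "continuous_on W cusp" by (intro continuous_at_imp_continuous_on ballI analytic2_isCont analytic2_cusp)
  from continuous_open_preimage[OF this assms(1), of "- {0}"]
  show "open {z\<in>W. cusp z \<noteq> 0}" by (simp add: Int_def vimage_def open_Compl[OF closed_singleton])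
  show "0 \<in> closure {z\<in>W. cusp z \<noteq> 0}"
  proof (rule closure_approachable[THEN iffD2], intro allI impI)
    fix e :: real assume e: "e > 0"
    obtain d where d: "d > 0" "ball 0 d \<subseteq> W" using assms open_contains_ball by metis
    define x where "x = min d e / 2"
    have "x > 0" "x < d" "x < e" using d e by (auto simp: x_def)
    then have "(x, 0) \<in> {z\<in>W. cusp z \<noteq> 0}" "dist (x, 0) (0 :: real \<times> real) < e"
      using d(2) by (auto simp: cusp_eq norm_Pair subset_iff)
    then show "\<exists>y\<in>{z\<in>W. cusp z \<noteq> 0}. dist y 0 < e" by blast
  qed
qed

text \<open>The complement of the cusp is open and has 0 in its closure, so
  \<open>ps_zero_of_zero_on_open\<close> applies to the difference.\<close>

lemma eventually_eq_off_cusp: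
  assumes f: "analytic2_at f 0" and g: "analytic2_at g 0"
    and eq: "\<forall>\<^sub>F z in nhds 0. cusp z \<noteq> 0 \<longrightarrow> f z = g z"
  shows "\<forall>\<^sub>F z in nhds 0. f z = g z"
proof -
  obtain c where c: "ps c (\<lambda>z. f z - g z)" using ps_exists[OF analytic2_diff[OF f g]] by metis
  obtain W where W: "open W" "0 \<in> W" "\<forall>z\<in>W. cusp z \<noteq> 0 \<longrightarrow> f z = g z"
    using eq unfolding eventually_nhds by (elim exE conjE)
  have "c i j = 0" for i j
    by (rule ps_zero_of_zero_on_open[OF c cusp_nonzero_dense[OF W(1,2)]]) (use W(3) in simp)
  then have "c = (\<lambda>i j. 0)" by (simp add: fun_eq_iff)
  then have c: "ps (\<lambda>i j. 0) (\<lambda>z. f z - g z)" using c by simp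
  have "ps (\<lambda>i j. 0) (\<lambda>z. 0)" using ps_cmult[OF c, of 0] by simp
  from ps_eq[OF c this] show ?thesis by eventually_elim simp
qed

text \<open>Differentiating gives k'(H) dH = - 2 u du + 3 v^2 dv; the two equations arise by wedging
  with du and with dv.\<close>

lemma jac_cusp_compose:
  assumes d: "diff2 u p" "diff2 v p" and eq: "\<forall>\<^sub>F z in nhds p. cusp (u z, v z) = k (cusp z)"
    and k: "(k has_field_derivative k') (at (cusp p))"
  shows "k' * hbr u p = - 3 * v p ^ 2 * jac u v p" "k' * hbr v p = - 2 * u p * jac u v p"
proof -
  note 1 = diff2_comp2[OF cusp_diff2(1) d]
  note 2 = diff2_comp1[OF k cusp_diff2(1)]
  have e: "\<forall>\<^sub>F z in nhds p. k (cusp z) = cusp (u z, v z)" using eq by eventually_elim simp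
  from diff2_cong(2,3)[OF 1(1) e]
  have "k' * pdx cusp p = pdx (\<lambda>z. cusp (u z, v z)) p" "k' * pdy cusp p = pdy (\<lambda>z. cusp (u z, v z)) p"
    using 2(2,3) by simp_all
  then have x: "k' * (- 2 * fst p) = - 2 * u p * pdx u p + 3 * v p ^ 2 * pdx v p"
    and y: "k' * (3 * snd p ^ 2) = - 2 * u p * pdy u p + 3 * v p ^ 2 * pdy v p"
    using 1(2,3) by (simp_all add: cusp_diff2)
  have w: "k' * hbr w p = (k' * (- 2 * fst p)) * pdy w p - (k' * (3 * snd p ^ 2)) * pdx w p" for w
    by (simp add: hbr_def algebra_simps)
  show "k' * hbr u p = - 3 * v p ^ 2 * jac u v p" "k' * hbr v p = - 2 * u p * jac u v p"
    unfolding w[unfolded x y] by (simp_all add: jac_def algebra_simps)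
qed

lemma analytic1_exp: "analytic1_at exp (a :: real)"
  unfolding analytic1_at_iff_ext
  by (intro exI[of _ exp] exI[of _ UNIV]) (auto intro: holomorphic_intros simp: exp_of_real)

lemma analytic1_ln:
  assumes "a > 0"
  shows "analytic1_at ln (a :: real)"
  unfolding analytic1_at_iff_ext
proof (intro exI[of _ Ln] exI[of _ "{z. Re z > 0}"] conjI allI impI)
  show "open {z. Re z > 0}" by (rule open_halfspace_Re_gt)
  show "Ln holomorphic_on {z. Re z > 0}"
    by (rule holomorphic_on_Ln) (auto simp: complex_nonpos_Reals_iff)
qed (use assms in \<open>auto simp: Ln_of_real\<close>)

text \<open>The exponent is odd, so a negative value of \<mu> is handled by splitting off its sign
  \<sigma>, for which \<sigma>^5 = \<sigma>.\<close>

lemma analytic1_fifth_root: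
  assumes "analytic1_at \<mu> 0" "\<mu> 0 \<noteq> (0 :: real)"
  obtains \<kappa> where "analytic1_at \<kappa> 0" "\<kappa> 0 \<noteq> 0" "\<forall>\<^sub>F t in nhds 0. \<kappa> t ^ 5 = \<mu> t"
proof -
  define \<sigma> :: real where "\<sigma> = sgn (\<mu> 0)"
  have \<sigma>: "\<sigma> ^ 5 = \<sigma>" "\<sigma> * \<sigma> = 1" "\<sigma> * \<mu> 0 > 0" "\<sigma> \<noteq> 0"
    using assms(2) by (auto simp: \<sigma>_def sgn_if)
  define \<kappa> where "\<kappa> = (\<lambda>t. \<sigma> * exp (1 / 5 * ln (\<sigma> * \<mu> t)))"
  have "analytic1_at \<kappa> 0"
    unfolding \<kappa>_def using \<sigma>
    by (intro analytic1_mult analytic1_const assms(1) analytic1_compose[of exp, OF analytic1_exp]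
        analytic1_compose[of ln, OF analytic1_ln]) auto
  moreover have "\<kappa> 0 \<noteq> 0" using \<sigma> by (simp add: \<kappa>_def)
  moreover have "\<forall>\<^sub>F t in nhds 0. \<kappa> t ^ 5 = \<mu> t"
  proof -
    have "isCont (\<lambda>t. \<sigma> * \<mu> t) 0" by (intro continuous_intros analytic1_isCont assms(1))
    then have "((\<lambda>t. \<sigma> * \<mu> t) \<longlongrightarrow> \<sigma> * \<mu> 0) (nhds 0)"
      using tendsto_at_iff_tendsto_nhds[of "\<lambda>t. \<sigma> * \<mu> t" 0] by (simp only: isCont_def)
    from order_tendstoD(1)[OF this \<sigma>(3)] show ?thesis
    proof eventually_elim
      case (elim t)
      have "exp (1 / 5 * ln (\<sigma> * \<mu> t)) ^ 5 = exp (ln (\<sigma> * \<mu> t))"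
        by (simp flip: exp_of_nat_mult)
      then show ?case using elim \<sigma>(1,2) by (simp add: \<kappa>_def power_mult_distrib flip: mult.assoc)
    qed
  qed
  ultimately show ?thesis by (rule that)
qed

text \<open>
  For \<open>\<mu> = \<kappa>\<^sup>5\<close> the left-hand side is the Jacobian of the scaling \<open>(x, y) \<mapsto> (\<kappa>(H)\<^sup>3 x, \<kappa>(H)\<^sup>2 y)\<close>.
\<close>

lemma euler_ode_solvable:
  assumes "analytic1_at f 0"
  obtains \<mu> where "analytic1_at \<mu> 0" "\<mu> 0 = f 0" "\<forall>\<^sub>F t in nhds 0. 6 / 5 * t * deriv \<mu> t + \<mu> t = f t"
proof -
  obtain a where a: "ps (\<lambda>i j. if j = 0 then a i else 0) (\<lambda>z. f (fst z))" using ps_first_kind[OF assms] by metis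
  then obtain M R where R: "cbound (\<lambda>i j. if j = 0 then a i else 0) M R" "R > 0" using psD by metis
  \<comment> \<open>The operator multiplies t^i by (5 + 6 i) / 5. Dividing by this does not enlarge
    a coefficient, so the bound for a is inherited.\<close>
  define d where "d = (\<lambda>i j. if j = (0::nat) then 5 * a i / (5 + 6 * real i) else 0)"
  have "norm (d i j) \<le> M / R ^ (i + j)" for i j
  proof -
    have "norm (if j = 0 then a i else 0) \<le> M / R ^ (i + j)" using R(1) unfolding cbound_def by blast
    moreover have "norm (d i j) \<le> norm (if j = 0 then a i else 0)"
      by (simp add: d_def abs_mult divide_le_eq mult_le_cancel_left) (simp add: algebra_simps)
    ultimately show ?thesis by linarith
  qed
  then have "cbound d M R" using R(2) unfolding cbound_def by blast
  then have d: "ps d (\<lambda>z. psum d (fst z) (snd z))" unfolding ps_def by auto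
  define m where "m = (\<lambda>z. psum d (fst z) (snd z))"
  define \<mu> where "\<mu> = (\<lambda>t. m (t, 0))"
  have m: "ps d m" using d by (simp add: m_def)
  have an: "analytic1_at \<mu> 0"
    unfolding \<mu>_def using analytic1_slice[of m 0 0] ps_analytic2[OF m] by (simp add: zero_prod_def)
  have "ps (\<lambda>i j. 6 / 5 * (if i = 0 then 0 else real (Suc (i - 1)) * d (Suc (i - 1)) j) + d i j)
     (\<lambda>z. 6 / 5 * (fst z * pdx m z) + m z)"
    by (intro ps_add ps_cmult ps_mulx ps_pdx m)
  also have "(\<lambda>i j. 6 / 5 * (if i = 0 then 0 else real (Suc (i - 1)) * d (Suc (i - 1)) j) + d i j)
      = (\<lambda>i j. if j = 0 then a i else 0)"
  proof (intro ext)
    fix i j :: nat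
    have "5 + 6 * real i > 0" by simp
    then show "6 / 5 * (if i = 0 then 0 else real (Suc (i - 1)) * d (Suc (i - 1)) j) + d i j = (if j = 0 then a i else 0)"
      by (cases i) (simp_all add: d_def divide_simps, simp add: algebra_simps)
  qed
  finally have "\<forall>\<^sub>F z in nhds 0. 6 / 5 * (fst z * pdx m z) + m z = f (fst z)" by (rule ps_eq[OF _ a])
  then obtain r where r: "r > 0" "\<forall>x y. \<bar>x\<bar> < r \<and> \<bar>y\<bar> < r \<longrightarrow>
      6 / 5 * (fst (x, y) * pdx m (x, y)) + m (x, y) = f (fst (x, y))"
    unfolding eventually_nhds_zero_iff by (elim exE conjE)
  have p: "pdx m (t, 0) = deriv \<mu> t" for t by (simp add: pdx_def \<mu>_def)
  have eq: "6 / 5 * t * deriv \<mu> t + \<mu> t = f t" if "\<bar>t\<bar> < r" for t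
    using r(2)[rule_format, of t 0] that r(1) by (simp add: p) (simp add: \<mu>_def)
  have "\<forall>\<^sub>F t in nhds 0. 6 / 5 * t * deriv \<mu> t + \<mu> t = f t"
    unfolding eventually_nhds_metric using r(1) eq by (intro exI[of _ r]) simp
  moreover have "\<mu> 0 = f 0" using eq[of 0] r(1) by simp
  ultimately show ?thesis using that an by blast
qed

text \<open>The field X = {H, _} / \<rho> is, up to sign, the Hamiltonian field of H for the area
  density \<rho>. Its flow E for time T fixes functions of H, and E x, E y are the new coordinates
  u, v. From X (E w) = (1 + X T) E (X w) the pulled-back density is \<rho> (1 + X T) = \<rho> + {H,
  T}.\<close>

lemma cusp_preserving_normalisation:
  assumes f: "analytic1_at f0 0" "analytic1_at f1 0" "f0 0 \<noteq> 0" and T: "analytic2_at T 0" "T 0 = 0"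
  obtains u v where "analytic2_at u 0" "analytic2_at v 0" "u 0 = 0" "v 0 = 0"
    "\<forall>\<^sub>F z in nhds 0. cusp (u z, v z) = cusp z"
    "\<forall>\<^sub>F z in nhds 0. (f0 (cusp z) + f1 (cusp z) * v z) * jac u v z = f0 (cusp z) + f1 (cusp z) * snd z + hbr T z"
proof -
  define F0 where "F0 = (\<lambda>z. f0 (cusp z))"
  define F1 where "F1 = (\<lambda>z. f1 (cusp z))"
  define \<rho> where "\<rho> = (\<lambda>z. F0 z + F1 z * snd z)"
  have c0: "cusp 0 = 0" by (simp add: cusp_eq)
  have F: "analytic2_at F0 0" "analytic2_at F1 0"
    unfolding F0_def F1_def
    by (rule analytic2_compose1[OF _ analytic2_cusp]; simp add: c0 f)+
  have \<rho>: "analytic2_at \<rho> 0" unfolding \<rho>_def by (intro analytic2_add analytic2_mult F analytic2_snd)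
  have \<rho>0: "\<rho> 0 \<noteq> 0" using f(3) by (simp add: \<rho>_def F0_def c0)
  define P where "P = (\<lambda>z. - 3 * snd z ^ 2 / \<rho> z)"
  define Q where "Q = (\<lambda>z. - 2 * fst z / \<rho> z)"
  have P: "analytic2_at P 0" and Q: "analytic2_at Q 0" unfolding P_def Q_def
    by (intro analytic2_divide analytic2_mult analytic2_const analytic2_power analytic2_fst analytic2_snd \<rho> \<rho>0)+
  \<comment> \<open>This holds also where \<rho> is zero, since division by zero yields 0 on both
    sides.\<close>
  have lie: "lie P Q w z = hbr w z / \<rho> z" for w z
    by (simp add: lie_def P_def Q_def hbr_def add_divide_distrib diff_divide_distrib)
  define E where "E = lie_exp P Q T"
  note E_an = lie_exp_analytic[OF P Q T, folded E_def]
  note E_mult = lie_exp_mult[OF P Q T, folded E_def]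
  note E_add = lie_exp_add[OF P Q T, folded E_def]
  have E_inv: "\<forall>\<^sub>F z in nhds 0. E w z = w z" if "\<forall>\<^sub>F z in nhds 0. hbr w z = 0" for w
    unfolding E_def 
  proof (rule lie_exp_invariant)
    show "\<forall>\<^sub>F z in nhds 0. lie P Q w z = 0" using that by eventually_elim (simp add: lie)
  qed
  have E_const: "\<forall>\<^sub>F z in nhds 0. E (\<lambda>z. c) z = c" for c
    by (rule E_inv) (simp add: hbr_const)
  have E_H: "\<forall>\<^sub>F z in nhds 0. E (\<lambda>z. h (cusp z)) z = h (cusp z)" if "analytic1_at h 0" for h
  proof (rule E_inv)
    show "\<forall>\<^sub>F z in nhds 0. hbr (\<lambda>z. h (cusp z)) z = 0"
      using eventually_cusp[OF analytic1_eventually[OF that]]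
      by eventually_elim (rule hbr_comp_cusp(2)[OF analytic1_deriv(1)])
  qed
  define u where "u = E fst"
  define v where "v = E snd"
  have u: "analytic2_at u 0" and v: "analytic2_at v 0"
    unfolding u_def v_def by (rule E_an(1)[OF analytic2_fst], rule E_an(1)[OF analytic2_snd])
  have uv0: "u 0 = 0" "v 0 = 0" unfolding u_def v_def E_def by (simp_all add: lie_exp_at_zero[of T, OF T(2)])
  have sq: "analytic2_at (\<lambda>z. snd z * snd z :: real) 0" "analytic2_at (\<lambda>z. snd z * (snd z * snd z) :: real) 0"
    "analytic2_at (\<lambda>z. fst z * fst z :: real) 0" "analytic2_at (\<lambda>z. (- 1) * (fst z * fst z) :: real) 0"
    by (intro analytic2_mult analytic2_fst analytic2_snd analytic2_const)+
  have "\<forall>\<^sub>F z in nhds 0. E (\<lambda>z. snd z * (snd z * snd z) + (- 1) * (fst z * fst z)) z = cusp z"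
    using E_H[OF analytic1_id] by (simp add: cusp_eq power2_eq_square power3_eq_cube mult.assoc)
  then have cu: "\<forall>\<^sub>F z in nhds 0. cusp (u z, v z) = cusp z"
    using E_add[OF sq(2,4)] E_mult[OF analytic2_snd sq(1)] E_mult[OF analytic2_snd analytic2_snd]
      E_mult[OF analytic2_const sq(3), of "- 1"] E_const[of "- 1"] E_mult[OF analytic2_fst analytic2_fst]
    by eventually_elim (simp add: cusp_eq[of "(_, _)"] power2_eq_square power3_eq_cube u_def v_def)
  have E\<rho>: "\<forall>\<^sub>F z in nhds 0. E \<rho> z = F0 z + F1 z * v z"
    unfolding \<rho>_def
    using E_add[OF F(1) analytic2_mult[OF F(2) analytic2_snd]] E_mult[OF F(2) analytic2_snd]
      E_H[OF f(1)] E_H[OF f(2)]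
    by eventually_elim (simp add: F0_def F1_def v_def)
  have \<rho>ne: "\<forall>\<^sub>F z in nhds 0. \<rho> z \<noteq> 0"
  proof -
    have "(\<rho> \<longlongrightarrow> \<rho> 0) (nhds 0)"
      using analytic2_isCont[OF \<rho>] by (simp only: isCont_def tendsto_at_iff_tendsto_nhds)
    then show ?thesis using \<rho>0 by (rule tendsto_imp_eventually_ne)
  qed
  \<comment> \<open>The law for X (E w), multiplied by \<rho> and E \<rho> so that only brackets
    remain.\<close>
  have key: "\<forall>\<^sub>F z in nhds 0. E \<rho> z * hbr (E w) z = (\<rho> z + hbr T z) * E (hbr w) z" if w: "analytic2_at w 0" for w
  proof -
    have l: "analytic2_at (lie P Q w) 0" by (rule analytic2_lie[OF P Q w])
    have e: "\<forall>\<^sub>F z in nhds 0. hbr w z = \<rho> z * lie P Q w z"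
      using \<rho>ne by eventually_elim (simp add: lie)
    show ?thesis
      using E_an(3)[OF w] E_mult[OF \<rho> l] lie_exp_cong[OF P Q analytic2_mult[OF \<rho> l] e, of T, folded E_def] \<rho>ne
    proof eventually_elim
      case (elim z)
      have "hbr (E w) z = \<rho> z * lie P Q (E w) z" using elim(4) by (simp add: lie)
      also have "\<dots> = (\<rho> z + hbr T z) * E (lie P Q w) z"
        unfolding elim(1) using elim(4) by (simp add: lie[of T] field_simps)
      finally show ?case using elim(2,3) by simp
    qed
  qed
  have hb: "hbr fst = (\<lambda>z. (- 3) * (snd z * snd z))" "hbr snd = (\<lambda>z. (- 2) * fst z)"
    by (simp_all add: hbr_fst hbr_snd fun_eq_iff power2_eq_square)
  have "\<forall>\<^sub>F z in nhds 0. E \<rho> z * hbr u z = (\<rho> z + hbr T z) * (- 3 * v z ^ 2)"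
    using key[OF analytic2_fst] E_mult[OF analytic2_const sq(1), of "- 3"] E_const[of "- 3"] E_mult[OF analytic2_snd analytic2_snd]
    unfolding hb(1) u_def[symmetric] by eventually_elim (simp add: v_def power2_eq_square)
  moreover have "\<forall>\<^sub>F z in nhds 0. E \<rho> z * hbr v z = (\<rho> z + hbr T z) * (- 2 * u z)"
    using key[OF analytic2_snd] E_mult[OF analytic2_const analytic2_fst, of "- 2"] E_const[of "- 2"]
    unfolding hb(2) v_def[symmetric] by eventually_elim (simp add: u_def)
  \<comment> \<open>By \<open>jac_cusp_compose\<close> the two bracket equations are the desired
    equation multiplied by v^2 and by u. Off the cusp u and v are not both zero, and the rest
    follows from the identity theorem.\<close>
  ultimately have "\<forall>\<^sub>F z in nhds 0. cusp z \<noteq> 0 \<longrightarrow> (F0 z + F1 z * v z) * jac u v z = \<rho> z + hbr T z"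
    using E\<rho> cu eventually_nhds_nhds[OF cu] analytic2_eventually[OF u] analytic2_eventually[OF v]
  proof eventually_elim
    case (elim z)
    note d = elim(6,7)[THEN analytic2_diff2]
    have "hbr u z = - 3 * v z ^ 2 * jac u v z" "hbr v z = - 2 * u z * jac u v z"
      using jac_cusp_compose[OF d elim(5), of 1] by (simp_all add: DERIV_ident)
    with elim(1-3) have "v z ^ 2 * ((F0 z + F1 z * v z) * jac u v z - (\<rho> z + hbr T z)) = 0"
      "u z * ((F0 z + F1 z * v z) * jac u v z - (\<rho> z + hbr T z)) = 0"
      by (simp_all add: algebra_simps)
    moreover have "u z \<noteq> 0 \<or> v z \<noteq> 0" if "cusp z \<noteq> 0" using elim(4) that by (auto simp: cusp_eq)
    ultimately show ?case by (auto simp: cusp_eq[symmetric])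
  qed
  then have "\<forall>\<^sub>F z in nhds 0. (F0 z + F1 z * v z) * jac u v z = \<rho> z + hbr T z"
    by (rule eventually_eq_off_cusp[rotated 2])
       (intro analytic2_mult analytic2_add F v analytic2_jac u \<rho> analytic2_hbr T)+
  then show ?thesis using that[OF u v uv0 cu] by (simp add: \<rho>_def F0_def F1_def)
qed

text \<open>The terms with \<kappa>' combine by Euler's relation for the weights 3 and 2: 3 u {H, v}
  - 2 v {H, u} = 6 (v^3 - u^2) J with J = \<open>jac u v\<close>, and v^3 - u^2 = H.\<close>

lemma jac_scaling:
  assumes d: "diff2 u p" "diff2 v p" and eq: "\<forall>\<^sub>F z in nhds p. cusp (u z, v z) = cusp z"
    and l: "(\<kappa> has_field_derivative l) (at (cusp p))"
  shows "jac (\<lambda>z. u z * \<kappa> (cusp z) ^ 3) (\<lambda>z. v z * \<kappa> (cusp z) ^ 2) p =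
     (\<kappa> (cusp p) ^ 5 + 6 * cusp p * \<kappa> (cusp p) ^ 4 * l) * jac u v p"
proof -
  define L where "L = \<kappa> (cusp p)"
  have l3: "((\<lambda>t. \<kappa> t ^ 3) has_field_derivative 3 * L ^ 2 * l) (at (cusp p))"
    and l2: "((\<lambda>t. \<kappa> t ^ 2) has_field_derivative 2 * L * l) (at (cusp p))"
    unfolding L_def by (auto intro!: derivative_eq_intros l)
  note 3 = diff2_comp1[of "\<lambda>t. \<kappa> t ^ 3", OF l3 cusp_diff2(1)]
  note 2 = diff2_comp1[of "\<lambda>t. \<kappa> t ^ 2", OF l2 cusp_diff2(1)]
  have h: "hbr u p = - 3 * v p ^ 2 * jac u v p" "hbr v p = - 2 * u p * jac u v p"
    using jac_cusp_compose[OF d eq, of 1] by (simp_all add: DERIV_ident)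
  have c: "cusp p = v p ^ 3 - u p ^ 2" using eventually_nhds_x_imp_x[OF eq] by (simp add: cusp_eq[of "(_, _)"])
  have "jac (\<lambda>z. u z * \<kappa> (cusp z) ^ 3) (\<lambda>z. v z * \<kappa> (cusp z) ^ 2) p
     = L ^ 5 * jac u v p + (3 * L ^ 4 * l * u p * (pdx cusp p * pdy v p - pdy cusp p * pdx v p)
       - 2 * L ^ 4 * l * v p * (pdx cusp p * pdy u p - pdy cusp p * pdx u p))"
    unfolding jac_def diff2_mult[OF d(1) 3(1)] diff2_mult[OF d(2) 2(1)] 3(2,3) 2(2,3) L_def[symmetric]
    by (simp add: power2_eq_square power3_eq_cube eval_nat_numeral algebra_simps)
  also have "\<dots> = L ^ 5 * jac u v p + (3 * L ^ 4 * l * u p * hbr v p - 2 * L ^ 4 * l * v p * hbr u p)"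
    by (simp add: hbr_eq_jac jac_def)
  also have "\<dots> = (L ^ 5 + 6 * cusp p * L ^ 4 * l) * jac u v p"
    unfolding h c by (simp add: power2_eq_square power3_eq_cube algebra_simps)
  finally show ?thesis by (simp add: L_def)
qed

text \<open>After \<open>cusp_preserving_normalisation\<close> the density is f0(H) + f1(H) y. The
  scaling is chosen so that its Jacobian equals f0(H), and the factor f0 is divided out of
  f1.\<close>

lemma cusp_area_normal_form:
  assumes a: "analytic2_at a 0" and a0: "a 0 \<noteq> 0"
  obtains u v k f where "analytic2_at u 0" "analytic2_at v 0" "u 0 = 0" "v 0 = 0"
    "analytic1_at k 0" "k 0 = 0" "deriv k 0 \<noteq> 0" "analytic1_at f 0"
    "\<forall>\<^sub>F z in nhds 0. cusp (u z, v z) = k (cusp z)"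
    "\<forall>\<^sub>F z in nhds 0. (1 + f (cusp (u z, v z)) * v z) * jac u v z = a z"
proof -
  obtain f0 f1 T where f: "analytic1_at f0 0" "analytic1_at f1 0" and T: "analytic2_at T 0" "T 0 = 0"
    and dec: "\<forall>\<^sub>F z in nhds 0. a z = f0 (cusp z) + f1 (cusp z) * snd z + hbr T z"
    by (rule brieskorn_decomposition[OF a])
  \<comment> \<open>Every bracket with H vanishes at 0 because dH does, so f0 0 = a 0.\<close>
  have f00: "f0 0 \<noteq> 0" using eventually_nhds_x_imp_x[OF dec] a0 by (simp add: cusp_eq hbr_def)
  obtain u0 v0 where uv: "analytic2_at u0 0" "analytic2_at v0 0" "u0 0 = 0" "v0 0 = 0"
    "\<forall>\<^sub>F z in nhds 0. cusp (u0 z, v0 z) = cusp z"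
    "\<forall>\<^sub>F z in nhds 0. (f0 (cusp z) + f1 (cusp z) * v0 z) * jac u0 v0 z = f0 (cusp z) + f1 (cusp z) * snd z + hbr T z"
    by (rule cusp_preserving_normalisation[OF f f00 T])
  obtain \<mu> where \<mu>: "analytic1_at \<mu> 0" "\<mu> 0 = f0 0" "\<forall>\<^sub>F t in nhds 0. 6 / 5 * t * deriv \<mu> t + \<mu> t = f0 t"
    by (rule euler_ode_solvable[OF f(1)])
  have \<mu>0: "\<mu> 0 \<noteq> 0" using \<mu>(2) f00 by simp
  obtain \<kappa> where \<kappa>: "analytic1_at \<kappa> 0" "\<kappa> 0 \<noteq> 0" "\<forall>\<^sub>F t in nhds 0. \<kappa> t ^ 5 = \<mu> t"
    by (rule analytic1_fifth_root[OF \<mu>(1) \<mu>0])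
  \<comment> \<open>Substituting \<mu> = \<kappa>^5 turns the equation for \<mu> into the statement
    that the factor in \<open>jac_scaling\<close> is f0.\<close>
  have \<kappa>ode: "\<forall>\<^sub>F t in nhds 0. \<kappa> t ^ 5 + 6 * t * \<kappa> t ^ 4 * deriv \<kappa> t = f0 t"
    using eventually_nhds_nhds[OF \<kappa>(3)] \<mu>(3) analytic1_eventually[OF \<kappa>(1)] analytic1_eventually[OF \<mu>(1)]
  proof eventually_elim
    case (elim t)
    have "((\<lambda>t. \<kappa> t ^ 5) has_field_derivative 5 * \<kappa> t ^ 4 * deriv \<kappa> t) (at t)"
      by (auto intro!: derivative_eq_intros analytic1_deriv(1)[OF elim(3)])
    moreover have "((\<lambda>t. \<kappa> t ^ 5) has_field_derivative deriv \<mu> t) (at t)"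
      using DERIV_cong_ev[OF refl elim(1) refl, of "deriv \<mu> t"] analytic1_deriv(1)[OF elim(4)] by simp
    ultimately have "deriv \<mu> t = 5 * \<kappa> t ^ 4 * deriv \<kappa> t" by (metis DERIV_unique)
    then show ?case using elim(2) eventually_nhds_x_imp_x[OF elim(1)] by (simp add: algebra_simps)
  qed
  \<comment> \<open>The scaling with weights 3 and 2 multiplies H by \<kappa>^6.\<close>
  define k where "k = (\<lambda>t. t * \<kappa> t ^ 6)"
  have k: "analytic1_at k 0" "k 0 = 0" unfolding k_def by (intro analytic1_mult analytic1_id analytic1_power \<kappa>(1)) simp
  have "(k has_field_derivative \<kappa> 0 ^ 6) (at 0)"
    unfolding k_def by (auto intro!: derivative_eq_intros analytic1_deriv(1)[OF \<kappa>(1)])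
  then have k': "deriv k 0 \<noteq> 0" using \<kappa>(2) by (simp add: DERIV_imp_deriv)
  obtain m where m: "analytic1_at m 0" "m 0 = 0" "deriv m 0 \<noteq> 0"
    "\<forall>\<^sub>F t in nhds 0. m (k t) = t" "\<forall>\<^sub>F t in nhds 0. k (m t) = t"
    by (rule analytic1_inverse_function[OF k k'])
  \<comment> \<open>Since v = v0 \<kappa>^2, the identity (1 + f(k(H)) v) f0 = f0 + f1 v0 asks for
    f(k(t)) = q t; hence q is composed with the inverse m of k.\<close>
  define q where "q = (\<lambda>t. f1 t / (\<kappa> t ^ 2 * f0 t))"
  define f where "f = (\<lambda>t. q (m t))"
  have q: "analytic1_at q 0" unfolding q_def
    using \<kappa> f f00 by (intro analytic1_divide analytic1_mult analytic1_power) auto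
  have fan: "analytic1_at f 0" unfolding f_def by (rule analytic1_compose[of q m 0]) (simp_all add: q m)
  define u where "u = (\<lambda>z. u0 z * \<kappa> (cusp z) ^ 3)"
  define v where "v = (\<lambda>z. v0 z * \<kappa> (cusp z) ^ 2)"
  have \<kappa>c: "analytic2_at (\<lambda>z. \<kappa> (cusp z)) 0"
    by (rule analytic2_compose1[OF _ analytic2_cusp]) (simp add: cusp_eq \<kappa>(1))
  have uv_an: "analytic2_at u 0" "analytic2_at v 0"
    unfolding u_def v_def by (intro analytic2_mult uv analytic2_power \<kappa>c)+
  have uv00: "u 0 = 0" "v 0 = 0" using uv by (simp_all add: u_def v_def)
  have cu: "\<forall>\<^sub>F z in nhds 0. cusp (u z, v z) = k (cusp z)"
    using uv(5)
  proof eventually_elim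
    case (elim z)
    have "cusp (u z, v z) = cusp (u0 z, v0 z) * \<kappa> (cusp z) ^ 6"
      by (simp add: cusp_eq[of "(_, _)"] u_def v_def power_mult_distrib left_diff_distrib flip: power_mult)
    then show ?case using elim by (simp add: k_def)
  qed
  have ne: "\<forall>\<^sub>F t in nhds 0. \<kappa> t ^ 2 * f0 t \<noteq> 0"
  proof -
    have an: "analytic1_at (\<lambda>t. \<kappa> t ^ 2 * f0 t) 0" by (intro analytic1_mult analytic1_power \<kappa> f)
    have "((\<lambda>t. \<kappa> t ^ 2 * f0 t) \<longlongrightarrow> \<kappa> 0 ^ 2 * f0 0) (nhds 0)"
      using analytic1_isCont[OF an] tendsto_at_iff_tendsto_nhds[of "\<lambda>t. \<kappa> t ^ 2 * f0 t" 0] by (simp only: isCont_def)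
    then show ?thesis by (rule tendsto_imp_eventually_ne) (use \<kappa> f00 in simp)
  qed
  have "\<forall>\<^sub>F z in nhds 0. (1 + f (cusp (u z, v z)) * v z) * jac u v z = a z"
    using cu dec uv(6) eventually_cusp[OF \<kappa>ode] eventually_cusp[OF m(4)] eventually_cusp[OF ne]
      eventually_nhds_nhds[OF uv(5)] analytic2_eventually[OF uv(1)] analytic2_eventually[OF uv(2)]
      eventually_cusp[OF analytic1_eventually[OF \<kappa>(1)]]
  proof eventually_elim
    case (elim z)
    have J: "jac u v z = f0 (cusp z) * jac u0 v0 z"
      unfolding u_def v_def
      using jac_scaling[OF elim(8,9)[THEN analytic2_diff2] elim(7) analytic1_deriv(1)[OF elim(10)]] elim(4) by simp
    have "f (cusp (u z, v z)) = q (cusp z)" unfolding elim(1) f_def elim(5) ..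
    then have "(1 + f (cusp (u z, v z)) * v z) * f0 (cusp z) = f0 (cusp z) + f1 (cusp z) * v0 z"
      using elim(6) by (simp add: q_def v_def field_simps)
    then have "(1 + f (cusp (u z, v z)) * v z) * jac u v z = (f0 (cusp z) + f1 (cusp z) * v0 z) * jac u0 v0 z"
      unfolding J by (simp add: mult.assoc[symmetric])
    then show ?case using elim(2,3) by simp
  qed
  then show ?thesis using that[OF uv_an uv00 k k' fan cu] by blast
qed

subsection \<open>Uniqueness of the normal form for germs\<close>

text \<open>The factor t cancels on a punctured neighbourhood, and continuity gives the value at 0.
  This is how leading coefficients are compared below.\<close>

lemma cancel_at_zero:
  fixes f g :: "real \<Rightarrow> real"
  assumes "isCont f 0" "isCont g 0" "\<forall>\<^sub>F t in nhds 0. t * f t = t * g t"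
  shows "f 0 = g 0"
proof -
  have "\<forall>\<^sub>F t in at 0. f t = g t"
    using assms(3) unfolding eventually_at_filter by eventually_elim auto
  moreover have "(f \<longlongrightarrow> f 0) (at 0)" "(g \<longlongrightarrow> g 0) (at 0)" using assms(1,2) by (simp_all add: isCont_def)
  ultimately have "(g \<longlongrightarrow> f 0) (at 0)" by (metis (mono_tags) tendsto_cong)
  then show ?thesis using \<open>(g \<longlongrightarrow> g 0) (at 0)\<close> tendsto_unique trivial_limit_at by blast
qed

lemma deriv_cong_ev:
  assumes "\<forall>\<^sub>F t in nhds a. f t = (g t :: real)"
  shows "deriv f a = deriv g a"
  unfolding deriv_def using DERIV_cong_ev[OF refl assms refl] by simp

lemma power_series_shift:
  fixes p :: "real \<Rightarrow> real"
  assumes r: "r > 0" and c: "\<And>t. \<bar>t\<bar> < r \<Longrightarrow> (\<lambda>m. c m * t ^ m) sums p t" and z: "\<And>i. i < n \<Longrightarrow> c i = 0"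
  obtains q where "analytic1_at q 0" "q 0 = c n" "\<forall>\<^sub>F t in nhds 0. p t = t ^ n * q t"
proof -
  define q where "q = (\<lambda>t. if t = 0 then c n else p t / t ^ n)"
  have s: "(\<lambda>m. c (m + n) * t ^ m) sums q t" if t: "\<bar>t\<bar> < r" for t
  proof (cases "t = 0")
    case True
    then show ?thesis using powser_sums_zero[of "\<lambda>m. c (m + n)"] by (simp add: q_def)
  next
    case False
    have "(\<lambda>m. c (m + n) * t ^ (m + n)) sums p t"
      using c[OF t] z by (subst sums_zero_iff_shift) auto
    from sums_divide[OF this, of "t ^ n"] show ?thesis using False by (simp add: q_def power_add)
  qed
  have "analytic1_at q 0"
    unfolding analytic1_at_def using r s by (intro exI[of _ "\<lambda>m. c (m + n)"] exI[of _ r]) simp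
  moreover have "q 0 = c n" by (simp add: q_def)
  moreover have "p t = t ^ n * q t" if "\<bar>t\<bar> < r" for t
  proof (cases "t = 0")
    case True
    have "p 0 = c 0" using c[of 0] r powser_sums_zero[of c] sums_unique2 by fastforce
    then show ?thesis using True z by (cases n) (auto simp: q_def)
  qed (simp add: q_def)
  then have "\<forall>\<^sub>F t in nhds 0. p t = t ^ n * q t"
    unfolding eventually_nhds_metric using r by (intro exI[of _ r]) simp
  ultimately show ?thesis by (rule that)
qed

lemma analytic1_factor:
  assumes "analytic1_at p 0"
  obtains "\<forall>\<^sub>F t in nhds 0. p t = 0"
    | n q where "analytic1_at q 0" "q 0 \<noteq> 0" "\<forall>\<^sub>F t in nhds 0. p t = t ^ n * q t"
proof -
  obtain c r where r: "r > 0" and c0: "\<forall>t. \<bar>t - 0\<bar> < r \<longrightarrow> (\<lambda>n. c n * (t - 0) ^ n) sums p t"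
    using assms unfolding analytic1_at_def by (elim exE conjE)
  have c: "(\<lambda>n. c n * t ^ n) sums p t" if "\<bar>t\<bar> < r" for t using c0 that by simp
  show ?thesis
  proof (cases "\<forall>n. c n = 0")
    case True
    have "p t = 0" if "\<bar>t\<bar> < r" for t using c[OF that] True sums_unique2[OF sums_zero] by auto
    then have "\<forall>\<^sub>F t in nhds 0. p t = 0"
      unfolding eventually_nhds_metric using r by (intro exI[of _ r]) simp
    then show ?thesis by (rule that(1))
  next
    case False
    define n where "n = (LEAST n. c n \<noteq> 0)"
    have n: "c n \<noteq> 0" "\<And>i. i < n \<Longrightarrow> c i = 0"
    proof -
      have ex: "\<exists>n. c n \<noteq> 0" using False by simp
      show "c n \<noteq> 0" unfolding n_def by (rule LeastI_ex[OF ex])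
      show "c i = 0" if "i < n" for i using not_less_Least[of i "\<lambda>n. c n \<noteq> 0"] that unfolding n_def by blast
    qed
    obtain q where "analytic1_at q 0" "q 0 = c n" "\<forall>\<^sub>F t in nhds 0. p t = t ^ n * q t"
      by (rule power_series_shift[OF r c n(2)])
    then show ?thesis using that(2) n(1) by auto
  qed
qed

lemma analytic1_divide_by_id:
  assumes "analytic1_at p 0" "p 0 = 0"
  obtains q where "analytic1_at q 0" "q 0 = deriv p 0" "\<forall>\<^sub>F t in nhds 0. p t = t * q t"
proof -
  obtain c r where r: "r > 0" and c0: "\<forall>t. \<bar>t - 0\<bar> < r \<longrightarrow> (\<lambda>n. c n * (t - 0) ^ n) sums p t"
    using assms unfolding analytic1_at_def by (elim exE conjE)
  have c: "(\<lambda>n. c n * t ^ n) sums p t" if "\<bar>t\<bar> < r" for t using c0 that by simp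
  have "c 0 = p 0" using c[of 0] r powser_sums_zero[of c] sums_unique2 by fastforce
  then have z: "c i = 0" if "i < 1" for i using that assms(2) by simp
  obtain q where q: "analytic1_at q 0" "q 0 = c 1" "\<forall>\<^sub>F t in nhds 0. p t = t ^ 1 * q t"
    by (rule power_series_shift[OF r c z])
  have "((\<lambda>t. t ^ 1 * q t) has_field_derivative q 0) (at 0)"
    by (auto intro!: derivative_eq_intros analytic1_deriv(1)[OF q(1)])
  then have "(p has_field_derivative q 0) (at 0)"
    using DERIV_cong_ev[OF refl q(3) refl, of "q 0"] by simp
  then show ?thesis using that[OF q(1)] q(3) by (simp add: DERIV_imp_deriv)
qed

text \<open>If r = t^n q with q 0 \<noteq> 0, comparing the coefficients of t^n gives \<alpha> =
  \<beta> + n, as \<kappa> 0 = 1. A resonance at n = 0 is tolerated when r 0 = 0, because then q 0 =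
  0; this admits \<alpha> = \<beta> = 0, the case that yields constancy.\<close>

lemma resonance_free_ode:
  assumes r: "analytic1_at r 0" and \<kappa>: "analytic1_at \<kappa> 0" "\<kappa> 0 = 1"
    and ode: "\<forall>\<^sub>F t in nhds 0. \<alpha> * r t = \<kappa> t * (t * deriv r t + \<beta> * r t)"
    and nr: "\<And>n. \<alpha> = \<beta> + real n \<Longrightarrow> n = 0 \<and> r 0 = 0"
  shows "\<forall>\<^sub>F t in nhds 0. r t = 0"
  using r
proof (cases rule: analytic1_factor)
  case 1
  then show ?thesis .
next
  case (2 n q)
  define F where "F = (\<lambda>t. \<alpha> * q t)"
  define G where "G = (\<lambda>t. \<kappa> t * (real n * q t + t * deriv q t + \<beta> * q t))"
  \<comment> \<open>Both sides carry an additional factor t, which makes t = 0 trivial and lets t^n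
    be cancelled elsewhere.\<close>
  have "\<forall>\<^sub>F t in nhds 0. t * F t = t * G t"
    using ode eventually_nhds_nhds[OF 2(3)] analytic1_eventually[OF 2(1)]
  proof eventually_elim
    case (elim t)
    show ?case
    proof (cases "t = 0")
      case False
      have "((\<lambda>t. t ^ n * q t) has_field_derivative (real n * t ^ (n - 1) * q t + t ^ n * deriv q t)) (at t)"
        by (auto intro!: derivative_eq_intros analytic1_deriv(1)[OF elim(3)])
      then have "deriv r t = real n * t ^ (n - 1) * q t + t ^ n * deriv q t"
        unfolding deriv_cong_ev[OF elim(2)] by (rule DERIV_imp_deriv)
      moreover have "real n * (t * t ^ (n - 1)) = real n * t ^ n" by (cases n) simp_all
      ultimately have "t * deriv r t = t ^ n * (real n * q t + t * deriv q t)"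
        by (simp add: distrib_left) (metis mult.assoc mult.left_commute)
      then have "t ^ n * F t = t ^ n * G t"
        using elim(1) eventually_nhds_x_imp_x[OF elim(2)] by (simp add: F_def G_def algebra_simps)
      then show ?thesis using False by simp
    qed simp
  qed
  then have "F 0 = G 0"
  proof (rule cancel_at_zero[rotated 2])
    show "isCont F 0" unfolding F_def by (intro analytic1_isCont analytic1_mult analytic1_const 2(1))
    show "isCont G 0" unfolding G_def
      by (intro analytic1_isCont analytic1_mult analytic1_add analytic1_const analytic1_id analytic1_deriv(2) 2(1) \<kappa>(1))
  qed
  then have "(\<alpha> - (\<beta> + real n)) * q 0 = 0" using \<kappa>(2) by (simp add: F_def G_def algebra_simps)
  then have "\<alpha> = \<beta> + real n" using 2(2) by simp
  then have "n = 0" "r 0 = 0" using nr by auto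
  then have "q 0 = 0" using eventually_nhds_x_imp_x[OF 2(3)] by simp
  then show ?thesis using 2(2) by simp
qed

text \<open>The partial derivatives - 2 x and 3 y^2 of H are coprime, so x divides A. In other
  words, a 1-form whose wedge product with dH is zero is a multiple of dH.\<close>

lemma cusp_de_rham_division:
  assumes A: "analytic2_at A 0" and B: "analytic2_at B 0"
    and eq: "\<forall>\<^sub>F z in nhds 0. - 2 * fst z * B z = 3 * snd z ^ 2 * A z"
  obtains g where "analytic2_at g 0" "\<forall>\<^sub>F z in nhds 0. A z = - 2 * fst z * g z" "\<forall>\<^sub>F z in nhds 0. B z = 3 * snd z ^ 2 * g z"
proof -
  obtain a where a: "ps a A" using ps_exists[OF A] by metis
  obtain b where b: "ps b B" using ps_exists[OF B] by metis
  have 1: "ps (\<lambda>i j. - 2 * (if i = 0 then 0 else b (i - 1) j)) (\<lambda>z. - 2 * (fst z * B z))"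
    by (intro ps_cmult ps_mulx b)
  have 2: "ps (\<lambda>i j. 3 * (if j = 0 then 0 else if j - 1 = 0 then 0 else a i (j - 1 - 1))) (\<lambda>z. 3 * (snd z * (snd z * A z)))"
    by (intro ps_cmult ps_muly a)
  have "\<forall>\<^sub>F z in nhds 0. - 2 * (fst z * B z) = 3 * (snd z * (snd z * A z))"
    using eq by eventually_elim (simp add: power2_eq_square mult.assoc)
  from fun_cong[OF fun_cong[OF ps_unique[OF 1 2 this]]]
  have c: "- 2 * (if i = 0 then 0 else b (i - 1) j) = 3 * (if j = 0 then 0 else if j - 1 = 0 then 0 else a i (j - 1 - 1))" for i j .
  \<comment> \<open>The left side of the relation has no term free of x, hence A has none, and its
    coefficients can be shifted to divide by x.\<close>
  have a0: "a 0 j = 0" for j using c[of 0 "Suc (Suc j)"] by simp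
  obtain M R where R: "cbound a M R" "R > 0" using psD[OF a] by metis
  define d where "d = (\<lambda>i j. a (Suc i) j)"
  have "norm (d i j) \<le> M / R / R ^ (i + j)" for i j
  proof -
    have "norm (a (Suc i) j) \<le> M / R ^ (Suc i + j)" using R(1) unfolding cbound_def by blast
    then show ?thesis by (simp add: d_def)
  qed
  then have "cbound d (M / R) R" using R(2) unfolding cbound_def by blast
  then have "ps d (\<lambda>z. psum d (fst z) (snd z))" unfolding ps_def by auto
  then obtain h where h: "ps d h" by metis
  define g where "g = (\<lambda>z. - 1 / 2 * h z)"
  have g: "ps (\<lambda>i j. - 1 / 2 * d i j) g" unfolding g_def by (intro ps_cmult h)
  have "ps (\<lambda>i j. - 2 * (if i = 0 then 0 else - 1 / 2 * d (i - 1) j)) (\<lambda>z. - 2 * (fst z * g z))"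
    by (intro ps_cmult ps_mulx g)
  also have "(\<lambda>i j. - 2 * (if i = 0 then 0 else - 1 / 2 * d (i - 1) j)) = a"
    by (auto simp: fun_eq_iff d_def a0)
  finally have "\<forall>\<^sub>F z in nhds 0. A z = - 2 * (fst z * g z)" by (rule ps_eq[OF a])
  moreover have "ps (\<lambda>i j. 3 * (if j = 0 then 0 else if j - 1 = 0 then 0 else - 1 / 2 * d i (j - 1 - 1))) (\<lambda>z. 3 * (snd z * (snd z * g z)))"
    by (intro ps_cmult ps_muly g)
  moreover have "(\<lambda>i j. 3 * (if j = 0 then 0 else if j - 1 = 0 then 0 else - 1 / 2 * d i (j - 1 - 1))) = b"
  proof (intro ext)
    fix i j
    show "3 * (if j = 0 then 0 else if j - 1 = 0 then 0 else - 1 / 2 * d i (j - 1 - 1)) = b i j"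
      using c[of "Suc i" j] by (auto simp: d_def split: if_splits)
  qed
  ultimately have "\<forall>\<^sub>F z in nhds 0. A z = - 2 * (fst z * g z)" "\<forall>\<^sub>F z in nhds 0. B z = 3 * (snd z * (snd z * g z))"
    using ps_eq[OF b] by simp_all
  then show ?thesis using that[OF ps_analytic2[OF g]] by (simp add: power2_eq_square mult.assoc)
qed

lemma pdx_sum: "(\<And>n. n \<in> A \<Longrightarrow> diff2 (F n) p) \<Longrightarrow> pdx (\<lambda>z. \<Sum>n\<in>A. F n z) p = (\<Sum>n\<in>A. pdx (F n) p)"
  using lie_sum[of A F p "\<lambda>_. 1" "\<lambda>_. 0"] by (simp add: lie_def)

lemma pdy_sum: "(\<And>n. n \<in> A \<Longrightarrow> diff2 (F n) p) \<Longrightarrow> pdy (\<lambda>z. \<Sum>n\<in>A. F n z) p = (\<Sum>n\<in>A. pdy (F n) p)"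
  using lie_sum[of A F p "\<lambda>_. 0" "\<lambda>_. 1"] by (simp add: lie_def)

text \<open>
  If the 1-form \<open>\<Sum>i. f i d(g i)\<close> vanishes along the level sets of \<open>H\<close>, then it is a multiple
  \<open>- \<gamma> dH\<close> of \<open>dH\<close>, and its differential is a bracket with \<open>H\<close>.
\<close>

lemma cusp_closed_form_exact:
  fixes n :: nat
  assumes f: "\<And>i. i < n \<Longrightarrow> analytic2_at (f i) 0" and g: "\<And>i. i < n \<Longrightarrow> analytic2_at (g i) 0"
    and eq: "\<forall>\<^sub>F z in nhds 0. (\<Sum>i<n. f i z * hbr (g i) z) = 0"
  obtains \<gamma> where "analytic2_at \<gamma> 0" "\<forall>\<^sub>F z in nhds 0. (\<Sum>i<n. jac (f i) (g i) z) = hbr \<gamma> z"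
proof -
  define A where "A = (\<lambda>z. \<Sum>i<n. f i z * pdx (g i) z)"
  define B where "B = (\<lambda>z. \<Sum>i<n. f i z * pdy (g i) z)"
  have sum_an: "analytic2_at (\<lambda>z. \<Sum>i<m. h i z) 0" if "\<And>i. i < m \<Longrightarrow> analytic2_at (h i) 0"
    for h :: "nat \<Rightarrow> real \<times> real \<Rightarrow> real" and m
    using that by (induction m) (simp_all add: analytic2_const analytic2_add)
  have "analytic2_at A 0" unfolding A_def
    by (rule sum_an[of n "\<lambda>i z. f i z * pdx (g i) z"]) (intro analytic2_mult f g analytic2_pdx)
  moreover have "analytic2_at B 0" unfolding B_def
    by (rule sum_an[of n "\<lambda>i z. f i z * pdy (g i) z"]) (intro analytic2_mult f g analytic2_pdy)
  ultimately have AB: "analytic2_at A 0" "analytic2_at B 0" .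
  have "\<forall>\<^sub>F z in nhds 0. - 2 * fst z * B z = 3 * snd z ^ 2 * A z"
    using eq
  proof eventually_elim
    case (elim z)
    have "(\<Sum>i<n. f i z * hbr (g i) z) = - 2 * fst z * B z - 3 * snd z ^ 2 * A z"
      unfolding A_def B_def sum_distrib_left sum_subtractf[symmetric]
      by (intro sum.cong refl) (simp add: hbr_def algebra_simps)
    then show ?case using elim by simp
  qed
  then obtain h where h: "analytic2_at h 0" "\<forall>\<^sub>F z in nhds 0. A z = - 2 * fst z * h z"
    "\<forall>\<^sub>F z in nhds 0. B z = 3 * snd z ^ 2 * h z"
    by (rule cusp_de_rham_division[OF AB])
  have "\<forall>\<^sub>F z in nhds 0. \<forall>i\<in>{..<n}. pdx (pdy (g i)) z = pdy (pdx (g i)) z"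
    by (intro eventually_ball_finite ballI pdx_pdy_commute g) auto
  moreover have "\<forall>\<^sub>F z in nhds 0. \<forall>i\<in>{..<n}. analytic2_at (f i) z"
    by (intro eventually_ball_finite ballI analytic2_eventually f) auto
  moreover have "\<forall>\<^sub>F z in nhds 0. \<forall>i\<in>{..<n}. analytic2_at (g i) z"
    by (intro eventually_ball_finite ballI analytic2_eventually g) auto
  ultimately have "\<forall>\<^sub>F z in nhds 0. (\<Sum>i<n. jac (f i) (g i) z) = hbr (\<lambda>z. - 1 * h z) z"
    using eventually_nhds_nhds[OF h(2)] eventually_nhds_nhds[OF h(3)] analytic2_eventually[OF h(1)]
  proof eventually_elim
    case (elim z)
    have d: "diff2 (f i) z" "diff2 (pdx (g i)) z" "diff2 (pdy (g i)) z" if "i < n" for i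
      using elim(2,3) that by (auto intro: analytic2_diff2 analytic2_pdx analytic2_pdy)
    have "pdx B z = (\<Sum>i<n. pdx (\<lambda>z. f i z * pdy (g i) z) z)" "pdy A z = (\<Sum>i<n. pdy (\<lambda>z. f i z * pdx (g i) z) z)"
      unfolding A_def B_def by (intro pdx_sum pdy_sum diff2_mult d; simp)+
    then have "pdx B z - pdy A z = (\<Sum>i<n. pdx (\<lambda>z. f i z * pdy (g i) z) z - pdy (\<lambda>z. f i z * pdx (g i) z) z)"
      by (simp add: sum_subtractf)
    \<comment> \<open>The second derivatives of g i cancel because the mixed ones are equal.\<close>
    also have "\<dots> = (\<Sum>i<n. jac (f i) (g i) z)"
      using elim(1) by (intro sum.cong refl) (simp add: diff2_mult d jac_def)
    finally have l: "(\<Sum>i<n. jac (f i) (g i) z) = pdx B z - pdy A z" by simp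
    note hd = analytic2_diff2[OF elim(6)]
    have s2: "diff2 (\<lambda>z. 3 * snd z ^ 2) z" "pdx (\<lambda>z. 3 * snd z ^ 2) z = 0"
      using diff2_cmult[OF diff2_mult(1)[OF diff2_snd(1) diff2_snd(1)], of 3 z] diff2_mult(2)[OF diff2_snd(1) diff2_snd(1), of z]
      by (simp_all add: power2_eq_square diff2_snd mult.assoc)
    have s1: "diff2 (\<lambda>z. - 2 * fst z) z" "pdy (\<lambda>z. - 2 * fst z) z = 0"
      using diff2_cmult[OF diff2_fst(1), of "- 2" z] by (simp_all add: diff2_fst)
    have "pdx B z = pdx (\<lambda>z. 3 * snd z ^ 2 * h z) z"
      by (rule diff2_cong(2)[OF diff2_mult(1)[OF s2(1) hd] elim(5)])
    also have "\<dots> = 3 * snd z ^ 2 * pdx h z" by (simp add: diff2_mult[OF s2(1) hd] s2(2))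
    finally have b: "pdx B z = 3 * snd z ^ 2 * pdx h z" .
    have "pdy A z = pdy (\<lambda>z. - 2 * fst z * h z) z"
      by (rule diff2_cong(3)[OF diff2_mult(1)[OF s1(1) hd] elim(4)])
    also have "\<dots> = - 2 * fst z * pdy h z" unfolding diff2_mult(3)[OF s1(1) hd] s1(2) by simp
    finally show ?case unfolding l b hbr_cmult[OF hd] by (simp add: hbr_def)
  qed
  moreover have "analytic2_at (\<lambda>z. - 1 * h z) 0" by (intro analytic2_mult analytic2_const h)
  ultimately show ?thesis by (intro that)
qed

text \<open>Write k' for the derivative of k at 0. On the x-axis the terms of order 2 of v^3 - u^2 =
  k(H) give u_x^2 = k'. On the y-axis the terms of order 2 give u_y = 0 and those of order 3 give
  v_y^3 = k'. With u_x v_y = 1 this yields v_y^5 = 1.\<close>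

lemma cusp_symmetry_linear_part:
  assumes u: "analytic2_at u 0" "u 0 = 0" and v: "analytic2_at v 0" "v 0 = 0"
    and k: "analytic1_at k 0" "k 0 = 0"
    and eq: "\<forall>\<^sub>F z in nhds 0. cusp (u z, v z) = k (cusp z)" and J: "jac u v 0 = 1"
  shows "deriv k 0 = 1" "pdy v 0 = 1"
proof -
  obtain r where r: "r > 0" "\<forall>x y. \<bar>x\<bar> < r \<and> \<bar>y\<bar> < r \<longrightarrow> cusp (u (x, y), v (x, y)) = k (cusp (x, y))"
    using eq unfolding eventually_nhds_zero_iff by (elim exE conjE)
  have e: "v (x, y) ^ 3 - u (x, y) ^ 2 = k (y ^ 3 - x ^ 2)" if "\<bar>x\<bar> < r" "\<bar>y\<bar> < r" for x y
    using r(2)[rule_format, of x y] that by (simp add: cusp_eq)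
  have sm: "\<forall>\<^sub>F t in nhds (0::real). \<bar>t\<bar> < r"
    unfolding eventually_nhds_metric using r(1) by (intro exI[of _ r]) simp
  obtain k1 where k1: "analytic1_at k1 0" "k1 0 = deriv k 0" "\<forall>\<^sub>F t in nhds 0. k t = t * k1 t"
    by (rule analytic1_divide_by_id[OF k])
  have sx: "analytic1_at (\<lambda>t. w (t, 0)) 0" and sy: "analytic1_at (\<lambda>t. w (0, t)) 0" if "analytic2_at w 0" for w
    using that analytic1_slice[of w 0 0] analytic1_slice[OF analytic2_compose[of w snd "(0, 0)" fst]] analytic2_fst analytic2_snd
    by (auto simp: zero_prod_def)
  have z: "u (0, 0) = 0" "v (0, 0) = 0" using u v by (simp_all add: zero_prod_def)
  obtain ux where ux: "analytic1_at ux 0" "ux 0 = deriv (\<lambda>t. u (t, 0)) 0" "\<forall>\<^sub>F t in nhds 0. u (t, 0) = t * ux t"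
    by (rule analytic1_divide_by_id[OF sx[OF u(1)] z(1)])
  obtain vx where vx: "analytic1_at vx 0" "vx 0 = deriv (\<lambda>t. v (t, 0)) 0" "\<forall>\<^sub>F t in nhds 0. v (t, 0) = t * vx t"
    by (rule analytic1_divide_by_id[OF sx[OF v(1)] z(2)])
  obtain uy where uy: "analytic1_at uy 0" "uy 0 = deriv (\<lambda>t. u (0, t)) 0" "\<forall>\<^sub>F t in nhds 0. u (0, t) = t * uy t"
    by (rule analytic1_divide_by_id[OF sy[OF u(1)] z(1)])
  obtain vy where vy: "analytic1_at vy 0" "vy 0 = deriv (\<lambda>t. v (0, t)) 0" "\<forall>\<^sub>F t in nhds 0. v (0, t) = t * vy t"
    by (rule analytic1_divide_by_id[OF sy[OF v(1)] z(2)])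
  have pd: "pdx u 0 = ux 0" "pdx v 0 = vx 0" "pdy u 0 = uy 0" "pdy v 0 = vy 0"
    by (simp_all add: pdx_def pdy_def ux vx uy vy)
  have c0: "isCont w 0" if "analytic1_at w 0" for w using analytic1_isCont[OF that] .
  have kx: "\<forall>\<^sub>F t in nhds 0. k (- (t ^ 2)) = - (t ^ 2) * k1 (- (t ^ 2))"
  proof -
    have "((\<lambda>t::real. - (t ^ 2)) \<longlongrightarrow> - (0 ^ 2)) (nhds 0)" by (intro tendsto_intros filterlim_ident)
    then have "filterlim (\<lambda>t::real. - (t ^ 2)) (nhds 0) (nhds 0)" by simp
    from eventually_compose_filterlim[OF k1(3) this] show ?thesis .
  qed
  have ky: "\<forall>\<^sub>F t in nhds 0. k (t ^ 3) = t ^ 3 * k1 (t ^ 3)"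
  proof -
    have "((\<lambda>t::real. t ^ 3) \<longlongrightarrow> 0 ^ 3) (nhds 0)" by (intro tendsto_intros filterlim_ident)
    then have "filterlim (\<lambda>t::real. t ^ 3) (nhds 0) (nhds 0)" by simp
    from eventually_compose_filterlim[OF k1(3) this] show ?thesis .
  qed
  have k1x: "analytic1_at (\<lambda>t. k1 (- (t ^ 2))) 0"
  proof -
    have "analytic1_at (\<lambda>t. 0 - t ^ 2 :: real) 0" by (intro analytic1_diff analytic1_const analytic1_power analytic1_id)
    then show ?thesis using analytic1_compose[of k1 "\<lambda>t. - (t ^ 2)" 0] k1(1) by simp
  qed
  have k1y: "analytic1_at (\<lambda>t. k1 (t ^ 3)) 0"
    using analytic1_compose[of k1 "\<lambda>t. t ^ 3" 0] k1(1) analytic1_power[OF analytic1_id] by simp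
  have "(\<lambda>t. t * vx t ^ 3 - ux t ^ 2) 0 = (\<lambda>t. - k1 (- (t ^ 2))) 0"
  proof (rule cancel_at_zero)
    show "isCont (\<lambda>t. t * vx t ^ 3 - ux t ^ 2) 0" by (intro continuous_intros c0 ux vx)
    show "isCont (\<lambda>t. - k1 (- (t ^ 2))) 0" by (intro continuous_minus c0 k1x)
    show "\<forall>\<^sub>F t in nhds 0. t * (t * vx t ^ 3 - ux t ^ 2) = t * - k1 (- (t ^ 2))"
      using sm kx ux(3) vx(3)
    proof eventually_elim
      case (elim t)
      have "t ^ 3 * vx t ^ 3 - (t ^ 2) * ux t ^ 2 = - (t ^ 2) * k1 (- (t ^ 2))"
        using e[of t 0] elim r(1) by (simp add: power_mult_distrib)
      then have "t * (t * (t * vx t ^ 3 - ux t ^ 2)) = t * (t * - k1 (- (t ^ 2)))"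
        by (simp add: power2_eq_square power3_eq_cube algebra_simps)
      then show ?case by (metis mult_cancel_left mult_zero_left)
    qed
  qed
  then have \<alpha>: "ux 0 ^ 2 = deriv k 0" by (simp add: k1(2))
  have "(\<lambda>t. uy t ^ 2) 0 = (\<lambda>t. t * (vy t ^ 3 - k1 (t ^ 3))) 0"
  proof (rule cancel_at_zero)
    show "isCont (\<lambda>t. uy t ^ 2) 0" by (intro continuous_intros c0 uy)
    show "isCont (\<lambda>t. t * (vy t ^ 3 - k1 (t ^ 3))) 0" by (intro continuous_intros c0 vy k1y)
    show "\<forall>\<^sub>F t in nhds 0. t * uy t ^ 2 = t * (t * (vy t ^ 3 - k1 (t ^ 3)))"
      using sm ky uy(3) vy(3)
    proof eventually_elim
      case (elim t)
      have "t ^ 3 * vy t ^ 3 - (t ^ 2) * uy t ^ 2 = t ^ 3 * k1 (t ^ 3)"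
        using e[of 0 t] elim r(1) by (simp add: power_mult_distrib)
      then have "t * (t * uy t ^ 2) = t * (t * (t * (vy t ^ 3 - k1 (t ^ 3))))"
        by (simp add: power2_eq_square power3_eq_cube algebra_simps)
      then show ?case by (cases "t = 0") simp_all
    qed
  qed
  then have \<beta>: "uy 0 = 0" by simp
  \<comment> \<open>As u_y = 0, u is of order t^2 on the y-axis, so u^2 starts at order 4 and does
    not disturb the comparison at order 3.\<close>
  obtain u2 where u2: "analytic1_at u2 0" "u2 0 = deriv uy 0" "\<forall>\<^sub>F t in nhds 0. uy t = t * u2 t"
    by (rule analytic1_divide_by_id[OF uy(1) \<beta>])
  have "(\<lambda>t. vy t ^ 3 - t * u2 t ^ 2) 0 = (\<lambda>t. k1 (t ^ 3)) 0"
  proof (rule cancel_at_zero)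
    show "isCont (\<lambda>t. vy t ^ 3 - t * u2 t ^ 2) 0" by (intro continuous_intros c0 vy u2)
    show "isCont (\<lambda>t. k1 (t ^ 3)) 0" by (intro c0 k1y)
    show "\<forall>\<^sub>F t in nhds 0. t * (vy t ^ 3 - t * u2 t ^ 2) = t * k1 (t ^ 3)"
      using sm ky uy(3) vy(3) u2(3)
    proof eventually_elim
      case (elim t)
      have "t ^ 3 * vy t ^ 3 - (t ^ 2) * (t * u2 t) ^ 2 = t ^ 3 * k1 (t ^ 3)"
        using e[of 0 t] elim r(1) by (simp add: power_mult_distrib)
      then have "t ^ 2 * (t * (vy t ^ 3 - t * u2 t ^ 2)) = t ^ 2 * (t * k1 (t ^ 3))"
        by (simp add: power2_eq_square power3_eq_cube algebra_simps)
      then show ?case by (cases "t = 0") simp_all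
    qed
  qed
  then have \<delta>: "vy 0 ^ 3 = deriv k 0" by (simp add: k1(2))
  have \<alpha>\<delta>: "ux 0 * vy 0 = 1" using J by (simp add: jac_def pd \<beta>)
  then have "ux 0 ^ 2 * vy 0 ^ 2 = 1" by (simp flip: power_mult_distrib)
  then have "vy 0 ^ 3 * vy 0 ^ 2 = 1" using \<alpha> \<delta> by simp
  then have "vy 0 ^ 5 = 1 ^ 5" by (simp flip: power_add)
  moreover have "0 \<le> vy 0"
  proof -
    have "0 \<le> vy 0 ^ 3" unfolding \<delta> \<alpha>[symmetric] by simp
    then show ?thesis using zero_le_odd_power[of 3 "vy 0"] by simp
  qed
  ultimately have "vy 0 = 1" by (rule power_eq_imp_eq_base) simp_all
  then show "pdy v 0 = 1" "deriv k 0 = 1" using \<delta> pd by simp_all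
qed

text \<open>
  Applied with \<open>V = v\<^sup>\<sigma>\<close> for \<open>\<sigma> = 0\<close> and \<open>\<sigma> = 1\<close>. The form \<open>v\<^sup>\<sigma> (u dv / 2 - v du / 3)\<close> is the pullback
  of a form \<open>\<beta>\<close> with \<open>dH \<and> \<beta> = H y\<^sup>\<sigma> dx \<and> dy\<close> and \<open>d\<beta> = (5 + 2 \<sigma>) / 6 y\<^sup>\<sigma> dx \<and> dy\<close>; the equations
  compare it with the corresponding form for the decomposition of \<open>v\<^sup>\<sigma> jac u v\<close>.
\<close>

lemma gauss_manin_equations:
  assumes u: "analytic2_at u 0" and v: "analytic2_at v 0"
    and k: "analytic1_at k 0" "deriv k 0 \<noteq> 0"
    and k1: "analytic1_at k1 0" "\<forall>\<^sub>F t in nhds 0. k t = t * k1 t"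
    and eq: "\<forall>\<^sub>F z in nhds 0. cusp (u z, v z) = k (cusp z)"
    and V: "analytic2_at V 0" and Vv: "\<forall>\<^sub>F z in nhds 0. jac V v z = 0 \<and> v z * jac u V z = \<sigma> * V z * jac u v z"
    and p: "analytic1_at p0 0" "analytic1_at p1 0" and \<eta>: "analytic2_at \<eta> 0"
    and dec: "\<forall>\<^sub>F z in nhds 0. V z * jac u v z = p0 (cusp z) + p1 (cusp z) * snd z + hbr \<eta> z"
  defines "\<kappa> \<equiv> \<lambda>t. k1 t / deriv k t"
  shows "\<forall>\<^sub>F t in nhds 0. (5 + 2 * \<sigma>) / 6 * p0 t = t * deriv (\<lambda>t. \<kappa> t * p0 t) t + 5 / 6 * (\<kappa> t * p0 t)"
    and "\<forall>\<^sub>F t in nhds 0. (5 + 2 * \<sigma>) / 6 * p1 t = t * deriv (\<lambda>t. \<kappa> t * p1 t) t + 7 / 6 * (\<kappa> t * p1 t)"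
proof -
  \<comment> \<open>\<kappa> is k / (t k'): the pulled-back function k(H) and the factor k'(H) from
    \<open>jac_cusp_compose\<close> enter only through this quotient. The two conditions on V
    express dV \<and> dv = 0 and v dV = \<sigma> V dv.\<close>
  have \<kappa>: "analytic1_at \<kappa> 0" unfolding \<kappa>_def by (intro analytic1_divide k1 analytic1_deriv k)
  define r0 where "r0 = (\<lambda>t. \<kappa> t * p0 t)"
  define r1 where "r1 = (\<lambda>t. \<kappa> t * p1 t)"
  have r: "analytic1_at r0 0" "analytic1_at r1 0" unfolding r0_def r1_def by (intro analytic1_mult \<kappa> p)+
  define \<tau> where "\<tau> = (\<lambda>t. t * \<kappa> t)"
  have \<tau>: "analytic1_at \<tau> 0" unfolding \<tau>_def by (intro analytic1_mult \<kappa> analytic1_id)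
  have pull: "analytic2_at (\<lambda>z. h (cusp z)) 0" if "analytic1_at h 0" for h
    by (rule analytic2_compose1[OF _ analytic2_cusp]) (simp add: cusp_eq that)
  define R where "R = (\<lambda>z. r0 (cusp z) + r1 (cusp z) * snd z)"
  have R: "analytic2_at R 0" unfolding R_def by (intro analytic2_add analytic2_mult pull r analytic2_snd)
  \<comment> \<open>With G below this encodes the 1-form V (u dv / 2 - v du / 3) - R (x dy / 2 - y
    dx / 3) - \<tau>(H) d\<eta> as a sum of five terms f dg.\<close>
  define F where "F = (\<lambda>i::nat. if i = 0 then (\<lambda>z. 1 / 2 * (V z * u z)) else if i = 1 then (\<lambda>z. - 1 / 3 * (V z * v z))
      else if i = 2 then (\<lambda>z. - 1 / 2 * (R z * fst z)) else if i = 3 then (\<lambda>z. 1 / 3 * (R z * snd z)) else (\<lambda>z. - 1 * \<tau> (cusp z)))"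
  define G where "G = (\<lambda>i::nat. if i = 0 then v else if i = 1 then u else if i = 2 then snd else if i = 3 then fst else \<eta>)"
  have sum5: "(\<Sum>i<5. s i) = s 0 + s 1 + s 2 + s 3 + s 4" for s :: "nat \<Rightarrow> real"
    by (simp add: eval_nat_numeral)
  have FG: "analytic2_at (F i) 0" "analytic2_at (G i) 0" for i
  proof -
    have "analytic2_at (\<lambda>z. 1 / 2 * (V z * u z)) 0" "analytic2_at (\<lambda>z. - 1 / 3 * (V z * v z)) 0"
      "analytic2_at (\<lambda>z. - 1 / 2 * (R z * fst z)) 0" "analytic2_at (\<lambda>z. 1 / 3 * (R z * snd z)) 0"
      "analytic2_at (\<lambda>z. - 1 * \<tau> (cusp z)) 0"
      by (intro analytic2_mult V R u v pull[OF \<tau>] analytic2_const analytic2_fst analytic2_snd)+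
    then show "analytic2_at (F i) 0" unfolding F_def by (simp only: simp_thms split: if_split)
    show "analytic2_at (G i) 0" unfolding G_def using u v \<eta> analytic2_fst analytic2_snd
      by (simp only: simp_thms split: if_split)
  qed
  have evd: "\<forall>\<^sub>F z in nhds 0. diff2 u z \<and> diff2 v z \<and> diff2 V z \<and> diff2 R z \<and> diff2 \<eta> z"
    using analytic2_eventually[OF u] analytic2_eventually[OF v] analytic2_eventually[OF V] analytic2_eventually[OF R]
      analytic2_eventually[OF \<eta>] by eventually_elim (simp add: analytic2_diff2)
  have kne: "\<forall>\<^sub>F t in nhds 0. deriv k t \<noteq> 0"
  proof -
    have "(deriv k \<longlongrightarrow> deriv k 0) (nhds 0)"
      using analytic1_isCont[OF analytic1_deriv(2)[OF k(1)]] by (simp only: isCont_def tendsto_at_iff_tendsto_nhds)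
    then show ?thesis using k(2) by (rule tendsto_imp_eventually_ne)
  qed
  \<comment> \<open>Wedging dH with the three parts gives H \<kappa> V J, - H R and - H \<kappa> {H,
    \<eta>}, where J = \<open>jac u v\<close>. Their sum is zero by the decomposition of V J, as R =
    \<kappa> (p0 + p1 y).\<close>
  have zero: "\<forall>\<^sub>F z in nhds 0. (\<Sum>i<5. F i z * hbr (G i) z) = 0"
    using evd eventually_nhds_nhds[OF eq] eventually_cusp[OF kne] eventually_cusp[OF k1(2)]
      eventually_cusp[OF analytic1_eventually[OF k(1)]] dec
  proof eventually_elim
    case (elim z)
    define K where "K = deriv k (cusp z)"
    have K: "K \<noteq> 0" using elim(3) by (simp add: K_def)
    have 1: "K * hbr u z = - 3 * v z ^ 2 * jac u v z" "K * hbr v z = - 2 * u z * jac u v z"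
      using jac_cusp_compose[OF _ _ elim(2) analytic1_deriv(1)[OF elim(5)]] elim(1) by (simp_all add: K_def)
    have 2: "v z ^ 3 - u z ^ 2 = cusp z * (\<kappa> (cusp z) * K)"
      using eventually_nhds_x_imp_x[OF elim(2)] elim(4) K by (simp add: cusp_eq[of "(_, _)"] \<kappa>_def K_def)
    have "K * (1 / 2 * (V z * u z) * hbr v z + - 1 / 3 * (V z * v z) * hbr u z)
       = 1 / 2 * (V z * u z) * (K * hbr v z) - 1 / 3 * (V z * v z) * (K * hbr u z)" by (simp add: algebra_simps)
    also have "\<dots> = (v z ^ 3 - u z ^ 2) * (V z * jac u v z)"
      unfolding 1 by (simp add: power2_eq_square power3_eq_cube algebra_simps)
    also have "\<dots> = K * (cusp z * \<kappa> (cusp z) * (V z * jac u v z))" unfolding 2 by simp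
    finally have 3: "1 / 2 * (V z * u z) * hbr v z + - 1 / 3 * (V z * v z) * hbr u z = cusp z * \<kappa> (cusp z) * (V z * jac u v z)"
      using K by simp
    have 4: "- 1 / 2 * (R z * fst z) * hbr snd z + 1 / 3 * (R z * snd z) * hbr fst z = - cusp z * R z"
      by (simp add: hbr_fst hbr_snd cusp_eq power2_eq_square power3_eq_cube algebra_simps)
    have 5: "R z = \<kappa> (cusp z) * (p0 (cusp z) + p1 (cusp z) * snd z)"
      by (simp add: R_def r0_def r1_def algebra_simps)
    have "(\<Sum>i<5. F i z * hbr (G i) z) = (1 / 2 * (V z * u z) * hbr v z + - 1 / 3 * (V z * v z) * hbr u z)
       + (- 1 / 2 * (R z * fst z) * hbr snd z + 1 / 3 * (R z * snd z) * hbr fst z) + - 1 * \<tau> (cusp z) * hbr \<eta> z"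
      unfolding sum5 by (simp add: F_def G_def)
    also have "\<dots> = 0" unfolding 3 4 unfolding 5 elim(6) \<tau>_def by (simp add: algebra_simps)
    finally show ?case .
  qed
  obtain \<gamma> where \<gamma>: "analytic2_at \<gamma> 0" "\<forall>\<^sub>F z in nhds 0. (\<Sum>i<5. jac (F i) (G i) z) = hbr \<gamma> z"
    by (rule cusp_closed_form_exact[OF FG zero])
  \<comment> \<open>In the differential of the first part du \<and> dv occurs with 1/2 from u dv and
    with (1 + \<sigma>) / 3 from v du, which adds up to c.\<close>
  define c where "c = (5 + 2 * \<sigma>) / 6"
  \<comment> \<open>All brackets are collected into one. A factor depending on H alone may be moved
    inside a bracket with H.\<close>
  define \<theta> where "\<theta> = (\<lambda>z. \<gamma> z + (deriv \<tau> (cusp z) * \<eta> z - c * \<eta> z))"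
  have \<tau>': "analytic2_at (\<lambda>z. deriv \<tau> (cusp z)) 0" by (rule pull[OF analytic1_deriv(2)[OF \<tau>]])
  have \<theta>: "analytic2_at \<theta> 0" unfolding \<theta>_def
    by (intro analytic2_add analytic2_diff analytic2_mult analytic2_const \<gamma>(1) \<eta> \<tau>')
  define e0 where "e0 = (\<lambda>t. c * p0 t - (t * deriv r0 t + 5 / 6 * r0 t))"
  \<comment> \<open>The exponent 7/6 is 5/6 + 1/3: the weighted Euler derivative of the factor y
    adds its weight.\<close>
  define e1 where "e1 = (\<lambda>t. c * p1 t - (t * deriv r1 t + 7 / 6 * r1 t))"
  have e: "analytic1_at e0 0" "analytic1_at e1 0" unfolding e0_def e1_def
    by (intro analytic1_diff analytic1_add analytic1_mult analytic1_const analytic1_id p r analytic1_deriv(2))+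
  have "\<forall>\<^sub>F z in nhds 0. e0 (cusp z) + e1 (cusp z) * snd z = hbr \<theta> z"
    using \<gamma>(2) evd dec Vv analytic2_eventually[OF \<gamma>(1)] eventually_cusp[OF analytic1_eventually[OF \<tau>]]
      eventually_cusp[OF analytic1_eventually[OF r(1)]] eventually_cusp[OF analytic1_eventually[OF r(2)]]
      eventually_cusp[OF analytic1_eventually[OF analytic1_deriv(2)[OF \<tau>]]]
  proof eventually_elim
    case (elim z)
    have d: "diff2 u z" "diff2 v z" "diff2 V z" "diff2 R z" "diff2 \<eta> z" using elim(2) by auto
    note dm = diff2_mult(1)[OF d(3) d(1)] diff2_mult(1)[OF d(3) d(2)] diff2_mult(1)[OF d(4) diff2_fst(1)] diff2_mult(1)[OF d(4) diff2_snd(1)]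
    note ds = diff2_comp1[OF analytic1_deriv(1)[OF elim(6)] cusp_diff2(1)]
    note dr0 = diff2_comp1[OF analytic1_deriv(1)[OF elim(7)] cusp_diff2(1)]
    note dr1 = diff2_comp1[OF analytic1_deriv(1)[OF elim(8)] cusp_diff2(1)]
    note dt = hbr_comp_cusp[OF analytic1_deriv(1)[OF elim(9)]]
    have j0: "jac (\<lambda>z. 1 / 2 * (V z * u z)) v z = 1 / 2 * (V z * jac u v z)"
    proof -
      have "jac (\<lambda>z. 1 / 2 * (V z * u z)) v z = 1 / 2 * (V z * jac u v z) + 1 / 2 * u z * jac V v z"
        unfolding jac_def diff2_cmult(2,3)[OF dm(1)] diff2_mult(2,3)[OF d(3) d(1)] by (simp add: algebra_simps)
      then show ?thesis using elim(4) by simp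
    qed
    have j1: "jac (\<lambda>z. - 1 / 3 * (V z * v z)) u z = (1 + \<sigma>) / 3 * (V z * jac u v z)"
    proof -
      have "jac (\<lambda>z. - 1 / 3 * (V z * v z)) u z = 1 / 3 * (V z * jac u v z) + 1 / 3 * (v z * jac u V z)"
        unfolding jac_def diff2_cmult(2,3)[OF dm(2)] diff2_mult(2,3)[OF d(3) d(2)] by (simp add: algebra_simps)
      also have "v z * jac u V z = \<sigma> * V z * jac u v z" using elim(4) by simp
      finally show ?thesis by (simp add: algebra_simps)
    qed
    have Rx: "pdx R z = (deriv r0 (cusp z) + deriv r1 (cusp z) * snd z) * (- 2 * fst z)"
      and Ry: "pdy R z = (deriv r0 (cusp z) + deriv r1 (cusp z) * snd z) * (3 * snd z ^ 2) + r1 (cusp z)"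
      unfolding R_def diff2_add(2,3)[OF dr0(1) diff2_mult(1)[OF dr1(1) diff2_snd(1)]]
        diff2_mult(2,3)[OF dr1(1) diff2_snd(1)] dr0(2,3) dr1(2,3) cusp_diff2(2,3) diff2_snd(2,3)
      by (simp_all add: algebra_simps)
    have j2: "jac (\<lambda>z. - 1 / 2 * (R z * fst z)) snd z = - 1 / 2 * (pdx R z * fst z + R z)"
      unfolding jac_def diff2_cmult(2,3)[OF dm(3)] diff2_mult(2,3)[OF d(4) diff2_fst(1)] by (simp add: diff2_fst diff2_snd)
    have j3: "jac (\<lambda>z. 1 / 3 * (R z * snd z)) fst z = - 1 / 3 * (pdy R z * snd z + R z)"
      unfolding jac_def diff2_cmult(2,3)[OF dm(4)] diff2_mult(2,3)[OF d(4) diff2_snd(1)] by (simp add: diff2_fst diff2_snd)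
    have j4: "jac (\<lambda>z. - 1 * \<tau> (cusp z)) \<eta> z = - deriv \<tau> (cusp z) * hbr \<eta> z"
      unfolding jac_def[of "\<lambda>z. - 1 * \<tau> (cusp z)"] diff2_cmult(2,3)[OF ds(1)] ds(2,3)
      by (simp add: hbr_eq_jac jac_def algebra_simps)
    have "(\<Sum>i<5. jac (F i) (G i) z) = jac (\<lambda>z. 1 / 2 * (V z * u z)) v z + jac (\<lambda>z. - 1 / 3 * (V z * v z)) u z
        + jac (\<lambda>z. - 1 / 2 * (R z * fst z)) snd z + jac (\<lambda>z. 1 / 3 * (R z * snd z)) fst z + jac (\<lambda>z. - 1 * \<tau> (cusp z)) \<eta> z"
      unfolding sum5 by (simp add: F_def G_def)
    also have "\<dots> = c * (V z * jac u v z) - (5 / 6 * R z + (1 / 2 * pdx R z * fst z + 1 / 3 * pdy R z * snd z))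
        - deriv \<tau> (cusp z) * hbr \<eta> z"
      unfolding j0 j1 j2 j3 j4 by (simp add: c_def algebra_simps add_divide_distrib)
    also have "1 / 2 * pdx R z * fst z + 1 / 3 * pdy R z * snd z =
        cusp z * (deriv r0 (cusp z) + deriv r1 (cusp z) * snd z) + 1 / 3 * r1 (cusp z) * snd z"
      unfolding Rx Ry by (simp add: cusp_eq power2_eq_square power3_eq_cube algebra_simps)
    finally have S: "hbr \<gamma> z = c * (p0 (cusp z) + p1 (cusp z) * snd z + hbr \<eta> z) - (5 / 6 * R z +
        (cusp z * (deriv r0 (cusp z) + deriv r1 (cusp z) * snd z) + 1 / 3 * r1 (cusp z) * snd z)) - deriv \<tau> (cusp z) * hbr \<eta> z"
      unfolding elim(1) elim(3) .
    have "hbr \<theta> z = hbr \<gamma> z + (deriv \<tau> (cusp z) * hbr \<eta> z - c * hbr \<eta> z)"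
    proof -
      have a: "diff2 \<gamma> z" by (rule analytic2_diff2[OF elim(5)])
      have b: "diff2 (\<lambda>z. deriv \<tau> (cusp z) * \<eta> z) z" "diff2 (\<lambda>z. c * \<eta> z) z"
        by (rule diff2_mult(1)[OF dt(1) d(5)], rule diff2_cmult(1)[OF d(5)])
      show ?thesis
        unfolding \<theta>_def hbr_add[OF a diff2_diff(1)[OF b]] hbr_diff[OF b] hbr_cmult[OF d(5)] hbr_mult[OF dt(1) d(5)] dt(2)
        by simp
    qed
    then show ?case unfolding S by (simp add: e0_def e1_def R_def algebra_simps)
  qed
  from brieskorn_independence[OF e \<theta> this]
  show "\<forall>\<^sub>F t in nhds 0. (5 + 2 * \<sigma>) / 6 * p0 t = t * deriv (\<lambda>t. \<kappa> t * p0 t) t + 5 / 6 * (\<kappa> t * p0 t)"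
    and "\<forall>\<^sub>F t in nhds 0. (5 + 2 * \<sigma>) / 6 * p1 t = t * deriv (\<lambda>t. \<kappa> t * p1 t) t + 7 / 6 * (\<kappa> t * p1 t)"
    unfolding e0_def e1_def c_def r0_def r1_def by simp_all
qed

text \<open>Both J = \<open>jac u v\<close> and v J are decomposed. The exponents exclude p1 and q0,
  so the area equation J + g(k(H)) v J = 1 + f(H) y gives p0 = 1 and f = (g o k) q1. The equation
  for p0 = 1 forces \<kappa> = 1 and hence k = id; the one for q1 makes q1 constant, and the linear
  part gives q1 = 1.\<close>

lemma cusp_area_rigidity:
  assumes u: "analytic2_at u 0" "u 0 = 0" and v: "analytic2_at v 0" "v 0 = 0"
    and k: "analytic1_at k 0" "k 0 = 0"
    and fg: "analytic1_at f 0" "analytic1_at g 0"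
    and eq: "\<forall>\<^sub>F z in nhds 0. cusp (u z, v z) = k (cusp z)"
    and area: "\<forall>\<^sub>F z in nhds 0. (1 + g (cusp (u z, v z)) * v z) * jac u v z = 1 + f (cusp z) * snd z"
  shows "\<forall>\<^sub>F t in nhds 0. f t = g t"
proof -
  define J where "J = jac u v"
  have J: "analytic2_at J 0" unfolding J_def by (rule analytic2_jac[OF u(1) v(1)])
  have J0: "J 0 = 1" using eventually_nhds_x_imp_x[OF area] v(2) by (simp add: J_def)
  have k': "deriv k 0 = 1" and \<delta>: "pdy v 0 = 1"
    using cusp_symmetry_linear_part[OF u v k eq] J0 by (simp_all add: J_def)
  obtain k1 where k1: "analytic1_at k1 0" "k1 0 = deriv k 0" "\<forall>\<^sub>F t in nhds 0. k t = t * k1 t"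
    by (rule analytic1_divide_by_id[OF k])
  define \<kappa> where "\<kappa> = (\<lambda>t. k1 t / deriv k t)"
  have \<kappa>: "analytic1_at \<kappa> 0" "\<kappa> 0 = 1"
    using k1(2) k' by (auto simp: \<kappa>_def intro!: analytic1_divide k1 analytic1_deriv k)
  have \<kappa>ne: "\<forall>\<^sub>F t in nhds 0. \<kappa> t \<noteq> 0"
  proof -
    have "(\<kappa> \<longlongrightarrow> \<kappa> 0) (nhds 0)"
      using analytic1_isCont[OF \<kappa>(1)] by (simp only: isCont_def tendsto_at_iff_tendsto_nhds)
    then show ?thesis by (rule tendsto_imp_eventually_ne) (simp add: \<kappa>(2))
  qed
  have kd: "deriv k 0 \<noteq> 0" using k' by simp
  obtain p0 p1 \<eta> where p: "analytic1_at p0 0" "analytic1_at p1 0" "analytic2_at \<eta> 0" "\<eta> 0 = 0"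
    "\<forall>\<^sub>F z in nhds 0. J z = p0 (cusp z) + p1 (cusp z) * snd z + hbr \<eta> z"
    by (rule brieskorn_decomposition[OF J])
  obtain q0 q1 \<zeta> where q: "analytic1_at q0 0" "analytic1_at q1 0" "analytic2_at \<zeta> 0" "\<zeta> 0 = 0"
    "\<forall>\<^sub>F z in nhds 0. v z * J z = q0 (cusp z) + q1 (cusp z) * snd z + hbr \<zeta> z"
    by (rule brieskorn_decomposition[OF analytic2_mult[OF v(1) J]])
  \<comment> \<open>The cases \<sigma> = 0 with V = 1 and \<sigma> = 1 with V = v of
    \<open>gauss_manin_equations\<close>.\<close>
  have V0: "\<forall>\<^sub>F z in nhds 0. jac (\<lambda>z. 1) v z = 0 \<and> v z * jac u (\<lambda>z. 1) z = 0 * 1 * jac u v z"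
    by (simp add: jac_def diff2_const)
  have V1: "\<forall>\<^sub>F z in nhds 0. jac v v z = 0 \<and> v z * jac u v z = 1 * v z * jac u v z"
    by (simp add: jac_def)
  have P: "\<forall>\<^sub>F t in nhds 0. 5 / 6 * p0 t = t * deriv (\<lambda>t. \<kappa> t * p0 t) t + 5 / 6 * (\<kappa> t * p0 t)"
      "\<forall>\<^sub>F t in nhds 0. 5 / 6 * p1 t = t * deriv (\<lambda>t. \<kappa> t * p1 t) t + 7 / 6 * (\<kappa> t * p1 t)"
    using gauss_manin_equations[OF u(1) v(1) k(1) kd k1(1,3) eq analytic2_const V0 p(1,2,3)] p(5)
    by (simp_all add: J_def \<kappa>_def)
  have Q: "\<forall>\<^sub>F t in nhds 0. 7 / 6 * q0 t = t * deriv (\<lambda>t. \<kappa> t * q0 t) t + 5 / 6 * (\<kappa> t * q0 t)"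
      "\<forall>\<^sub>F t in nhds 0. 7 / 6 * q1 t = t * deriv (\<lambda>t. \<kappa> t * q1 t) t + 7 / 6 * (\<kappa> t * q1 t)"
    using gauss_manin_equations[OF u(1) v(1) k(1) kd k1(1,3) eq v(1) V1 q(1,2,3)] q(5)
    by (simp_all add: J_def \<kappa>_def)
  \<comment> \<open>The derivative acts on \<kappa> w, so the equation is multiplied by \<kappa> and
    solved for \<kappa> w; \<kappa> is nonzero near 0.\<close>
  have van: "\<forall>\<^sub>F t in nhds 0. w t = 0" if w: "analytic1_at w 0"
      and eq: "\<forall>\<^sub>F t in nhds 0. \<alpha> * w t = t * deriv (\<lambda>t. \<kappa> t * w t) t + \<beta> * (\<kappa> t * w t)"
      and nr: "\<And>n. \<alpha> \<noteq> \<beta> + real n" for w \<alpha> \<beta>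
  proof -
    have "\<forall>\<^sub>F t in nhds 0. \<kappa> t * w t = 0"
    proof (rule resonance_free_ode[OF analytic1_mult[OF \<kappa>(1) w] \<kappa>])
      show "\<forall>\<^sub>F t in nhds 0. \<alpha> * (\<kappa> t * w t) = \<kappa> t * (t * deriv (\<lambda>t. \<kappa> t * w t) t + \<beta> * (\<kappa> t * w t))"
        using eq by eventually_elim (metis mult.left_commute)
    qed (use nr in blast)
    then show ?thesis using \<kappa>ne by eventually_elim simp
  qed
  have p1z: "\<forall>\<^sub>F t in nhds 0. p1 t = 0" by (rule van[OF p(2) P(2)]) (simp add: field_simps)
  have q0z: "\<forall>\<^sub>F t in nhds 0. q0 t = 0"
  proof (rule van[OF q(1) Q(1)])
    fix n show "7 / 6 \<noteq> 5 / 6 + real n" by (cases n) simp_all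
  qed
  define G where "G = (\<lambda>t. g (k t))"
  have G: "analytic1_at G 0" unfolding G_def by (rule analytic1_compose[of g k 0]) (simp_all add: k fg)
  have pull: "analytic2_at (\<lambda>z. h (cusp z)) 0" if "analytic1_at h 0" for h
    by (rule analytic2_compose1[OF _ analytic2_cusp]) (simp add: cusp_eq that)
  \<comment> \<open>The bracket parts of J and of G(H) v J with reversed sign, as needed to move
    them to the other side of the area equation.\<close>
  define \<theta> where "\<theta> = (\<lambda>z. - 1 * \<eta> z - G (cusp z) * \<zeta> z)"
  have \<theta>: "analytic2_at \<theta> 0" unfolding \<theta>_def
    by (intro analytic2_diff analytic2_mult analytic2_const pull p q G)
  define e0 where "e0 = (\<lambda>t. p0 t - 1 + G t * q0 t)"
  define e1 where "e1 = (\<lambda>t. p1 t + G t * q1 t - f t)"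
  have e: "analytic1_at e0 0" "analytic1_at e1 0" unfolding e0_def e1_def
    by (intro analytic1_add analytic1_diff analytic1_mult analytic1_const p q G fg)+
  have "\<forall>\<^sub>F z in nhds 0. e0 (cusp z) + e1 (cusp z) * snd z = hbr \<theta> z"
    using area eq p(5) q(5) analytic2_eventually[OF p(3)] analytic2_eventually[OF q(3)]
      eventually_cusp[OF analytic1_eventually[OF G]]
  proof eventually_elim
    case (elim z)
    note d = elim(5,6)[THEN analytic2_diff2] and h = hbr_comp_cusp[OF analytic1_deriv(1)[OF elim(7)]]
    have "hbr \<theta> z = - 1 * hbr \<eta> z - G (cusp z) * hbr \<zeta> z"
      unfolding \<theta>_def hbr_diff[OF diff2_cmult(1)[OF d(1)] diff2_mult(1)[OF h(1) d(2)]] hbr_cmult[OF d(1)]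
        hbr_mult[OF h(1) d(2)] h(2) by simp
    moreover have a: "J z + G (cusp z) * (v z * J z) = 1 + f (cusp z) * snd z"
      using elim(1) unfolding elim(2) by (simp add: G_def J_def algebra_simps)
    ultimately show ?case using a[unfolded elim(4), unfolded elim(3)]
      by (simp add: e0_def e1_def algebra_simps)
  qed
  from brieskorn_independence[OF e \<theta> this]
  have ez: "\<forall>\<^sub>F t in nhds 0. e0 t = 0" "\<forall>\<^sub>F t in nhds 0. e1 t = 0" .
  have p0: "\<forall>\<^sub>F t in nhds 0. p0 t = 1" using ez(1) q0z by eventually_elim (simp add: e0_def)
  \<comment> \<open>With p0 = 1 the first equation says 0 = t \<kappa>' + 5/6 (\<kappa> - 1), and
    5/6 + n is never zero.\<close>
  have \<kappa>1: "\<forall>\<^sub>F t in nhds 0. \<kappa> t = 1"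
  proof -
    have "\<forall>\<^sub>F t in nhds 0. \<kappa> t - 1 = 0"
    proof (rule resonance_free_ode[of _ "\<lambda>t. 1" 0 "5 / 6"])
      show "\<forall>\<^sub>F t in nhds 0. 0 * (\<kappa> t - 1) = 1 * (t * deriv (\<lambda>t. \<kappa> t - 1) t + 5 / 6 * (\<kappa> t - 1))"
        using P(1) eventually_nhds_nhds[OF p0] analytic1_eventually[OF \<kappa>(1)]
      proof eventually_elim
        case (elim t)
        have "\<forall>\<^sub>F s in nhds t. \<kappa> s * p0 s = \<kappa> s" using elim(2) by eventually_elim simp
        then have "deriv (\<lambda>t. \<kappa> t * p0 t) t = deriv \<kappa> t" by (rule deriv_cong_ev)
        moreover have "deriv (\<lambda>t. \<kappa> t - 1) t = deriv \<kappa> t"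
          by (rule DERIV_imp_deriv) (auto intro!: derivative_eq_intros analytic1_deriv(1)[OF elim(3)])
        ultimately show ?case using elim(1) eventually_nhds_x_imp_x[OF elim(2)] by (simp add: field_simps)
      qed
      show "analytic1_at (\<lambda>t. \<kappa> t - 1) 0" by (intro analytic1_diff \<kappa> analytic1_const)
    qed (auto simp: analytic1_const)
    then show ?thesis by simp
  qed
  have const: "\<forall>\<^sub>F t in nhds 0. w t = w 0" if w: "analytic1_at w 0" and eq: "\<forall>\<^sub>F t in nhds 0. t * deriv w t = 0" for w :: "real \<Rightarrow> real"
  proof -
    have "\<forall>\<^sub>F t in nhds 0. w t - w 0 = 0"
    proof (rule resonance_free_ode[of _ "\<lambda>t. 1" 0 0])
      show "\<forall>\<^sub>F t in nhds 0. 0 * (w t - w 0) = 1 * (t * deriv (\<lambda>t. w t - w 0) t + 0 * (w t - w 0))"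
        using eq analytic1_eventually[OF w]
      proof eventually_elim
        case (elim t)
        have "deriv (\<lambda>t. w t - w 0) t = deriv w t"
          by (rule DERIV_imp_deriv) (auto intro!: derivative_eq_intros analytic1_deriv(1)[OF elim(2)])
        then show ?case using elim(1) by simp
      qed
      show "analytic1_at (\<lambda>t. w t - w 0) 0" by (intro analytic1_diff w analytic1_const)
    qed (auto simp: analytic1_const)
    then show ?thesis by simp
  qed
  \<comment> \<open>From k = t k1 one has k' = k1 + t k1', while \<kappa> = 1 says k' = k1; so k1 is
    constant, with value k'(0) = 1.\<close>
  have "\<forall>\<^sub>F t in nhds 0. t * deriv k1 t = 0"
    using \<kappa>1 eventually_nhds_nhds[OF k1(3)] analytic1_eventually[OF k1(1)]
  proof eventually_elim
    case (elim t)
    have "deriv k t = deriv (\<lambda>t. t * k1 t) t" by (rule deriv_cong_ev[OF elim(2)])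
    also have "\<dots> = k1 t + t * deriv k1 t"
      by (rule DERIV_imp_deriv) (auto intro!: derivative_eq_intros analytic1_deriv(1)[OF elim(3)])
    finally have "deriv k t = k1 t + t * deriv k1 t" .
    moreover have "k1 t = deriv k t" using elim(1) by (cases "deriv k t = 0") (simp_all add: \<kappa>_def)
    ultimately show ?case by simp
  qed
  from const[OF k1(1) this] have kid: "\<forall>\<^sub>F t in nhds 0. k t = t"
    using k1(3) by eventually_elim (simp add: k1(2) k')
  have "\<forall>\<^sub>F t in nhds 0. t * deriv q1 t = 0"
    using Q(2) eventually_nhds_nhds[OF \<kappa>1]
  proof eventually_elim
    case (elim t)
    have "\<forall>\<^sub>F s in nhds t. \<kappa> s * q1 s = q1 s" using elim(2) by eventually_elim simp
    then have "deriv (\<lambda>t. \<kappa> t * q1 t) t = deriv q1 t" by (rule deriv_cong_ev)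
    then show ?case using elim(1) eventually_nhds_x_imp_x[OF elim(2)] by simp
  qed
  from const[OF q(2) this] have q1c: "\<forall>\<^sub>F t in nhds 0. q1 t = q1 0" .
  \<comment> \<open>Compare the derivatives in y at 0. On the left v_y J = 1. The bracket with
    \<zeta> does not contribute, since the coefficients of dH are - 2 x and 3 y^2, whose values and
    y-derivatives vanish at 0.\<close>
  have q10: "q1 0 = 1"
  proof -
    define w where "w = (\<lambda>z. v z * J z)"
    have "\<forall>\<^sub>F z in nhds 0. w z = q1 0 * snd z + hbr \<zeta> z"
      using q(5) eventually_cusp[OF q0z] eventually_cusp[OF q1c] by eventually_elim (simp add: w_def)
    moreover have dd: "diff2 \<zeta> 0" "diff2 (pdx \<zeta>) 0" "diff2 (pdy \<zeta>) 0"
      using q(3) by (auto intro: analytic2_diff2 analytic2_pdx analytic2_pdy)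
    have dh: "diff2 (hbr \<zeta>) 0" by (rule analytic2_diff2[OF analytic2_hbr[OF q(3)]])
    ultimately have "pdy w 0 = pdy (\<lambda>z. q1 0 * snd z + hbr \<zeta> z) 0"
      by (intro diff2_cong(3) diff2_add diff2_cmult diff2_snd)
    also have "\<dots> = q1 0 + pdy (hbr \<zeta>) 0"
      by (simp add: diff2_add(3)[OF diff2_cmult(1)[OF diff2_snd(1)] dh] diff2_cmult(3)[OF diff2_snd(1)] diff2_snd)
    also have "pdy (hbr \<zeta>) 0 = 0"
    proof -
      have h: "hbr \<zeta> = (\<lambda>z. fst z * (- 2 * pdy \<zeta> z) - snd z * (snd z * (3 * pdx \<zeta> z)))"
        by (simp add: hbr_def fun_eq_iff power2_eq_square)
      have a: "diff2 (\<lambda>z. - 2 * pdy \<zeta> z) 0" "diff2 (\<lambda>z. 3 * pdx \<zeta> z) 0" by (intro diff2_cmult dd)+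
      have b: "diff2 (\<lambda>z. snd z * (3 * pdx \<zeta> z)) 0" by (intro diff2_mult diff2_snd a)
      have c: "diff2 (\<lambda>z. fst z * (- 2 * pdy \<zeta> z)) 0" "diff2 (\<lambda>z. snd z * (snd z * (3 * pdx \<zeta> z))) 0"
        by (intro diff2_mult diff2_fst diff2_snd a b)+
      show ?thesis unfolding h diff2_diff(3)[OF c] diff2_mult(3)[OF diff2_fst(1) a(1)] diff2_mult(3)[OF diff2_snd(1) b]
        by (simp add: diff2_fst)
    qed
    also have "pdy w 0 = 1"
      using diff2_mult(3)[OF analytic2_diff2[OF v(1)] analytic2_diff2[OF J]] v(2) J0 \<delta> by (simp add: w_def)
    finally show ?thesis by simp
  qed
  show ?thesis using ez(2) p1z q1c kid by eventually_elim (simp add: e1_def q10 G_def)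
qed

subsection \<open>Charts\<close>

lemma is_chart_inj_on: "is_chart X c \<Longrightarrow> inj_on (snd c) (fst c)"
  unfolding is_chart_def case_prod_unfold
  by (metis homeomorphic_imp_injective_map openin_subset topspace_subtopology_subset)

lemma is_chart_openin: "is_chart X c \<Longrightarrow> openin X (fst c)"
  unfolding is_chart_def case_prod_unfold by blast

lemma chart_inv_left: "is_chart X c \<Longrightarrow> q \<in> fst c \<Longrightarrow> chart_inv c (snd c q) = q"
  unfolding chart_inv_def by (rule inv_into_f_f[OF is_chart_inj_on])

lemma is_chart_open_image:
  assumes "is_chart X c" "openin X S" "S \<subseteq> fst c"
  shows "open (snd c ` S)"
proof -
  have h: "homeomorphic_map (subtopology X (fst c)) (top_of_set (snd c ` fst c)) (snd c)" "open (snd c ` fst c)"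
    using assms(1) unfolding is_chart_def case_prod_unfold by blast+
  have "openin (subtopology X (fst c)) S"
    using assms(2,3) by (simp add: openin_subset_topspace_eq openin_open_subtopology is_chart_openin[OF assms(1)])
  then have "openin (top_of_set (snd c ` fst c)) (snd c ` S)"
    using homeomorphic_imp_open_map[OF h(1)] unfolding open_map_def by blast
  then show ?thesis using h(2) openin_open_trans by blast
qed

lemma is_chart_open_vimage:
  assumes "is_chart X c" "open S"
  shows "openin X {q \<in> fst c. snd c q \<in> S}"
proof -
  have h: "homeomorphic_map (subtopology X (fst c)) (top_of_set (snd c ` fst c)) (snd c)"
    using assms(1) unfolding is_chart_def case_prod_unfold by blast
  have U: "fst c \<subseteq> topspace X" using is_chart_openin[OF assms(1)] by (rule openin_subset)
  have "openin (top_of_set (snd c ` fst c)) (snd c ` fst c \<inter> S)" using assms(2) by blast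
  from openin_continuous_map_preimage[OF homeomorphic_imp_continuous_map[OF h] this]
  have "openin (subtopology X (fst c)) {q \<in> topspace (subtopology X (fst c)). snd c q \<in> snd c ` fst c \<inter> S}" .
  also have "{q \<in> topspace (subtopology X (fst c)). snd c q \<in> snd c ` fst c \<inter> S} = {q \<in> fst c. snd c q \<in> S}"
    using U by auto
  finally have "openin (subtopology X (fst c)) {q \<in> fst c. snd c q \<in> S}" .
  then show ?thesis using is_chart_openin[OF assms(1)] by (simp add: openin_open_subtopology)
qed

lemma eventually_chart:
  assumes "is_chart X c" "P \<in> fst c" "\<forall>\<^sub>F z in nhds (snd c P). Q z"
  shows "\<forall>\<^sub>F q in nhdsin X P. q \<in> fst c \<and> Q (snd c q)"
proof -
  obtain S where S: "open S" "snd c P \<in> S" "\<forall>z\<in>S. Q z" using assms(3) unfolding eventually_nhds by (elim exE conjE)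
  have "openin X {q \<in> fst c. snd c q \<in> S}" by (rule is_chart_open_vimage[OF assms(1) S(1)])
  then show ?thesis unfolding eventually_nhdsin
    using assms(2) S(2,3) by (intro disjI2 exI[of _ "{q \<in> fst c. snd c q \<in> S}"]) simp
qed

text \<open>Membership in the image is part of the conclusion because \<open>chart_inv\<close> is
  arbitrary elsewhere.\<close>

lemma eventually_chart_inv:
  assumes "is_chart X c" "P \<in> fst c" "\<forall>\<^sub>F q in nhdsin X P. Q q"
  shows "\<forall>\<^sub>F z in nhds (snd c P). z \<in> snd c ` fst c \<and> Q (chart_inv c z)"
proof -
  have o: "openin X (fst c)" by (rule is_chart_openin[OF assms(1)])
  then have "P \<in> topspace X" using assms(2) openin_subset by blast
  then obtain S where S: "openin X S" "P \<in> S" "\<forall>q\<in>S. Q q" using assms(3) unfolding eventually_nhdsin by blast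
  have "open (snd c ` (S \<inter> fst c))" by (rule is_chart_open_image[OF assms(1) openin_Int[OF S(1) o]]) simp
  then have "\<forall>\<^sub>F z in nhds (snd c P). z \<in> snd c ` (S \<inter> fst c)"
    by (rule eventually_nhds_in_open) (use assms(2) S(2) in blast)
  then show ?thesis
  proof eventually_elim
    case (elim z)
    then show ?case using chart_inv_left[OF assms(1)] S(3) by auto
  qed
qed

lemma eventually_nhdsin_at:
  "\<forall>\<^sub>F q in nhdsin X P. Q q \<Longrightarrow> P \<in> topspace X \<Longrightarrow> Q P"
  unfolding eventually_nhdsin by blast

lemma open_overlap: "is_chart X c \<Longrightarrow> is_chart X d \<Longrightarrow> open (overlap c d)"
  unfolding overlap_def by (rule is_chart_open_image) (auto intro: is_chart_openin)

section \<open>Area densities of 2-forms and analytic changes of chart\<close>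

lemma dx_wedge_dy_lin2:
  "dx_wedge_dy (lin2 a b c d v) (lin2 a b c d w) = (a * d - b * c) * dx_wedge_dy v w"
  by (simp add: dx_wedge_dy_def lin2_def algebra_simps)

lemma alternating_form2:
  fixes B :: form2
  assumes "bilinear B" "\<And>v. B v v = 0"
  shows "B v w = B (1, 0) (0, 1) * dx_wedge_dy v w"
proof -
  have add: "B (x + y) z = B x z + B y z" "B z (x + y) = B z x + B z y" for x y z
    using bilinear_ladd[OF assms(1)] bilinear_radd[OF assms(1)] by auto
  have mul: "B (r *\<^sub>R x) y = r * B x y" "B x (r *\<^sub>R y) = r * B x y" for r x y
    using bilinear_lmul[OF assms(1)] bilinear_rmul[OF assms(1)] by auto
  have "B ((1, 0) + (0, 1)) ((1, 0) + (0, 1)) = 0" by (rule assms(2))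
  then have anti: "B (0, 1) (1, 0) = - B (1, 0) (0, 1)" unfolding add unfolding assms(2) by simp
  have dec: "x = fst x *\<^sub>R (1, 0) + snd x *\<^sub>R (0, 1)" for x :: "real \<times> real" by (cases x) simp
  have "B v w = B (fst v *\<^sub>R (1, 0) + snd v *\<^sub>R (0, 1)) (fst w *\<^sub>R (1, 0) + snd w *\<^sub>R (0, 1))"
    using dec[of v] dec[of w] by simp
  also have "\<dots> = B (1, 0) (0, 1) * dx_wedge_dy v w"
    unfolding add mul assms(2) anti by (simp add: dx_wedge_dy_def algebra_simps)
  finally show ?thesis .
qed

lemma frechet_derivative_pair:
  assumes "diff2 (fst \<circ> \<phi>) z" "diff2 (snd \<circ> \<phi>) z"
  shows "frechet_derivative \<phi> (at z) = lin2 (pdx (fst \<circ> \<phi>) z) (pdy (fst \<circ> \<phi>) z) (pdx (snd \<circ> \<phi>) z) (pdy (snd \<circ> \<phi>) z)"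
proof -
  have "((\<lambda>z. ((fst \<circ> \<phi>) z, (snd \<circ> \<phi>) z)) has_derivative
     lin2 (pdx (fst \<circ> \<phi>) z) (pdy (fst \<circ> \<phi>) z) (pdx (snd \<circ> \<phi>) z) (pdy (snd \<circ> \<phi>) z)) (at z)"
    using has_derivative_Pair[OF assms[THEN diff2D]] by (simp add: lin2_def[abs_def])
  then have "(\<phi> has_derivative lin2 (pdx (fst \<circ> \<phi>) z) (pdy (fst \<circ> \<phi>) z) (pdx (snd \<circ> \<phi>) z) (pdy (snd \<circ> \<phi>) z)) (at z)"
    by simp
  then show ?thesis by (rule frechet_derivative_at[symmetric])
qed

text \<open>Alternating forms on the plane are multiples of dx \<and> dy, so this coefficient
  carries the whole form and turns statements about it into scalar ones.\<close>

definition area_density :: "'a form2_field \<Rightarrow> 'a chart \<Rightarrow> real \<times> real \<Rightarrow> real" where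
  "area_density \<omega> c z = \<omega> c z (1, 0) (0, 1)"

lemma form_eq_area_density:
  assumes "analytic_2form A \<omega>" "c \<in> A" "z \<in> snd c ` fst c"
  shows "\<omega> c z v w = area_density \<omega> c z * dx_wedge_dy v w"
  unfolding area_density_def
  using assms unfolding analytic_2form_def by (intro alternating_form2) blast+

lemma analytic_area_density:
  assumes "analytic_2form A \<omega>" "c \<in> A" "z \<in> snd c ` fst c"
  shows "analytic2_at (area_density \<omega> c) z"
  unfolding area_density_def[abs_def] using assms unfolding analytic_2form_def by blast

lemma area_density_nonzero:
  assumes "symplectic_form A \<omega>" "c \<in> A" "z \<in> snd c ` fst c"
  shows "area_density \<omega> c z \<noteq> 0"
proof
  assume 0: "area_density \<omega> c z = 0"
  have "\<forall>w. \<omega> c z (1, 0) w = 0"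
    using form_eq_area_density[OF _ assms(2,3), of \<omega>] assms(1) 0 unfolding symplectic_form_def by simp
  then have "(1, 0) = (0 :: real \<times> real)"
    using assms unfolding symplectic_form_def by blast
  then show False by (simp add: zero_prod_def)
qed

lemma area_density_transition:
  assumes S: "analytic_surface X A" and \<omega>: "analytic_2form A \<omega>" and c: "c \<in> A" and d: "d \<in> A"
    and z: "z \<in> overlap c d"
  shows "area_density \<omega> c z = area_density \<omega> d (transition c d z) * jac (fst \<circ> transition c d) (snd \<circ> transition c d) z"
proof -
  have ch: "is_chart X c" "is_chart X d" using S c d unfolding analytic_surface_def by blast+
  have "analytic2_at (fst \<circ> transition c d) z" "analytic2_at (snd \<circ> transition c d) z"
    using S c d z unfolding analytic_surface_def analytic_compatible_def analytic_transition_def by blast+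
  note fr = frechet_derivative_pair[OF this[THEN analytic2_diff2]]
  obtain q where q: "q \<in> fst c" "q \<in> fst d" "z = snd c q" using z unfolding overlap_def by blast
  then have t: "transition c d z \<in> snd d ` fst d"
    using chart_inv_left[OF ch(1)] by (simp add: transition_def)
  have "area_density \<omega> c z = \<omega> d (transition c d z)
        (frechet_derivative (transition c d) (at z) (1, 0)) (frechet_derivative (transition c d) (at z) (0, 1))"
    using \<omega> c d z unfolding area_density_def analytic_2form_def by blast
  also have "\<dots> = area_density \<omega> d (transition c d z) * jac (fst \<circ> transition c d) (snd \<circ> transition c d) z"
    unfolding form_eq_area_density[OF \<omega> d t] fr dx_wedge_dy_lin2
    by (simp add: jac_def dx_wedge_dy_def)
  finally show ?thesis .
qed

text \<open>The atlas is maximal, so the new coordinates belong to it as soon as they are compatible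
  with every chart. One direction of compatibility uses the analyticity of (u, v), the other that of
  its inverse.\<close>

lemma analytic_change_of_chart:
  assumes S: "analytic_surface X A" and c: "c \<in> A" and z0: "z0 \<in> snd c ` fst c"
    and u: "analytic2_at u z0" and v: "analytic2_at v z0" and J: "jac u v z0 \<noteq> 0"
  obtains N g where "open N" "z0 \<in> N" "N \<subseteq> snd c ` fst c"
    "({q \<in> fst c. snd c q \<in> N}, \<lambda>q. (u (snd c q), v (snd c q))) \<in> A"
    "homeomorphism N ((\<lambda>z. (u z, v z)) ` N) (\<lambda>z. (u z, v z)) g" "open ((\<lambda>z. (u z, v z)) ` N)"
    "\<forall>z\<in>N. analytic2_at u z \<and> analytic2_at v z"
proof -
  define \<Psi> where "\<Psi> = (\<lambda>z. (u z, v z))"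
  have ch: "is_chart X c" using S c unfolding analytic_surface_def by blast
  obtain U V g where I: "open U" "z0 \<in> U" "open V" "homeomorphism U V (\<lambda>z. (u z, v z)) g"
    "\<forall>z\<in>U. analytic2_at u z \<and> analytic2_at v z"
    "\<forall>y\<in>V. analytic2_at (\<lambda>y. fst (g y)) y \<and> analytic2_at (\<lambda>y. snd (g y)) y"
    by (rule analytic_inverse_function_2[OF u v J])
  \<comment> \<open>The neighbourhood of the inverse function theorem may leave the image of the
    chart.\<close>
  define N where "N = U \<inter> snd c ` fst c"
  have N: "open N" "z0 \<in> N" "N \<subseteq> U" "N \<subseteq> snd c ` fst c"
    using I z0 is_chart_open_image[OF ch is_chart_openin[OF ch] order_refl] unfolding N_def by auto
  have hU: "homeomorphism U V \<Psi> g" using I(4) by (simp add: \<Psi>_def)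
  have gP: "g (\<Psi> z) = z" if "z \<in> U" for z using hU that unfolding homeomorphism_def by blast
  have hN: "homeomorphism N (\<Psi> ` N) \<Psi> g"
    by (rule homeomorphism_of_subsets[OF hU N(3)]) (use hU N(3) in \<open>auto simp: homeomorphism_def\<close>)
  have sV: "\<Psi> ` N \<subseteq> V" using hU N(3) unfolding homeomorphism_def by blast
  have oN: "open (\<Psi> ` N)"
  proof -
    have "openin (top_of_set U) N" using N by (simp add: openin_open_eq I(1))
    then have "openin (top_of_set V) (\<Psi> ` N)" by (rule homeomorphism_imp_open_map[OF hU])
    then show ?thesis using I(3) openin_open_trans by blast
  qed
  define W where "W = {q \<in> fst c. snd c q \<in> N}"
  define c' where "c' = (W, \<lambda>q. \<Psi> (snd c q))"
  have fs: "fst c' = W" "snd c' = (\<lambda>q. \<Psi> (snd c q))" by (simp_all add: c'_def)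
  have WN: "snd c ` W = N" using N(4) unfolding W_def by auto
  have oW: "openin X W" unfolding W_def by (rule is_chart_open_vimage[OF ch N(1)])
  have im: "snd c' ` W = \<Psi> ` N" unfolding fs using WN by (metis image_image)
  have ch': "is_chart X c'"
  proof -
    have h: "homeomorphic_map (subtopology X (fst c)) (top_of_set (snd c ` fst c)) (snd c)"
      using ch unfolding is_chart_def case_prod_unfold by blast
    have ts: "topspace (subtopology X (fst c)) = fst c"
      using openin_subset[OF is_chart_openin[OF ch]] by auto
    have "homeomorphic_map (subtopology (subtopology X (fst c)) W) (subtopology (top_of_set (snd c ` fst c)) N) (snd c)"
      by (rule homeomorphic_map_subtopologies[OF h]) (use ts N(4) in \<open>auto simp: W_def\<close>)
    moreover have "subtopology (subtopology X (fst c)) W = subtopology X W"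
      by (simp add: subtopology_subtopology W_def Int_absorb1 Collect_conj_eq inf.absorb2 flip: Int_assoc)
    moreover have "subtopology (top_of_set (snd c ` fst c)) N = top_of_set N"
      using N(4) by (simp add: subtopology_subtopology Int_absorb1)
    ultimately have 1: "homeomorphic_map (subtopology X W) (top_of_set N) (snd c)" by simp
    have 2: "homeomorphic_map (top_of_set N) (top_of_set (\<Psi> ` N)) \<Psi>"
      using hN unfolding homeomorphic_map_maps homeomorphic_maps_def homeomorphism_def
      by (intro exI[of _ g]) auto
    have "homeomorphic_map (subtopology X W) (top_of_set (\<Psi> ` N)) (\<Psi> \<circ> snd c)"
      by (rule homeomorphic_map_compose[OF 1 2])
    then show ?thesis unfolding is_chart_def case_prod_unfold fs
      using oW oN im[unfolded fs] by (simp add: o_def)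
  qed
  \<comment> \<open>The inverse of the new chart factors through g, so transitions out of it are old
    transitions composed with the analytic map g.\<close>
  have inv: "chart_inv c' y = chart_inv c (g y)" if "y \<in> \<Psi> ` N" for y
  proof -
    have "y \<in> (\<lambda>q. \<Psi> (snd c q)) ` W" using that im[unfolded fs] by simp
    then obtain q where q: "q \<in> W" "y = \<Psi> (snd c q)" by blast
    have "chart_inv c' y = q" using chart_inv_left[OF ch', of q] q by (simp add: fs)
    moreover have "g y = snd c q" using gP[of "snd c q"] q N(3) by (auto simp: W_def)
    ultimately show ?thesis using chart_inv_left[OF ch, of q] q by (simp add: W_def)
  qed
  have comp: "analytic_compatible c' d" if d: "d \<in> A" for d
  proof -
    have chd: "is_chart X d" using S d unfolding analytic_surface_def by blast
    have cd: "analytic_transition c d" "analytic_transition d c"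
      using S c d unfolding analytic_surface_def analytic_compatible_def by blast+
    have "analytic_transition c' d"
      unfolding analytic_transition_def
    proof
      fix y assume "y \<in> overlap c' d"
      then obtain q where q: "q \<in> W" "q \<in> fst d" "y = \<Psi> (snd c q)" unfolding overlap_def fs by blast
      have yN: "y \<in> \<Psi> ` N" using q by (auto simp: W_def)
      have gy: "g y = snd c q" using gP[of "snd c q"] q N(3) by (auto simp: W_def)
      have ov: "snd c q \<in> overlap c d" using q unfolding overlap_def W_def by blast
      have ev: "\<forall>\<^sub>F y' in nhds y. transition c' d y' = transition c d (g y')"
        using eventually_nhds_in_open[OF oN yN] by eventually_elim (simp add: transition_def inv)
      have t: "analytic2_at (fst \<circ> transition c d) (fst (g y), snd (g y))" "analytic2_at (snd \<circ> transition c d) (fst (g y), snd (g y))"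
        using cd(1) ov gy unfolding analytic_transition_def by simp_all
      have ga: "analytic2_at (\<lambda>y. fst (g y)) y" "analytic2_at (\<lambda>y. snd (g y)) y" using I(6) sV yN by blast+
      show "analytic2_at (fst \<circ> transition c' d) y \<and> analytic2_at (snd \<circ> transition c' d) y"
      proof
        show "analytic2_at (fst \<circ> transition c' d) y"
          by (rule analytic2_cong[OF analytic2_compose[OF t(1) ga]]) (use ev in eventually_elim, simp)
        show "analytic2_at (snd \<circ> transition c' d) y"
          by (rule analytic2_cong[OF analytic2_compose[OF t(2) ga]]) (use ev in eventually_elim, simp)
      qed
    qed
    moreover have "analytic_transition d c'"
      unfolding analytic_transition_def
    proof
      fix y assume "y \<in> overlap d c'"
      then obtain q where q: "q \<in> W" "q \<in> fst d" "y = snd d q" unfolding overlap_def fs by blast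
      have ov: "y \<in> overlap d c" using q unfolding overlap_def W_def by blast
      have t: "analytic2_at (fst \<circ> transition d c) y" "analytic2_at (snd \<circ> transition d c) y"
        using cd(2) ov unfolding analytic_transition_def by blast+
      have "transition d c y = snd c q" using chart_inv_left[OF chd] q by (simp add: transition_def)
      then have "transition d c y \<in> N" using q by (simp add: W_def)
      then have uv: "analytic2_at u ((fst \<circ> transition d c) y, (snd \<circ> transition d c) y)"
        "analytic2_at v ((fst \<circ> transition d c) y, (snd \<circ> transition d c) y)"
        using I(5) N(3) by auto
      have "fst \<circ> transition d c' = (\<lambda>y. u ((fst \<circ> transition d c) y, (snd \<circ> transition d c) y))"
        "snd \<circ> transition d c' = (\<lambda>y. v ((fst \<circ> transition d c) y, (snd \<circ> transition d c) y))"
        by (simp_all add: fun_eq_iff transition_def fs \<Psi>_def)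
      then show "analytic2_at (fst \<circ> transition d c') y \<and> analytic2_at (snd \<circ> transition d c') y"
        using analytic2_compose[OF uv(1) t] analytic2_compose[OF uv(2) t] by simp
    qed
    ultimately show ?thesis by (simp add: analytic_compatible_def)
  qed
  have "c' \<in> A" using S ch' comp unfolding analytic_surface_def by blast
  moreover have "\<forall>z\<in>N. analytic2_at u z \<and> analytic2_at v z" using I(5) N(3) by blast
  ultimately show ?thesis
    using that[of N g] N hN oN unfolding c'_def W_def \<Psi>_def by blast
qed

section \<open>The normal form on the surface\<close>

text \<open>A reflection of y reduces all sign choices to the function H. After that
  \<open>cusp_area_normal_form\<close>, applied to the area density, supplies the
  coordinates.\<close>

lemma A2_normal_form_exists:
  assumes S: "analytic_surface X A" and \<omega>: "symplectic_form A \<omega>" and A2: "A2_singularity X A P G"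
  shows "\<exists>c f. A2_normal_form X A \<omega> P G c f"
proof -
  obtain c0 \<epsilon> \<delta> where c0: "coords_centred_at A P c0" and \<epsilon>: "\<epsilon> \<in> {1, - 1 :: real}" and \<delta>: "\<delta> \<in> {1, - 1 :: real}"
    and G: "\<forall>\<^sub>F q in nhdsin X P. G q - G P = \<epsilon> * fst (snd c0 q) ^ 2 + \<delta> * snd (snd c0 q) ^ 3"
    using A2 unfolding A2_singularity_def by blast
  have c0A: "c0 \<in> A" "P \<in> fst c0" "snd c0 P = 0" using c0 unfolding coords_centred_at_def by auto
  have ch0: "is_chart X c0" using S c0A unfolding analytic_surface_def by blast
  have \<omega>2: "analytic_2form A \<omega>" using \<omega> unfolding symplectic_form_def by blast
  have z0: "0 \<in> snd c0 ` fst c0" using c0A by (metis imageI)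
  define a where "a = area_density \<omega> c0"
  have a: "analytic2_at a 0" unfolding a_def by (rule analytic_area_density[OF \<omega>2 c0A(1) z0])
  have a0: "a 0 \<noteq> 0" unfolding a_def by (rule area_density_nonzero[OF \<omega> c0A(1) z0])
  \<comment> \<open>With this sign \<epsilon> x^2 + \<delta> y^3 = - \<epsilon> H(x, \<sigma>
    y).\<close>
  define \<sigma> where "\<sigma> = - \<delta> * \<epsilon>"
  have \<sigma>: "\<sigma> * \<sigma> = 1" "\<sigma> ^ 3 = \<sigma>" "\<sigma> \<noteq> 0" using \<epsilon> \<delta> by (auto simp: \<sigma>_def)
  define F where "F = (\<lambda>z::real \<times> real. (fst z, \<sigma> * snd z))"
  have F0: "F 0 = 0" by (simp add: F_def zero_prod_def)
  have flip_an: "analytic2_at (\<lambda>z. w (F z)) 0" if "analytic2_at w 0" for w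
    unfolding F_def
    by (rule analytic2_compose[OF _ analytic2_fst analytic2_mult[OF analytic2_const analytic2_snd]])
       (use that in \<open>simp add: zero_prod_def\<close>)
  have F_lim: "filterlim F (nhds 0) (nhds 0)"
  proof -
    have "isCont F 0" unfolding F_def by (intro continuous_intros)
    then show ?thesis using tendsto_at_iff_tendsto_nhds[of F 0] by (simp add: isCont_def F0)
  qed
  \<comment> \<open>The area density in the reflected coordinates: F is its own inverse and has
    Jacobian \<sigma>.\<close>
  define b where "b = (\<lambda>z. \<sigma> * a (F z))"
  have b: "analytic2_at b 0" unfolding b_def by (intro analytic2_mult analytic2_const flip_an a)
  have b0: "b 0 \<noteq> 0" using a0 \<sigma>(3) by (simp add: b_def F0)
  obtain u v k f where N: "analytic2_at u 0" "analytic2_at v 0" "u 0 = 0" "v 0 = 0"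
    "analytic1_at k 0" "k 0 = 0" "deriv k 0 \<noteq> 0" "analytic1_at f 0"
    "\<forall>\<^sub>F z in nhds 0. cusp (u z, v z) = k (cusp z)"
    "\<forall>\<^sub>F z in nhds 0. (1 + f (cusp (u z, v z)) * v z) * jac u v z = b z"
    by (rule cusp_area_normal_form[OF b b0])
  obtain m where m: "analytic1_at m 0" "m 0 = 0" "deriv m 0 \<noteq> 0" "\<forall>\<^sub>F t in nhds 0. m (k t) = t" "\<forall>\<^sub>F t in nhds 0. k (m t) = t"
    by (rule analytic1_inverse_function[OF N(5-7)])
  define u' where "u' = (\<lambda>z. u (F z))"
  define v' where "v' = (\<lambda>z. v (F z))"
  have uv: "analytic2_at u' 0" "analytic2_at v' 0" "u' 0 = 0" "v' 0 = 0"
    unfolding u'_def v'_def using N F0 by (simp_all add: flip_an)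
  have cu: "\<forall>\<^sub>F z in nhds 0. cusp (u' z, v' z) = k (cusp (F z))"
    using eventually_compose_filterlim[OF N(9) F_lim] by (simp add: u'_def v'_def)
  have area: "\<forall>\<^sub>F z in nhds 0. (1 + f (cusp (u' z, v' z)) * v' z) * jac u' v' z = a z"
    using eventually_compose_filterlim[OF N(10) F_lim] eventually_compose_filterlim[OF analytic2_eventually[OF N(1)] F_lim]
      eventually_compose_filterlim[OF analytic2_eventually[OF N(2)] F_lim]
  proof eventually_elim
    case (elim z)
    note ds = diff2_cmult[OF diff2_snd(1), of \<sigma> z]
    have d: "diff2 u (fst z, \<sigma> * snd z)" "diff2 v (fst z, \<sigma> * snd z)"
      using elim(2,3) by (auto intro: analytic2_diff2 simp: F_def)
    have "jac u' v' z = \<sigma> * jac u v (F z)"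
      unfolding jac_def u'_def v'_def F_def diff2_comp2(2,3)[OF d(1) diff2_fst(1) ds(1)] diff2_comp2(2,3)[OF d(2) diff2_fst(1) ds(1)]
        ds(2,3) diff2_fst(2,3) diff2_snd(2,3) by (simp add: algebra_simps)
    then have "(1 + f (cusp (u' z, v' z)) * v' z) * jac u' v' z = \<sigma> * b (F z)"
      unfolding elim(1)[symmetric] by (simp add: u'_def v'_def)
    also have "F (F z) = z" using \<sigma>(1) by (cases z) (simp add: F_def flip: mult.assoc)
    then have "\<sigma> * b (F z) = a z" using \<sigma>(1) by (simp add: b_def flip: mult.assoc)
    finally show ?case .
  qed
  have J: "jac u' v' 0 \<noteq> 0" using eventually_nhds_x_imp_x[OF area] a0 uv(4) by auto
  obtain W g where W: "open W" "0 \<in> W" "W \<subseteq> snd c0 ` fst c0"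
    "({q \<in> fst c0. snd c0 q \<in> W}, \<lambda>q. (u' (snd c0 q), v' (snd c0 q))) \<in> A"
    "homeomorphism W ((\<lambda>z. (u' z, v' z)) ` W) (\<lambda>z. (u' z, v' z)) g" "open ((\<lambda>z. (u' z, v' z)) ` W)"
    "\<forall>z\<in>W. analytic2_at u' z \<and> analytic2_at v' z"
    by (rule analytic_change_of_chart[OF S c0A(1) z0 uv(1,2) J])
  define \<Psi> where "\<Psi> = (\<lambda>z. (u' z, v' z))"
  define c where "c = ({q \<in> fst c0. snd c0 q \<in> W}, \<lambda>q. \<Psi> (snd c0 q))"
  have fs: "fst c = {q \<in> fst c0. snd c0 q \<in> W}" "snd c = (\<lambda>q. \<Psi> (snd c0 q))" by (simp_all add: c_def)
  have cA: "c \<in> A" using W(4) by (simp add: c_def \<Psi>_def)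
  have \<Psi>0: "\<Psi> 0 = 0" using uv by (simp add: \<Psi>_def zero_prod_def)
  have cent: "coords_centred_at A P c"
    unfolding coords_centred_at_def fs using cA c0A W(2) \<Psi>0 by simp
  have "fibration_defined_by X P G (cusp \<circ> snd c)"
    unfolding fibration_defined_by_def
  \<comment> \<open>In the chart \<open>c0\<close> the function is G P - \<epsilon> H(F z), and m
    recovers H(F z) from the new value k(H(F z)).\<close>
  proof (intro exI[of _ "\<lambda>t. G P + - \<epsilon> * m t"] conjI)
    show "analytic1_at (\<lambda>t. G P + - \<epsilon> * m t) 0" by (intro analytic1_add analytic1_mult analytic1_const m(1))
    have "((\<lambda>t. G P + - \<epsilon> * m t) has_field_derivative - \<epsilon> * deriv m 0) (at 0)"
      by (auto intro!: derivative_eq_intros analytic1_deriv(1)[OF m(1)])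
    then have "deriv (\<lambda>t. G P + - \<epsilon> * m t) 0 = - \<epsilon> * deriv m 0" by (rule DERIV_imp_deriv)
    then show "deriv (\<lambda>t. G P + - \<epsilon> * m t) 0 \<noteq> 0" using m(3) \<epsilon> by auto
    have "\<forall>\<^sub>F z in nhds (snd c0 P). cusp (\<Psi> z) = k (cusp (F z)) \<and> m (k (cusp (F z))) = cusp (F z)"
      using cu eventually_compose_filterlim[OF eventually_cusp[OF m(4)] F_lim]
      unfolding c0A(3) by eventually_elim (simp add: \<Psi>_def)
    from eventually_chart[OF ch0 c0A(2) this] G
    show "\<forall>\<^sub>F q in nhdsin X P. G q = G P + - \<epsilon> * m ((cusp \<circ> snd c) q)"
    proof eventually_elim
      case (elim q)
      have "- \<epsilon> * m ((cusp \<circ> snd c) q) = - \<epsilon> * cusp (F (snd c0 q))" using elim(1) by (simp add: fs)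
      also have "\<dots> = \<epsilon> * fst (snd c0 q) ^ 2 + \<delta> * snd (snd c0 q) ^ 3"
        using \<epsilon> by (auto simp: cusp_eq F_def power_mult_distrib \<sigma>(2)) (auto simp: \<sigma>_def)
      finally show ?case using elim(2) by simp
    qed
  qed
  moreover have "\<forall>\<^sub>F (x, y) in nhds 0. \<forall>v w. \<omega> c (x, y) v w = dx_wedge_dy v w + f (y ^ 3 - x ^ 2) * y * dx_wedge_dy v w"
  proof -
    have h: "homeomorphism W (\<Psi> ` W) \<Psi> g" "open (\<Psi> ` W)" using W(5,6) by (simp_all add: \<Psi>_def)
    have g0: "g 0 = 0" using h(1) W(2) \<Psi>0 unfolding homeomorphism_def by metis
    have 0: "0 \<in> \<Psi> ` W" using W(2) \<Psi>0 by (metis imageI)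
    have "continuous_on (\<Psi> ` W) g" using h(1) unfolding homeomorphism_def by blast
    then have "isCont g 0" using h(2) 0 continuous_on_eq_continuous_at by blast
    then have gl: "filterlim g (nhds 0) (nhds 0)"
      using tendsto_at_iff_tendsto_nhds[of g 0] by (simp add: isCont_def g0)
    have ane: "\<forall>\<^sub>F z in nhds 0. a z \<noteq> 0"
    proof -
      have "(a \<longlongrightarrow> a 0) (nhds 0)" using analytic2_isCont[OF a] by (simp only: isCont_def tendsto_at_iff_tendsto_nhds)
      then show ?thesis using a0 by (rule tendsto_imp_eventually_ne)
    qed
    have "\<forall>\<^sub>F y in nhds 0. \<forall>v w. \<omega> c y v w = (1 + f (cusp y) * snd y) * dx_wedge_dy v w"
      using eventually_compose_filterlim[OF area gl] eventually_compose_filterlim[OF ane gl] eventually_nhds_in_open[OF h(2) 0]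
    proof eventually_elim
      case (elim y)
      obtain z where z: "z \<in> W" "y = \<Psi> z" using elim(3) by blast
      have gy: "g y = z" using h(1) z unfolding homeomorphism_def by blast
      obtain q where q: "q \<in> fst c0" "z = snd c0 q" using W(3) z by blast
      have qc: "q \<in> fst c" using q z by (simp add: fs)
      have ov: "z \<in> overlap c0 c" unfolding overlap_def using q qc by blast
      have tr: "transition c0 c z' = \<Psi> z'" if "z' \<in> W" for z'
      proof -
        obtain q' where "q' \<in> fst c0" "z' = snd c0 q'" using W(3) \<open>z' \<in> W\<close> by blast
        then show ?thesis using chart_inv_left[OF ch0, of q'] by (simp add: transition_def fs)
      qed
      have ev: "\<forall>\<^sub>F z' in nhds z. (fst \<circ> transition c0 c) z' = u' z'" "\<forall>\<^sub>F z' in nhds z. (snd \<circ> transition c0 c) z' = v' z'"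
        using eventually_nhds_in_open[OF W(1) z(1)] by (eventually_elim, simp add: tr \<Psi>_def)+
      have "jac (fst \<circ> transition c0 c) (snd \<circ> transition c0 c) z = jac u' v' z"
        using diff2_cong(2,3)[OF _ ev(1)] diff2_cong(2,3)[OF _ ev(2)] W(7) z(1) analytic2_diff2
        unfolding jac_def by metis
      then have "a z = area_density \<omega> c y * jac u' v' z"
        using area_density_transition[OF S \<omega>2 c0A(1) cA ov] tr[OF z(1)] z(2) by (simp add: a_def)
      moreover have "(1 + f (cusp y) * snd y) * jac u' v' z = a z"
        using elim(1) unfolding gy by (simp add: z(2) \<Psi>_def)
      moreover have "a z \<noteq> 0" using elim(2) gy by simp
      \<comment> \<open>Both \<open>area_density\<close> and the normal form, multiplied by the
        Jacobian, give a z. As a z is nonzero, so is the Jacobian, and it cancels.\<close>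
      ultimately have "area_density \<omega> c y = 1 + f (cusp y) * snd y"
        by (metis mult_cancel_right mult_zero_right)
      moreover have "y \<in> snd c ` fst c" using qc q z by (auto simp: fs)
      ultimately show ?case using form_eq_area_density[OF \<omega>2 cA] by simp
    qed
    then show ?thesis by eventually_elim (auto simp: cusp_def algebra_simps)
  qed
  ultimately have "A2_normal_form X A \<omega> P G c f"
    unfolding A2_normal_form_def using cent N(8) by blast
  then show ?thesis by blast
qed

text \<open>The transition map between the two charts takes one normal form to the other. As both
  define the fibration, it maps H to a function k(H), and \<open>cusp_area_rigidity\<close>
  applies.\<close>

lemma A2_normal_form_unique:
  assumes S: "analytic_surface X A" and \<omega>: "symplectic_form A \<omega>"
    and n: "A2_normal_form X A \<omega> P G c f" and n': "A2_normal_form X A \<omega> P G c' f'"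
  shows "\<forall>\<^sub>F t in nhds 0. f t = f' t"
proof -
  have \<omega>2: "analytic_2form A \<omega>" using \<omega> unfolding symplectic_form_def by blast
  have c: "c \<in> A" "P \<in> fst c" "snd c P = 0" and c': "c' \<in> A" "P \<in> fst c'" "snd c' P = 0"
    and f: "analytic1_at f 0" "analytic1_at f' 0"
    using n n' unfolding A2_normal_form_def coords_centred_at_def by auto
  have ch: "is_chart X c" "is_chart X c'" using S c c' unfolding analytic_surface_def by blast+
  have PX: "P \<in> topspace X" using is_chart_openin[OF ch(1)] c(2) openin_subset by blast
  define \<phi> where "\<phi> = transition c c'"
  define u where "u = fst \<circ> \<phi>"
  define v where "v = snd \<circ> \<phi>"
  have ov: "0 \<in> overlap c c'" unfolding overlap_def using c c' by (metis IntI imageI)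
  have uv: "analytic2_at u 0" "analytic2_at v 0"
    using S c(1) c'(1) ov unfolding u_def v_def \<phi>_def analytic_surface_def analytic_compatible_def analytic_transition_def by blast+
  have "\<phi> 0 = 0" unfolding \<phi>_def transition_def using chart_inv_left[OF ch(1) c(2)] c(3) c'(3) by simp
  then have uv0: "u 0 = 0" "v 0 = 0" by (simp_all add: u_def v_def)
  have \<phi>: "\<phi> z = (u z, v z)" for z by (simp add: u_def v_def)
  obtain h where h: "analytic1_at h 0" "deriv h 0 \<noteq> 0" "\<forall>\<^sub>F q in nhdsin X P. G q = h ((cusp \<circ> snd c) q)"
    using n unfolding A2_normal_form_def fibration_defined_by_def by blast
  obtain h' where h': "analytic1_at h' 0" "deriv h' 0 \<noteq> 0" "\<forall>\<^sub>F q in nhdsin X P. G q = h' ((cusp \<circ> snd c') q)"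
    using n' unfolding A2_normal_form_def fibration_defined_by_def by blast
  have hh: "h 0 = h' 0"
    using eventually_nhdsin_at[OF h(3) PX] eventually_nhdsin_at[OF h'(3) PX] c(3) c'(3) by (simp add: cusp_eq)
  \<comment> \<open>From h(H) = h'(H') one gets H' = k(H) by inverting h'. The common value of h and
    h' at 0, obtained by evaluating at P, is subtracted so that the inversion takes place at
    0.\<close>
  define h2 where "h2 = (\<lambda>t. h' t - h' 0)"
  have h2: "analytic1_at h2 0" "h2 0 = 0" unfolding h2_def by (auto intro: analytic1_diff h' analytic1_const)
  have "(h2 has_field_derivative deriv h' 0) (at 0)"
    unfolding h2_def by (auto intro!: derivative_eq_intros analytic1_deriv(1)[OF h'(1)])
  then have h2': "deriv h2 0 \<noteq> 0" using h'(2) by (simp add: DERIV_imp_deriv)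
  obtain m where m: "analytic1_at m 0" "m 0 = 0" "deriv m 0 \<noteq> 0" "\<forall>\<^sub>F t in nhds 0. m (h2 t) = t" "\<forall>\<^sub>F t in nhds 0. h2 (m t) = t"
    by (rule analytic1_inverse_function[OF h2 h2'])
  define k where "k = (\<lambda>t. m (h t - h 0))"
  have k: "analytic1_at k 0" "k 0 = 0"
  proof -
    show "k 0 = 0" by (simp add: k_def m)
    show "analytic1_at k 0" unfolding k_def
      by (rule analytic1_compose[of m "\<lambda>t. h t - h 0" 0]) (auto simp: m intro: analytic1_diff h analytic1_const)
  qed
  have \<phi>l: "filterlim \<phi> (nhds 0) (nhds 0)"
  proof -
    have "isCont (\<lambda>z. (u z, v z)) 0" by (intro continuous_intros analytic2_isCont uv)
    then have "isCont \<phi> 0" by (simp add: \<phi>[abs_def])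
    then show ?thesis using tendsto_at_iff_tendsto_nhds[of \<phi> 0] by (simp add: isCont_def \<open>\<phi> 0 = 0\<close>)
  qed
  have inv_ev: "\<forall>\<^sub>F z in nhds 0. z \<in> snd c ` fst c \<and> Q (chart_inv c z)" if "\<forall>\<^sub>F q in nhdsin X P. Q q" for Q
    using eventually_chart_inv[OF ch(1) c(2) that] c(3) by simp
  have eq: "\<forall>\<^sub>F z in nhds 0. cusp (u z, v z) = k (cusp z)"
    using inv_ev[OF h(3)] inv_ev[OF h'(3)] eventually_compose_filterlim[OF eventually_cusp[OF m(4)] \<phi>l]
  proof eventually_elim
    case (elim z)
    obtain q where q: "q \<in> fst c" "z = snd c q" using elim(1) by blast
    have qi: "chart_inv c z = q" using chart_inv_left[OF ch(1) q(1)] q(2) by simp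
    have "\<phi> z = snd c' q" by (simp add: \<phi>_def transition_def qi)
    then have "h' (cusp (\<phi> z)) = h (cusp z)" using elim(1,2) qi q(2) by simp
    then have "h2 (cusp (\<phi> z)) = h (cusp z) - h 0" by (simp add: h2_def hh)
    then have "k (cusp z) = m (h2 (cusp (\<phi> z)))" by (simp add: k_def)
    then show ?case using elim(3) by (simp add: \<phi>)
  qed
  have form: "\<forall>\<^sub>F z in nhds 0. area_density \<omega> d z = 1 + g (cusp z) * snd z"
    if "A2_normal_form X A \<omega> P G d g" for d g
  proof -
    have "\<forall>\<^sub>F (x, y) in nhds 0. \<forall>v w. \<omega> d (x, y) v w = dx_wedge_dy v w + g (y ^ 3 - x ^ 2) * y * dx_wedge_dy v w"
      using that unfolding A2_normal_form_def by blast
    then show ?thesis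
      by eventually_elim (auto simp: area_density_def cusp_def dx_wedge_dy_def)
  qed
  have area: "\<forall>\<^sub>F z in nhds 0. (1 + f' (cusp (u z, v z)) * v z) * jac u v z = 1 + f (cusp z) * snd z"
    using form[OF n] eventually_compose_filterlim[OF form[OF n'] \<phi>l] eventually_nhds_in_open[OF open_overlap[OF ch] ov]
  proof eventually_elim
    case (elim z)
    have "area_density \<omega> c z = area_density \<omega> c' (\<phi> z) * jac u v z"
      unfolding u_def v_def \<phi>_def by (rule area_density_transition[OF S \<omega>2 c(1) c'(1) elim(3)])
    then show ?case using elim(1,2) by (simp add: \<phi>)
  qed
  show ?thesis by (rule cusp_area_rigidity[OF uv(1) uv0(1) uv(2) uv0(2) k f eq area])
qed

theorem proposition4p12:
  fixes X :: "'a topology" and A :: "'a chart set" and \<omega> :: "'a form2_field"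
    and P :: 'a and W :: "'a set" and G :: "'a \<Rightarrow> real"
  assumes "analytic_surface X A"
    and "symplectic_form A \<omega>"
    and "openin X W" and "P \<in> W"
    and "analytic_fun_on A W G"
    and "A2_singularity X A P G"
  shows "(\<exists>c f. A2_normal_form X A \<omega> P G c f) \<and>
         (\<forall>c f c' f'. A2_normal_form X A \<omega> P G c f \<and> A2_normal_form X A \<omega> P G c' f' \<longrightarrow>
            (\<forall>\<^sub>F t in nhds 0. f t = f' t))"
  using A2_normal_form_exists[OF assms(1,2,6)] A2_normal_form_unique[OF assms(1,2)] by blast

end
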